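(* Suppose the following five assumptions hold. (1) There is a constant $K_1$ independent of $n$ with $p_n/n\le K_1$. (2) There is a constant $K_2$ independent of $n$ with $\frac1{p_n}\sum_{i=1}^{p_n}\mathbb{E}[(y_{i1}^n)^8]\le K_2$ and $\mathbb{E}\big[\langle X_1^n(X_1^n)^T,T_n^{(k)}\rangle_n^4\big]\le K_2$ for all $1\le k\le N_n$. (3) $N_n=o(n)$. (4) $\displaystyle\lim_{n\to\infty}\frac{p_n^2}{n}\times\frac{\sum_{(i,j,k,l)\in Q_n}\big(\mathrm{Cov}[\tilde y_{i1}^n\tilde y_{j1}^n,\tilde y_{k1}^n\tilde y_{l1}^n]\big)^2}{|Q_n|}=0$. (5) For each $n$, $\mathbb{P}_n\big[\lVert S_n\rVert_n^2-\sum_{k=1}^{N_n}\langle S_n,T_n^{(k)}\rangle_n^2=0\big]=0$. Then, both in the known mean setting and in the unknown mean setting, the bona fide estimator $S_n^*$ converges to the oracle estimator $\Sigma_n^*$ in quadratic mean: $$\mathbb{E}\big[\lVert S_n^*-\Sigma_n^*\rVert_n^2\big]\longrightarrow 0 \quad (n\to\infty).$$ Consequently, $S_n^*$ has asymptotically the same loss as $\Sigma_n^*$: $$\mathbb{E}\Big[\big|\lVert S_n^*-\Sigma_n\rVert_n^2-\lVert\Sigma_n^*-\Sigma_n\rVert_n^2\big|\Big]\longrightarrow 0 .$$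
   Context: Observations: for each $n$, $X_n$ is a random real $p_n\times n$ matrix whose columns $X_1^n,\dots,X_n^n$ are i.i.d. observations of a $p_n$-dimensional random vector with covariance matrix $\Sigma_n=\Gamma_n\Lambda_n\Gamma_n^T$, $\Lambda_n$ diagonal and $\Gamma_n$ a rotation matrix. $Y_n=\Gamma_n^TX_n$; $y_{i1}^n$ is the $i$-th coordinate of the first column of $Y_n$, and $\tilde y_{i1}^n=y_{i1}^n-\mathbb{E}[y_{i1}^n]$. $Q_n$ is the set of all quadruples made of four distinct integers between $1$ and $p_n$. $\mathbb{P}_n$ is the probability of the distribution indexed by $n$. Norm: for $p_n\times p_n$ matrices, $\langle A,B\rangle_n=\mathrm{Tr}(AB^T)/p_n$, $\lVert A\rVert_n=\sqrt{\langle A,A\rangle_n}$. Targets: for each $n$, $T_n^{(1)},\dots,T_n^{(N_n)}$ ($N_n\in\mathbb{N}^*$) are deterministic symmetric $p_n\times p_n$ matrices, not necessarily positive, orthonormal for $\langle\cdot,\cdot\rangle_n$. Sample covariance: known mean: $S_n=(X_n-\mathbb{E}[X_n])(X_n-\mathbb{E}[X_n])^T/n$. Unknown mean: $S_n=\tilde X_n\tilde X_n^T/(n-1)$, with $(\tilde X_n)_{ik}=(X_n)_{ik}-\frac1n\sum_{k'=1}^n(X_n)_{ik'}$; $\tilde X^n_{\cdot k}$ is the $k$-th column of $\tilde X_n$. Let $\mathcal{P}_{\mathcal{S}_n^+}$ be the orthogonal projection (for $\langle\cdot,\cdot\rangle_n$) onto the cone of symmetric positive semi-definite $p_n\times p_n$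 matrices, and $d_n^2=\lVert S_n\rVert_n^2-\sum_{k=1}^{N_n}\langle S_n,T_n^{(k)}\rangle_n^2$. Oracle estimator: $\Sigma_n^*=\mathcal{P}_{\mathcal{S}_n^+}\big(c_0^*S_n+\sum_{k=1}^{N_n}c_k^*T_n^{(k)}\big)$ with $c_0^*=\frac1{d_n^2}\big(\langle S_n,\Sigma_n\rangle_n-\sum_{k=1}^{N_n}\langle S_n,T_n^{(k)}\rangle_n\langle\Sigma_n,T_n^{(k)}\rangle_n\big)$ and $c_i^*=\langle\Sigma_n,T_n^{(i)}\rangle_n-c_0^*\langle S_n,T_n^{(i)}\rangle_n$ for $1\le i\le N_n$. Variance estimators, known mean ($n\ge2$): with $Z_k=X_k^n-\mathbb{E}[X_k^n]$, $$\hat{\mathbb{V}}(S_n)=\frac1{n(n-1)}\sum_{k=1}^n\lVert Z_kZ_k^T-S_n\rVert_n^2,\qquad \hat{\mathbb{V}}(\langle S_n,T_n^{(i)}\rangle_n)=\frac1{n(n-1)}\sum_{k=1}^n\langle Z_kZ_k^T-S_n,T_n^{(i)}\rangle_n^2 .$$ Variance estimators, unknown mean ($n\ge4$): with $\bar b_n^2=\frac1{n^2}\sum_{k=1}^n\big\lVert\frac n{n-1}\tilde X^n_{\cdot k}(\tilde X^n_{\cdot k})^T-S_n\big\rVert_n^2$, $$\hat{\mathbb{V}}(S_n)=\frac{(n-1)^2}{(n-2)(n-3)}\bar b_n^2-\frac1{n(n-2)}\lVert S_n\rVert_n^2-\frac{n-1}{n(n-2)(n-3)}p_n\langle S_n,I_{p_n}\rangle_n^2,$$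 $$\hat{\mathbb{V}}(\langle S_n,T_n^{(i)}\rangle_n)=q_n^{(0)}\bar b_{T^{(i)},n}^2+q_n^{(1)}\langle S_nT_n^{(i)},T_n^{(i)}S_n\rangle_n-q_n^{(2)}\langle S_n,T_n^{(i)}\rangle_n^2,$$ where $\bar b_{T^{(i)},n}^2=\frac{p_n}{(n-1)^2}\sum_{k=1}^n\langle\tilde X^n_{\cdot k}(\tilde X^n_{\cdot k})^T,T_n^{(i)}\rangle_n^2-\frac1n\langle S_nT_n^{(i)},T_n^{(i)}S_n\rangle_n$, $q_n^{(0)}=\frac{(n-1)^2}{p_n(n-2)(n-3)}$, $q_n^{(1)}=\frac{n-1}{p_nn(n-2)}$, $q_n^{(2)}=\frac{n^2-2n-1}{n(n-2)(n-3)}$. Bona fide estimator: let $$\hat c_0=\frac1{d_n^2}\Big(\lVert S_n\rVert_n^2-\hat{\mathbb{V}}(S_n)-\sum_{k=1}^{N_n}\big(\langle S_n,T_n^{(k)}\rangle_n^2-\hat{\mathbb{V}}(\langle S_n,T_n^{(k)}\rangle_n)\big)\Big),\qquad c_0=\min\big((\hat c_0)_+,1\big),$$ where $(x)_+=\max(x,0)$, and $$S_n^*=\mathcal{P}_{\mathcal{S}_n^+}\Big(c_0S_n+(1-c_0)\sum_{i=1}^{N_n}\langle S_n,T_n^{(i)}\rangle_nT_n^{(i)}\Big).$$ *)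

theory Defs
  imports "HOL-Probability.Probability" "HOL-Library.Landau_Symbols"
    "Jordan_Normal_Form.Determinant"
begin

(* The dimensions vary with n, so matrices are carrier-based ("real mat").  Rows, columns,
   coordinates and targets are numbered from 0: the first column of X n is column 0, and the
   targets of index n are T n 0, ..., T n (N n - 1). *)

section \<open>Deterministic matrices\<close>

definition inner_mat :: "nat \<Rightarrow> real mat \<Rightarrow> real mat \<Rightarrow> real" where
  "inner_mat p A B = (\<Sum>i<p. (A * transpose_mat B) $$ (i, i)) / real p"

definition norm_mat :: "nat \<Rightarrow> real mat \<Rightarrow> real" where
  "norm_mat p A = sqrt (inner_mat p A A)"

definition rotation_mat :: "nat \<Rightarrow> real mat \<Rightarrow> bool" where
  "rotation_mat p A \<longleftrightarrow>
     A \<in> carrier_mat p p \<and> transpose_mat A * A = 1\<^sub>m p \<and> Determinant.det A = 1"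

definition psd_cone :: "nat \<Rightarrow> real mat set" where
  "psd_cone p = {A \<in> carrier_mat p p. transpose_mat A = A \<and>
     (\<forall>x \<in> carrier_vec p. scalar_prod x (A *\<^sub>v x) \<ge> 0)}"

(* The cone is closed and convex, so the nearest point exists and is unique if A is p x p. *)
definition psd_proj :: "nat \<Rightarrow> real mat \<Rightarrow> real mat" where
  "psd_proj p A = (THE B. B \<in> psd_cone p \<and>
     (\<forall>C \<in> psd_cone p. norm_mat p (A - B) \<le> norm_mat p (A - C)))"

definition lin_comb :: "nat \<Rightarrow> nat \<Rightarrow> (nat \<Rightarrow> real) \<Rightarrow> (nat \<Rightarrow> real mat) \<Rightarrow> real mat" where
  "lin_comb p N c T = Matrix.mat p p (\<lambda>(i, j). \<Sum>k<N. c k * T k $$ (i, j))"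

definition outer_col :: "real mat \<Rightarrow> nat \<Rightarrow> real mat" where
  "outer_col A k =
     Matrix.mat (dim_row A) (dim_row A) (\<lambda>(i, j). A $$ (i, k) * A $$ (j, k))"

definition targets :: "nat \<Rightarrow> nat \<Rightarrow> (nat \<Rightarrow> real mat) \<Rightarrow> bool" where
  "targets p N T \<longleftrightarrow>
     (\<forall>k<N. T k \<in> carrier_mat p p \<and> transpose_mat (T k) = T k) \<and>
     (\<forall>k<N. \<forall>l<N. inner_mat p (T k) (T l) = (if k = l then 1 else 0))"

(* Ordered quadruples.  For p < 4 the set is empty, and an average over it is 0 / 0 = 0. *)
definition quadruples :: "nat \<Rightarrow> (nat \<times> nat \<times> nat \<times> nat) set" where
  "quadruples p = {(i, j, k, l). i < p \<and> j < p \<and> k < p \<and> l < p \<and> distinct [i, j, k, l]}"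

section \<open>Random matrices\<close>

definition col_rv :: "('a \<Rightarrow> real mat) \<Rightarrow> nat \<Rightarrow> nat \<Rightarrow> 'a \<Rightarrow> nat \<Rightarrow> real" where
  "col_rv X p k \<omega> = (\<lambda>i\<in>{..<p}. X \<omega> $$ (i, k))"

definition iid_columns :: "'a measure \<Rightarrow> ('a \<Rightarrow> real mat) \<Rightarrow> nat \<Rightarrow> nat \<Rightarrow> bool" where
  "iid_columns M X p n \<longleftrightarrow>
     prob_space.indep_vars M (\<lambda>_. PiM {..<p} (\<lambda>_. borel)) (col_rv X p) {..<n} \<and>
     (\<forall>k<n. distr M (PiM {..<p} (\<lambda>_. borel)) (col_rv X p k) =
            distr M (PiM {..<p} (\<lambda>_. borel)) (col_rv X p 0))"

definition covar :: "'a measure \<Rightarrow> ('a \<Rightarrow> real) \<Rightarrow> ('a \<Rightarrow> real) \<Rightarrow> real" where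
  "covar M f g = integral\<^sup>L M (\<lambda>\<omega>. (f \<omega> - integral\<^sup>L M f) * (g \<omega> - integral\<^sup>L M g))"

definition mean_mat :: "'a measure \<Rightarrow> nat \<Rightarrow> nat \<Rightarrow> ('a \<Rightarrow> real mat) \<Rightarrow> real mat" where
  "mean_mat M p n X = Matrix.mat p n (\<lambda>(i, k). integral\<^sup>L M (\<lambda>\<omega>. X \<omega> $$ (i, k)))"

definition cov_mat :: "'a measure \<Rightarrow> nat \<Rightarrow> ('a \<Rightarrow> real mat) \<Rightarrow> real mat" where
  "cov_mat M p X =
     Matrix.mat p p (\<lambda>(i, j). covar M (\<lambda>\<omega>. X \<omega> $$ (i, 0)) (\<lambda>\<omega>. X \<omega> $$ (j, 0)))"

definition y_coord :: "real mat \<Rightarrow> ('a \<Rightarrow> real mat) \<Rightarrow> nat \<Rightarrow> 'a \<Rightarrow> real" where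
  "y_coord G X i \<omega> = (transpose_mat G * X \<omega>) $$ (i, 0)"

definition y_centred :: "'a measure \<Rightarrow> real mat \<Rightarrow> ('a \<Rightarrow> real mat) \<Rightarrow> nat \<Rightarrow> 'a \<Rightarrow> real" where
  "y_centred M G X i \<omega> = y_coord G X i \<omega> - integral\<^sup>L M (y_coord G X i)"

section \<open>Sample covariance and variance estimators\<close>

datatype mean_setting = Known_Mean | Unknown_Mean

(* Smallest sample size for which the variance estimators are defined. *)
fun min_size :: "mean_setting \<Rightarrow> nat" where
  "min_size Known_Mean = 2"
| "min_size Unknown_Mean = 4"

definition centre_cols :: "nat \<Rightarrow> nat \<Rightarrow> real mat \<Rightarrow> real mat" where
  "centre_cols p n A = Matrix.mat p n (\<lambda>(i, k). A $$ (i, k) - (\<Sum>k'<n. A $$ (i, k')) / real n)"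

fun centred_obs ::
  "mean_setting \<Rightarrow> 'a measure \<Rightarrow> nat \<Rightarrow> nat \<Rightarrow> ('a \<Rightarrow> real mat) \<Rightarrow> 'a \<Rightarrow> real mat" where
  "centred_obs Known_Mean M p n X \<omega> = X \<omega> - mean_mat M p n X"
| "centred_obs Unknown_Mean M p n X \<omega> = centre_cols p n (X \<omega>)"

(* In what follows Z is the p x n matrix of centred observations given by centred_obs. *)

fun sample_cov :: "mean_setting \<Rightarrow> nat \<Rightarrow> real mat \<Rightarrow> real mat" where
  "sample_cov Known_Mean n Z = (1 / real n) \<cdot>\<^sub>m (Z * transpose_mat Z)"
| "sample_cov Unknown_Mean n Z = (1 / (real n - 1)) \<cdot>\<^sub>m (Z * transpose_mat Z)"

definition b_bar_sq :: "nat \<Rightarrow> nat \<Rightarrow> real mat \<Rightarrow> real" where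
  "b_bar_sq p n Z = 1 / (real n)^2 *
     (\<Sum>k<n. (norm_mat p ((real n / (real n - 1)) \<cdot>\<^sub>m outer_col Z k
                            - sample_cov Unknown_Mean n Z))^2)"

definition b_bar_target_sq :: "nat \<Rightarrow> nat \<Rightarrow> real mat \<Rightarrow> real mat \<Rightarrow> real" where
  "b_bar_target_sq p n Z T =
     (let S = sample_cov Unknown_Mean n Z in
      real p / (real n - 1)^2 * (\<Sum>k<n. (inner_mat p (outer_col Z k) T)^2)
      - 1 / real n * inner_mat p (S * T) (T * S))"

definition q0 :: "nat \<Rightarrow> nat \<Rightarrow> real" where
  "q0 p n = (real n - 1)^2 / (real p * (real n - 2) * (real n - 3))"

definition q1 :: "nat \<Rightarrow> nat \<Rightarrow> real" where
  "q1 p n = (real n - 1) / (real p * real n * (real n - 2))"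

definition q2 :: "nat \<Rightarrow> real" where
  "q2 n = ((real n)^2 - 2 * real n - 1) / (real n * (real n - 2) * (real n - 3))"

fun var_est :: "mean_setting \<Rightarrow> nat \<Rightarrow> nat \<Rightarrow> real mat \<Rightarrow> real" where
  "var_est Known_Mean p n Z =
     1 / (real n * (real n - 1)) *
       (\<Sum>k<n. (norm_mat p (outer_col Z k - sample_cov Known_Mean n Z))^2)"
| "var_est Unknown_Mean p n Z =
     (let S = sample_cov Unknown_Mean n Z in
      (real n - 1)^2 / ((real n - 2) * (real n - 3)) * b_bar_sq p n Z
      - 1 / (real n * (real n - 2)) * (norm_mat p S)^2
      - (real n - 1) / (real n * (real n - 2) * (real n - 3))
          * real p * (inner_mat p S (1\<^sub>m p))^2)"

fun var_est_target :: "mean_setting \<Rightarrow> nat \<Rightarrow> nat \<Rightarrow> real mat \<Rightarrow> real mat \<Rightarrow> real" where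
  "var_est_target Known_Mean p n Z T =
     1 / (real n * (real n - 1)) *
       (\<Sum>k<n. (inner_mat p (outer_col Z k - sample_cov Known_Mean n Z) T)^2)"
| "var_est_target Unknown_Mean p n Z T =
     (let S = sample_cov Unknown_Mean n Z in
      q0 p n * b_bar_target_sq p n Z T
      + q1 p n * inner_mat p (S * T) (T * S)
      - q2 n * (inner_mat p S T)^2)"

section \<open>Oracle and bona fide estimators\<close>

definition d_sq :: "nat \<Rightarrow> nat \<Rightarrow> (nat \<Rightarrow> real mat) \<Rightarrow> real mat \<Rightarrow> real" where
  "d_sq p N T S = (norm_mat p S)^2 - (\<Sum>k<N. (inner_mat p S (T k))^2)"

definition oracle_c0 ::
  "nat \<Rightarrow> nat \<Rightarrow> (nat \<Rightarrow> real mat) \<Rightarrow> real mat \<Rightarrow> real mat \<Rightarrow> real" where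
  "oracle_c0 p N T \<Sigma> S = 1 / d_sq p N T S *
     (inner_mat p S \<Sigma> - (\<Sum>k<N. inner_mat p S (T k) * inner_mat p \<Sigma> (T k)))"

definition oracle_c ::
  "nat \<Rightarrow> nat \<Rightarrow> (nat \<Rightarrow> real mat) \<Rightarrow> real mat \<Rightarrow> real mat \<Rightarrow> nat \<Rightarrow> real" where
  "oracle_c p N T \<Sigma> S i =
     inner_mat p \<Sigma> (T i) - oracle_c0 p N T \<Sigma> S * inner_mat p S (T i)"

definition oracle_est ::
  "nat \<Rightarrow> nat \<Rightarrow> (nat \<Rightarrow> real mat) \<Rightarrow> real mat \<Rightarrow> real mat \<Rightarrow> real mat" where
  "oracle_est p N T \<Sigma> S =
     psd_proj p (oracle_c0 p N T \<Sigma> S \<cdot>\<^sub>m S + lin_comb p N (oracle_c p N T \<Sigma> S) T)"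

definition c0_hat ::
  "mean_setting \<Rightarrow> nat \<Rightarrow> nat \<Rightarrow> nat \<Rightarrow> (nat \<Rightarrow> real mat) \<Rightarrow> real mat \<Rightarrow> real" where
  "c0_hat s p n N T Z =
     (let S = sample_cov s n Z in
      1 / d_sq p N T S *
       ((norm_mat p S)^2 - var_est s p n Z
        - (\<Sum>k<N. (inner_mat p S (T k))^2 - var_est_target s p n Z (T k))))"

definition bona_fide_c0 ::
  "mean_setting \<Rightarrow> nat \<Rightarrow> nat \<Rightarrow> nat \<Rightarrow> (nat \<Rightarrow> real mat) \<Rightarrow> real mat \<Rightarrow> real" where
  "bona_fide_c0 s p n N T Z = min (max (c0_hat s p n N T Z) 0) 1"

definition bona_fide_est ::
  "mean_setting \<Rightarrow> nat \<Rightarrow> nat \<Rightarrow> nat \<Rightarrow> (nat \<Rightarrow> real mat) \<Rightarrow> real mat \<Rightarrow> real mat" where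
  "bona_fide_est s p n N T Z =
     (let S = sample_cov s n Z; c0 = bona_fide_c0 s p n N T Z in
      psd_proj p (c0 \<cdot>\<^sub>m S + (1 - c0) \<cdot>\<^sub>m lin_comb p N (\<lambda>i. inner_mat p S (T i)) T))"

(* The Bochner integral of a non-integrable function is 0, so finiteness of the expectations
   is required explicitly. *)
definition mean_tends_to_zero :: "nat \<Rightarrow> (nat \<Rightarrow> 'a measure) \<Rightarrow> (nat \<Rightarrow> 'a \<Rightarrow> real) \<Rightarrow> bool" where
  "mean_tends_to_zero n0 M f \<longleftrightarrow>
     (\<forall>n\<ge>n0. integrable (M n) (f n)) \<and> (\<lambda>n. integral\<^sup>L (M n) (f n)) \<longlonglongrightarrow> 0"

end

theory Submission
  imports Defs
begin

text \<open>
  All matrices are compared in \<open>\<langle>A, B\<rangle> = Tr (A B\<^sup>T) / p\<close>, with norm \<open>\<parallel>A\<parallel>\<close>; \<open>A\<^sup>\<bottom>\<close> is the component of \<open>A\<close>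
  orthogonal to the targets \<open>T\<^sub>1, \<dots>, T\<^sub>N\<close>, and \<open>\<Sigma>\<close> is the covariance matrix of the observations.

  Before projection, the oracle and the bona fide estimator both have the form "multiple of \<open>S\<^sup>\<bottom>\<close> plus
  combination of the targets".  The projection on a convex cone is nonexpansive, so by Pythagoras the
  squared distance of the estimators is at most
  \<open>(c\<^sub>0 - c\<^sub>0\<^sup>*)\<^sup>2 \<parallel>S\<^sup>\<bottom>\<parallel>\<^sup>2 + \<Sum>\<^sub>k \<langle>S - \<Sigma>, T\<^sub>k\<rangle>\<^sup>2\<close>.
  Let \<open>a = \<parallel>\<Sigma>\<^sup>\<bottom>\<parallel>\<^sup>2\<close> and let \<open>v\<close> be the typical value of \<open>\<parallel>S - \<Sigma>\<parallel>\<^sup>2\<close>.  Then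
  \<open>\<parallel>S\<^sup>\<bottom>\<parallel>\<^sup>2\<close> is close to \<open>a + v\<close>, and the numerators of \<open>c\<^sub>0\<close> and of \<open>c\<^sub>0\<^sup>*\<close> are both close to
  \<open>a\<close>.  Lemma \<open>clamped_ratio_bound\<close> turns these approximations, in mean, into a bound on
  \<open>(c\<^sub>0 - c\<^sub>0\<^sup>*)\<^sup>2 \<parallel>S\<^sup>\<bottom>\<parallel>\<^sup>2\<close> that does not degenerate when \<open>\<parallel>S\<^sup>\<bottom>\<parallel>\<close> is small.  Hence, as
  \<open>estimator_distance_le\<close> makes precise, it is enough that five quantities vanish in mean:
  \<open>\<parallel>S - \<Sigma>\<parallel>\<^sup>2 - v\<close>, the estimator of the variance of \<open>S\<close> minus \<open>v\<close>, the sum of the estimators of the variances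
  of the \<open>\<langle>S, T\<^sub>k\<rangle>\<close>, \<open>\<langle>S - \<Sigma>, \<Sigma>\<^sup>\<bottom>\<rangle>\<close>, and \<open>\<Sum>\<^sub>k \<langle>S - \<Sigma>, T\<^sub>k\<rangle>\<^sup>2\<close>.

  One number controls all of them.  Let \<open>u = z z\<^sup>T - \<Sigma>\<close> for a centred observation \<open>z\<close>, and let \<open>\<Psi>\<close>
  (\<open>dev_power\<close>) be the normalised squared Frobenius norm of the covariance of \<open>u\<close>, that is the mean of
  \<open>\<langle>u\<^sub>1, u\<^sub>2\<rangle>\<^sup>2\<close> over two independent observations.  It does not depend on the orthonormal basis.  In the
  eigenbasis, quadruples of distinct indices are controlled by the hypothesis on the covariances, and the
  \<open>O(p\<^sup>3)\<close> remaining ones by eighth moments, so \<open>\<Psi> = O(n)\<close> (\<open>dev_power_bound\<close>).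

  For a known mean, \<open>S - \<Sigma>\<close> is the average of the \<open>u\<^sub>k\<close>.  The off-diagonal part of
  \<open>\<parallel>S - \<Sigma>\<parallel>\<^sup>2\<close> is a degenerate double sum, with second moment \<open>O(\<Psi> / n\<^sup>2)\<close>, and its diagonal part is an
  average of independent terms, so both concentrate (\<open>mean_dev_norm_sq\<close>).  By Cauchy--Schwarz on
  quadratic forms, the mean of \<open>\<Sum>\<^sub>k \<langle>S - \<Sigma>, T\<^sub>k\<rangle>\<^sup>2\<close> is at most
  \<open>\<surd>(N \<Psi>) / n = O(\<surd>(N / n))\<close>, which is where \<open>N = o(n)\<close> enters; the same argument with \<open>\<Sigma>\<^sup>\<bottom>\<close> in
  place of the targets handles \<open>\<langle>S - \<Sigma>, \<Sigma>\<^sup>\<bottom>\<rangle>\<close>.  The estimator of the variance of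
  \<open>S\<close> is the diagonal part up to \<open>O(1 / n)\<close>, and the sum of the estimators for the targets is controlled by
  \<open>1 / n\<close> times the average over the sample of \<open>\<Sum>\<^sub>k \<langle>z z\<^sup>T, T\<^sub>k\<rangle>\<^sup>2\<close>.

  An unknown mean is a perturbation: the empirical mean \<open>m\<close> of the centred observations satisfies
  \<open>E \<bar>m\<bar>\<^sup>4 = O(p\<^sup>2 / n\<^sup>2)\<close>, so replacing \<open>z\<^sub>k\<close> by \<open>z\<^sub>k - m\<close> changes all these quantities by terms that
  vanish in mean.
\<close>

section \<open>The normalised Frobenius inner product\<close>

text \<open>Working with families of entries instead of matrices removes dimension side conditions from all the
  linear algebra.\<close>
definition entry_prod :: "nat \<Rightarrow> (nat \<times> nat \<Rightarrow> real) \<Rightarrow> (nat \<times> nat \<Rightarrow> real) \<Rightarrow> real" where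
  "entry_prod p f g = (\<Sum>a\<in>{..<p} \<times> {..<p}. f a * g a) / real p"

lemma entry_prod_cong:
  assumes "\<And>i j. i < p \<Longrightarrow> j < p \<Longrightarrow> f (i, j) = f' (i, j)"
    and "\<And>i j. i < p \<Longrightarrow> j < p \<Longrightarrow> g (i, j) = g' (i, j)"
  shows "entry_prod p f g = entry_prod p f' g'"
  unfolding entry_prod_def by (intro arg_cong2[where f = "(/)"] sum.cong) (auto simp: assms)

lemma entry_prod_commute: "entry_prod p f g = entry_prod p g f"
  by (simp add: entry_prod_def mult.commute)

lemma entry_prod_add_left: "entry_prod p (\<lambda>a. f a + g a) h = entry_prod p f h + entry_prod p g h"
  by (simp add: entry_prod_def sum.distrib distrib_right add_divide_distrib)

lemma entry_prod_diff_left: "entry_prod p (\<lambda>a. f a - g a) h = entry_prod p f h - entry_prod p g h"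
  by (simp add: entry_prod_def sum_subtractf left_diff_distrib diff_divide_distrib)

lemma entry_prod_scale_left: "entry_prod p (\<lambda>a. c * f a) h = c * entry_prod p f h"
  by (simp add: entry_prod_def sum_distrib_left mult.assoc)

lemma entry_prod_sum_left: "entry_prod p (\<lambda>a. \<Sum>k\<in>K. f k a) h = (\<Sum>k\<in>K. entry_prod p (f k) h)"
  unfolding entry_prod_def sum_distrib_right sum_divide_distrib by (rule sum.swap)

lemma entry_prod_add_right: "entry_prod p h (\<lambda>a. f a + g a) = entry_prod p h f + entry_prod p h g"
  using entry_prod_add_left by (simp add: entry_prod_commute[of p h])

lemma entry_prod_diff_right: "entry_prod p h (\<lambda>a. f a - g a) = entry_prod p h f - entry_prod p h g"
  using entry_prod_diff_left by (simp add: entry_prod_commute[of p h])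

lemma entry_prod_scale_right: "entry_prod p h (\<lambda>a. c * f a) = c * entry_prod p h f"
  using entry_prod_scale_left by (simp add: entry_prod_commute[of p h])

lemma entry_prod_sum_right: "entry_prod p h (\<lambda>a. \<Sum>k\<in>K. f k a) = (\<Sum>k\<in>K. entry_prod p h (f k))"
  using entry_prod_sum_left by (simp add: entry_prod_commute[of p h])

lemmas entry_prod_linear =
  entry_prod_add_left entry_prod_add_right entry_prod_diff_left entry_prod_diff_right
  entry_prod_scale_left entry_prod_scale_right entry_prod_sum_left entry_prod_sum_right

lemma entry_prod_nonneg: "0 \<le> entry_prod p f f"
  by (simp add: entry_prod_def sum_nonneg)

lemma entry_prod_Cauchy_Schwarz: "(entry_prod p f g)^2 \<le> entry_prod p f f * entry_prod p g g"
proof -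
  have "(\<Sum>a\<in>{..<p} \<times> {..<p}. f a * g a)^2
      \<le> (\<Sum>a\<in>{..<p} \<times> {..<p}. (f a)^2) * (\<Sum>a\<in>{..<p} \<times> {..<p}. (g a)^2)"
    by (rule Cauchy_Schwarz_ineq_sum)
  then show ?thesis
    by (simp add: entry_prod_def power_divide power2_eq_square divide_right_mono)
qed

lemma entry_prod_add_sq_le:
  "entry_prod p (\<lambda>a. f a + g a) (\<lambda>a. f a + g a) \<le> 2 * entry_prod p f f + 2 * entry_prod p g g"
proof -
  have "0 \<le> entry_prod p (\<lambda>a. f a - g a) (\<lambda>a. f a - g a)" by (rule entry_prod_nonneg)
  then show ?thesis by (simp add: entry_prod_linear entry_prod_commute[of p g f])
qed

text \<open>The cross term is bounded by Cauchy--Schwarz; thus a perturbation that vanishes in mean square does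
  not change the limit of a squared norm that is bounded in mean.\<close>
lemma entry_prod_add_sq_diff:
  "\<bar>entry_prod p (\<lambda>a. f a + g a) (\<lambda>a. f a + g a) - entry_prod p f f\<bar>
   \<le> entry_prod p g g + 2 * (sqrt (entry_prod p f f) * sqrt (entry_prod p g g))"
proof -
  have "\<bar>entry_prod p f g\<bar> \<le> sqrt (entry_prod p f f) * sqrt (entry_prod p g g)"
    using real_sqrt_le_mono[OF entry_prod_Cauchy_Schwarz[of p f g]]
    by (simp add: real_sqrt_mult)
  then show ?thesis using entry_prod_nonneg[of p g]
    by (simp add: entry_prod_linear entry_prod_commute[of p g f])
qed

definition orthonormal :: "nat \<Rightarrow> nat \<Rightarrow> (nat \<Rightarrow> nat \<times> nat \<Rightarrow> real) \<Rightarrow> bool" where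
  "orthonormal p N t \<longleftrightarrow> (\<forall>k<N. \<forall>l<N. entry_prod p (t k) (t l) = (if k = l then 1 else 0))"

lemma entry_prod_orthonormal_comb:
  assumes "orthonormal p N t" "l < N"
  shows "entry_prod p (\<lambda>a. \<Sum>k<N. c k * t k a) (t l) = c l"
proof -
  have "entry_prod p (\<lambda>a. \<Sum>k<N. c k * t k a) (t l) = (\<Sum>k<N. c k * (if k = l then 1 else 0))"
    using assms by (simp add: entry_prod_linear orthonormal_def)
  also have "\<dots> = c l" using assms by (simp add: if_distrib cong: if_cong)
  finally show ?thesis .
qed

text \<open>Orthogonal to the span of the targets when these are orthonormal; the squared norm of the residual of
  \<open>S\<close> is \<^const>\<open>d_sq\<close>.\<close>
definition residual :: "nat \<Rightarrow> nat \<Rightarrow> (nat \<Rightarrow> nat \<times> nat \<Rightarrow> real) \<Rightarrow> (nat \<times> nat \<Rightarrow> real) \<Rightarrow> nat \<times> nat \<Rightarrow> real"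
  where "residual p N t f = (\<lambda>a. f a - (\<Sum>k<N. entry_prod p f (t k) * t k a))"

lemma residual_orthogonal:
  assumes "orthonormal p N t" "l < N"
  shows "entry_prod p (residual p N t f) (t l) = 0"
  unfolding residual_def entry_prod_diff_left
  using entry_prod_orthonormal_comb[OF assms] by simp

lemma entry_prod_residual:
  assumes "orthonormal p N t"
  shows "entry_prod p (residual p N t f) (residual p N t g)
       = entry_prod p f g - (\<Sum>k<N. entry_prod p f (t k) * entry_prod p g (t k))"
proof -
  have "entry_prod p (residual p N t f) (residual p N t g)
      = entry_prod p (residual p N t f) g
        - (\<Sum>k<N. entry_prod p g (t k) * entry_prod p (residual p N t f) (t k))"
    unfolding residual_def[of p N t g] by (simp add: entry_prod_linear)
  also have "\<dots> = entry_prod p (residual p N t f) g"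
    using residual_orthogonal[OF assms] by simp
  also have "\<dots> = entry_prod p f g - (\<Sum>k<N. entry_prod p f (t k) * entry_prod p g (t k))"
    unfolding residual_def by (simp add: entry_prod_linear entry_prod_commute)
  finally show ?thesis .
qed

lemma bessel:
  assumes "orthonormal p N t"
  shows "(\<Sum>k<N. (entry_prod p f (t k))^2) \<le> entry_prod p f f"
  using entry_prod_nonneg[of p "residual p N t f"] entry_prod_residual[OF assms, of f f]
  by (simp add: power2_eq_square)

lemma residual_le:
  assumes "orthonormal p N t"
  shows "entry_prod p (residual p N t f) (residual p N t f) \<le> entry_prod p f f"
  using entry_prod_residual[OF assms, of f f] by (simp add: sum_nonneg)

text \<open>Pythagoras for a linear combination of a residual and of targets.\<close>
lemma entry_prod_residual_comb:
  assumes "orthonormal p N t"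
  shows "entry_prod p (\<lambda>a. b * residual p N t f a + (\<Sum>k<N. c k * t k a))
                      (\<lambda>a. b * residual p N t f a + (\<Sum>k<N. c k * t k a))
       = b^2 * entry_prod p (residual p N t f) (residual p N t f) + (\<Sum>k<N. (c k)^2)"
proof -
  let ?r = "residual p N t f" and ?q = "\<lambda>a. \<Sum>k<N. c k * t k a"
  have 1: "entry_prod p ?r ?q = 0"
    using residual_orthogonal[OF assms] by (simp add: entry_prod_linear)
  have "entry_prod p ?q ?q = (\<Sum>k<N. c k * entry_prod p ?q (t k))"
    by (simp only: entry_prod_sum_right[where h = ?q] entry_prod_scale_right[where h = ?q])
  also have "\<dots> = (\<Sum>k<N. (c k)^2)"
    using entry_prod_orthonormal_comb[OF assms] by (simp add: power2_eq_square)
  finally have 2: "entry_prod p ?q ?q = (\<Sum>k<N. (c k)^2)" .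
  have "entry_prod p (\<lambda>a. b * ?r a + ?q a) (\<lambda>a. b * ?r a + ?q a)
      = b * (b * entry_prod p ?r ?r) + b * entry_prod p ?r ?q + b * entry_prod p ?r ?q + entry_prod p ?q ?q"
    by (simp only: entry_prod_add_left entry_prod_add_right entry_prod_scale_left
        entry_prod_scale_right entry_prod_commute[of p ?q ?r] distrib_left add.assoc)
  then show ?thesis using 1 2 by (simp add: power2_eq_square)
qed

subsection \<open>Matrices as families of entries\<close>

lemma inner_mat_entry_prod:
  assumes "A \<in> carrier_mat p p" "B \<in> carrier_mat p p"
  shows "inner_mat p A B = entry_prod p (($$) A) (($$) B)"
proof -
  have "(A * transpose_mat B) $$ (i, i) = (\<Sum>j<p. A $$ (i, j) * B $$ (i, j))" if "i < p" for i
    using assms that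
    by (auto simp: times_mat_def scalar_prod_def intro!: sum.cong)
  then show ?thesis
    by (simp add: inner_mat_def entry_prod_def sum.cartesian_product)
qed

lemma inner_mat_self_nonneg:
  assumes "A \<in> carrier_mat p p" shows "0 \<le> inner_mat p A A"
  using assms by (simp add: inner_mat_entry_prod entry_prod_nonneg)

lemma norm_mat_sq:
  assumes "A \<in> carrier_mat p p"
  shows "(norm_mat p A)^2 = entry_prod p (($$) A) (($$) A)"
  using assms inner_mat_self_nonneg[OF assms]
  by (simp add: norm_mat_def inner_mat_entry_prod)

section \<open>Projection onto the positive semi-definite cone\<close>

text \<open>The cone in terms of entries: in the product topology on families of reals it is closed by continuity
  of coordinates, and cubes are compact.\<close>
definition psd_entries :: "nat \<Rightarrow> (nat \<times> nat \<Rightarrow> real) \<Rightarrow> bool" where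
  "psd_entries p f \<longleftrightarrow> (\<forall>i<p. \<forall>j<p. f (i, j) = f (j, i)) \<and>
     (\<forall>x. 0 \<le> (\<Sum>a\<in>{..<p} \<times> {..<p}. f a * (x (fst a) * x (snd a))))"

lemma psd_cone_iff:
  "A \<in> psd_cone p \<longleftrightarrow> A \<in> carrier_mat p p \<and> psd_entries p (($$) A)"
proof (cases "A \<in> carrier_mat p p")
  case True
  have form: "scalar_prod v (A *\<^sub>v v)
      = (\<Sum>a\<in>{..<p} \<times> {..<p}. A $$ a * (v $ fst a * v $ snd a))"
    if "v \<in> carrier_vec p" for v
  proof -
    have "scalar_prod v (A *\<^sub>v v) = (\<Sum>i<p. \<Sum>j<p. A $$ (i, j) * (v $ i * v $ j))"
      using True that
      by (auto simp: scalar_prod_def sum_distrib_left lessThan_atLeast0 mult_ac intro!: sum.cong)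
    then show ?thesis by (simp add: sum.cartesian_product case_prod_beta)
  qed
  have sym: "transpose_mat A = A \<longleftrightarrow> (\<forall>i<p. \<forall>j<p. A $$ (i, j) = A $$ (j, i))"
  proof
    assume "transpose_mat A = A"
    then show "\<forall>i<p. \<forall>j<p. A $$ (i, j) = A $$ (j, i)"
      using True by (metis carrier_matD index_transpose_mat(1))
  next
    assume "\<forall>i<p. \<forall>j<p. A $$ (i, j) = A $$ (j, i)"
    then show "transpose_mat A = A" using True by (intro eq_matI) auto
  qed
  have "(\<forall>v \<in> carrier_vec p. 0 \<le> scalar_prod v (A *\<^sub>v v))
      \<longleftrightarrow> (\<forall>x. 0 \<le> (\<Sum>a\<in>{..<p} \<times> {..<p}. A $$ a * (x (fst a) * x (snd a))))" (is "?l = ?r")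
  proof
    assume l: ?l
    show ?r
    proof
      fix x :: "nat \<Rightarrow> real"
      have "(\<Sum>a\<in>{..<p} \<times> {..<p}. A $$ a * (x (fst a) * x (snd a)))
          = (\<Sum>a\<in>{..<p} \<times> {..<p}. A $$ a * (Matrix.vec p x $ fst a * Matrix.vec p x $ snd a))"
        by (intro sum.cong) auto
      then show "0 \<le> (\<Sum>a\<in>{..<p} \<times> {..<p}. A $$ a * (x (fst a) * x (snd a)))"
        using l[rule_format, of "Matrix.vec p x"] form[of "Matrix.vec p x"] by simp
    qed
  qed (simp add: form)
  then show ?thesis using True sym by (simp add: psd_cone_def psd_entries_def)
qed (simp add: psd_cone_def)

lemma psd_entries_cong:
  assumes "\<And>i j. i < p \<Longrightarrow> j < p \<Longrightarrow> f (i, j) = g (i, j)"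
  shows "psd_entries p f = psd_entries p g"
proof -
  have "(\<Sum>a\<in>{..<p} \<times> {..<p}. f a * (x (fst a) * x (snd a)))
      = (\<Sum>a\<in>{..<p} \<times> {..<p}. g a * (x (fst a) * x (snd a)))" for x :: "nat \<Rightarrow> real"
    by (intro sum.cong) (auto simp: assms)
  then show ?thesis by (simp add: psd_entries_def assms)
qed

lemma psd_entries_zero: "psd_entries p (\<lambda>_. 0)"
  by (simp add: psd_entries_def)

lemma psd_entries_convex:
  assumes "psd_entries p f" "psd_entries p g" "0 \<le> \<theta>" "\<theta> \<le> 1"
  shows "psd_entries p (\<lambda>a. f a + \<theta> * (g a - f a))"
  unfolding psd_entries_def
proof (intro conjI allI impI)
  fix i j assume "i < p" "j < p"
  then show "f (i, j) + \<theta> * (g (i, j) - f (i, j)) = f (j, i) + \<theta> * (g (j, i) - f (j, i))"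
    using assms(1,2) unfolding psd_entries_def by metis
next
  fix x :: "nat \<Rightarrow> real"
  have "(\<Sum>a\<in>{..<p} \<times> {..<p}. (f a + \<theta> * (g a - f a)) * (x (fst a) * x (snd a)))
      = (1 - \<theta>) * (\<Sum>a\<in>{..<p} \<times> {..<p}. f a * (x (fst a) * x (snd a)))
        + \<theta> * (\<Sum>a\<in>{..<p} \<times> {..<p}. g a * (x (fst a) * x (snd a)))"
    unfolding sum_distrib_left sum.distrib[symmetric] by (intro sum.cong) (auto simp: algebra_simps)
  then show "0 \<le> (\<Sum>a\<in>{..<p} \<times> {..<p}. (f a + \<theta> * (g a - f a)) * (x (fst a) * x (snd a)))"
    using assms by (simp add: psd_entries_def)
qed

lemma closed_psd_entries: "closed {g. psd_entries p g}"
proof -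
  have coord: "continuous_on UNIV (\<lambda>g::nat \<times> nat \<Rightarrow> real. g a)" for a
    by (rule continuous_on_product_coordinates)
  have "closed {g::nat \<times> nat \<Rightarrow> real. g (i, j) = g (j, i)}" for i j
    by (rule closed_Collect_eq) (rule coord)+
  moreover have "closed {g::nat \<times> nat \<Rightarrow> real.
      0 \<le> (\<Sum>a\<in>{..<p} \<times> {..<p}. g a * (x (fst a) * x (snd a)))}" for x :: "nat \<Rightarrow> real"
    by (intro closed_Collect_le continuous_on_const continuous_on_sum continuous_on_mult coord)
  ultimately show ?thesis
    unfolding psd_entries_def
    by (intro closed_Collect_conj closed_Collect_all closed_Collect_imp) auto
qed

definition nearest_psd :: "nat \<Rightarrow> (nat \<times> nat \<Rightarrow> real) \<Rightarrow> (nat \<times> nat \<Rightarrow> real) \<Rightarrow> bool" where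
  "nearest_psd p f g \<longleftrightarrow> psd_entries p g \<and>
     (\<forall>h. psd_entries p h \<longrightarrow>
        entry_prod p (\<lambda>a. f a - g a) (\<lambda>a. f a - g a) \<le> entry_prod p (\<lambda>a. f a - h a) (\<lambda>a. f a - h a))"

text \<open>Only the part of the cone in a cube needs to be searched, because a family with one entry
  larger than twice the Euclidean norm of \<open>f\<close> is further from \<open>f\<close> than the zero family is; the cube is compact by
  Tychonoff's theorem.\<close>
lemma nearest_psd_exists: "\<exists>g. nearest_psd p f g"
proof -
  let ?I = "{..<p} \<times> {..<p}"
  define h where "h g = (\<Sum>a\<in>?I. (f a - g a)^2)" for g
  define r where "r = sqrt (h (\<lambda>_. 0))"
  have r: "0 \<le> r" "r^2 = h (\<lambda>_. 0)" by (auto simp: r_def h_def sum_nonneg)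
  define K where "K = (PiE UNIV (\<lambda>a. if a \<in> ?I then {- (2 * r) .. 2 * r} else {0::real}))"
  have "compactin (product_topology (\<lambda>_. euclidean) UNIV) K"
    unfolding K_def compactin_PiE by auto
  then have "compact K" by (simp add: euclidean_product_topology)
  then have "compact (K \<inter> {g. psd_entries p g})"
    by (rule compact_Int_closed) (rule closed_psd_entries)
  moreover have "(\<lambda>_. 0) \<in> K \<inter> {g. psd_entries p g}"
    using r by (auto simp: K_def psd_entries_zero)
  moreover have "continuous_on (K \<inter> {g. psd_entries p g}) h"
    unfolding h_def
    by (rule continuous_on_subset[of UNIV])
       (intro continuous_on_sum continuous_on_power continuous_on_diff continuous_on_const
         continuous_on_product_coordinates, simp)
  ultimately obtain g where g: "g \<in> K" "psd_entries p g"
      "\<And>c. c \<in> K \<Longrightarrow> psd_entries p c \<Longrightarrow> h g \<le> h c"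
    using continuous_attains_inf[of "K \<inter> {g. psd_entries p g}" h] by blast
  have "h g \<le> h c" if c: "psd_entries p c" for c
  proof (cases "\<forall>a\<in>?I. \<bar>c a\<bar> \<le> 2 * r")
    case True
    define c' where "c' a = (if a \<in> ?I then c a else 0)" for a
    have "- (2 * r) \<le> c a \<and> c a \<le> 2 * r" if "a \<in> ?I" for a
      using bspec[OF True that] by (intro conjI; linarith)
    then have "c' \<in> K" by (simp add: K_def c'_def PiE_def)
    moreover have "psd_entries p c'" using c psd_entries_cong[of p c c'] by (simp add: c'_def)
    ultimately have "h g \<le> h c'" by (rule g(3))
    also have "h c' = h c" by (simp add: h_def c'_def cong: sum.cong)
    finally show ?thesis .
  next
    case False
    then obtain a where a: "a \<in> ?I" "2 * r < \<bar>c a\<bar>" by auto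
    have "(f a - 0)^2 \<le> h (\<lambda>_. 0)"
      unfolding h_def using a(1) by (intro member_le_sum) auto
    then have "\<bar>f a\<bar>^2 \<le> r^2" using r(2) by simp
    then have "\<bar>f a\<bar> \<le> r" using r(1) by (rule power2_le_imp_le)
    then have "r \<le> \<bar>f a - c a\<bar>" using a(2) by linarith
    then have "r^2 \<le> (f a - c a)^2" using r(1) by (metis abs_of_nonneg abs_le_square_iff)
    also have "\<dots> \<le> h c"
      unfolding h_def using a(1) by (intro member_le_sum) auto
    finally have "h (\<lambda>_. 0) \<le> h c" using r(2) by simp
    moreover have "h g \<le> h (\<lambda>_. 0)"
      using r(1) by (intro g(3)) (auto simp: K_def psd_entries_zero)
    ultimately show ?thesis by linarith
  qed
  moreover have "entry_prod p (\<lambda>a. f a - c a) (\<lambda>a. f a - c a) = h c / real p" for c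
    by (simp add: entry_prod_def h_def power2_eq_square)
  ultimately have "nearest_psd p f g"
    using g(2) by (auto simp: nearest_psd_def divide_right_mono)
  then show ?thesis by blast
qed

text \<open>Moving from the nearest point \<open>g\<close> a little towards another point \<open>c\<close> of the convex cone
  cannot decrease the distance to \<open>f\<close>.\<close>
lemma nearest_psd_variational:
  assumes "nearest_psd p f g" "psd_entries p c"
  shows "entry_prod p (\<lambda>a. f a - g a) (\<lambda>a. c a - g a) \<le> 0"
proof (rule field_le_epsilon)
  fix e :: real assume e: "e > 0"
  let ?u = "\<lambda>a. f a - g a" and ?v = "\<lambda>a. c a - g a"
  define q where "q = entry_prod p ?v ?v"
  have q: "0 \<le> q" unfolding q_def by (rule entry_prod_nonneg)
  \<comment> \<open>A step so short that the second-order term \<open>\<theta> q\<close> is below \<open>e\<close>.\<close>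
  define \<theta> where "\<theta> = min 1 (e / (q + 1))"
  have \<theta>: "0 < \<theta>" "\<theta> \<le> 1" "\<theta> * q \<le> e"
  proof -
    show "0 < \<theta>" "\<theta> \<le> 1" using e q by (auto simp: \<theta>_def)
    have "\<theta> * q \<le> e / (q + 1) * (q + 1)"
      using e q by (intro mult_mono) (auto simp: \<theta>_def)
    then show "\<theta> * q \<le> e" using q by simp
  qed
  have "psd_entries p (\<lambda>a. g a + \<theta> * (c a - g a))"
    using assms \<theta> by (intro psd_entries_convex) (auto simp: nearest_psd_def)
  then have "entry_prod p ?u ?u
      \<le> entry_prod p (\<lambda>a. f a - (g a + \<theta> * (c a - g a))) (\<lambda>a. f a - (g a + \<theta> * (c a - g a)))"
    using assms(1) unfolding nearest_psd_def by blast
  also have "(\<lambda>a. f a - (g a + \<theta> * (c a - g a))) = (\<lambda>a. ?u a - \<theta> * ?v a)"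
    by (auto simp: algebra_simps)
  also have "entry_prod p (\<lambda>a. ?u a - \<theta> * ?v a) (\<lambda>a. ?u a - \<theta> * ?v a)
      = entry_prod p ?u ?u - 2 * (\<theta> * entry_prod p ?u ?v) + \<theta> * (\<theta> * q)"
    unfolding q_def entry_prod_diff_left[of p ?u "\<lambda>a. \<theta> * ?v a"]
      entry_prod_diff_right[of p _ ?u "\<lambda>a. \<theta> * ?v a"] entry_prod_scale_left[of p \<theta> ?v]
      entry_prod_scale_right[of p _ \<theta> ?v] entry_prod_commute[of p ?v ?u] by simp
  finally have "\<theta> * (2 * entry_prod p ?u ?v) \<le> \<theta> * (\<theta> * q)" by simp
  then have "2 * entry_prod p ?u ?v \<le> \<theta> * q" using \<theta>(1) by simp
  then show "entry_prod p ?u ?v \<le> 0 + e" using \<theta>(3) e by linarith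
qed

text \<open>The variational inequalities at the two nearest points add up to
  \<open>\<parallel>f' - g'\<parallel>\<^sup>2 \<le> \<langle>f - g, f' - g'\<rangle>\<close>.\<close>
lemma nearest_psd_nonexpansive:
  assumes "nearest_psd p f f'" "nearest_psd p g g'"
  shows "entry_prod p (\<lambda>a. f' a - g' a) (\<lambda>a. f' a - g' a) \<le> entry_prod p (\<lambda>a. f a - g a) (\<lambda>a. f a - g a)"
proof -
  have 1: "entry_prod p (\<lambda>a. f a - f' a) (\<lambda>a. g' a - f' a) \<le> 0"
    using assms by (intro nearest_psd_variational) (auto simp: nearest_psd_def)
  have 2: "entry_prod p (\<lambda>a. g a - g' a) (\<lambda>a. f' a - g' a) \<le> 0"
    using assms by (intro nearest_psd_variational) (auto simp: nearest_psd_def)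
  have 3: "0 \<le> entry_prod p (\<lambda>a. (f a - g a) - (f' a - g' a)) (\<lambda>a. (f a - g a) - (f' a - g' a))"
    by (rule entry_prod_nonneg)
  show ?thesis
    using 1 2 3
    by (simp add: entry_prod_linear entry_prod_commute[of p f' f] entry_prod_commute[of p g' g]
        entry_prod_commute[of p g f] entry_prod_commute[of p g' f'] entry_prod_commute[of p g f']
        entry_prod_commute[of p g' f])
qed

text \<open>The definite description in \<^const>\<open>psd_proj\<close> denotes: a nearest point exists by compactness, and
  nonexpansiveness makes two nearest points of the same matrix equal.\<close>
lemma psd_proj_nearest:
  assumes A: "A \<in> carrier_mat p p"
  shows "psd_proj p A \<in> carrier_mat p p" "nearest_psd p (($$) A) (($$) (psd_proj p A))"
proof -
  have norm_diff: "norm_mat p (A - B) = sqrt (entry_prod p (\<lambda>a. A $$ a - B $$ a) (\<lambda>a. A $$ a - B $$ a))"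
    if "B \<in> carrier_mat p p" for B
  proof -
    have "inner_mat p (A - B) (A - B) = entry_prod p (($$) (A - B)) (($$) (A - B))"
      using A that by (intro inner_mat_entry_prod) auto
    also have "\<dots> = entry_prod p (\<lambda>a. A $$ a - B $$ a) (\<lambda>a. A $$ a - B $$ a)"
      using A that by (intro entry_prod_cong) auto
    finally show ?thesis by (simp add: norm_mat_def)
  qed
  let ?P = "\<lambda>B. B \<in> psd_cone p \<and> (\<forall>C \<in> psd_cone p. norm_mat p (A - B) \<le> norm_mat p (A - C))"
  have P_iff: "?P B \<longleftrightarrow> B \<in> carrier_mat p p \<and> nearest_psd p (($$) A) (($$) B)" for B
  proof (cases "B \<in> carrier_mat p p")
    case B: True
    have "(\<forall>C \<in> psd_cone p. norm_mat p (A - B) \<le> norm_mat p (A - C)) \<longleftrightarrow>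
      (\<forall>h. psd_entries p h \<longrightarrow> entry_prod p (\<lambda>a. A $$ a - B $$ a) (\<lambda>a. A $$ a - B $$ a)
        \<le> entry_prod p (\<lambda>a. A $$ a - h a) (\<lambda>a. A $$ a - h a))" (is "?l = ?r")
    proof
      assume l: ?l
      show ?r
      proof (intro allI impI)
        fix h assume h: "psd_entries p h"
        let ?C = "Matrix.mat p p h"
        have "psd_entries p (($$) ?C)" using h psd_entries_cong[of p h "($$) ?C"] by simp
        then have "?C \<in> psd_cone p" by (simp add: psd_cone_iff)
        then have "norm_mat p (A - B) \<le> norm_mat p (A - ?C)" using l by blast
        moreover have "entry_prod p (\<lambda>a. A $$ a - h a) (\<lambda>a. A $$ a - h a)
            = entry_prod p (\<lambda>a. A $$ a - ?C $$ a) (\<lambda>a. A $$ a - ?C $$ a)"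
          by (intro entry_prod_cong) auto
        ultimately show "entry_prod p (\<lambda>a. A $$ a - B $$ a) (\<lambda>a. A $$ a - B $$ a)
            \<le> entry_prod p (\<lambda>a. A $$ a - h a) (\<lambda>a. A $$ a - h a)"
          by (simp add: norm_diff B)
      qed
    next
      assume ?r
      then show ?l by (auto simp: psd_cone_iff norm_diff B)
    qed
    then show ?thesis using B by (simp add: psd_cone_iff nearest_psd_def)
  qed (simp add: psd_cone_iff)
  have "\<exists>B. ?P B"
  proof -
    obtain g where g: "nearest_psd p (($$) A) g" using nearest_psd_exists by blast
    let ?B = "Matrix.mat p p g"
    have "psd_entries p (($$) ?B) = psd_entries p g" by (rule psd_entries_cong) simp
    moreover have "entry_prod p (\<lambda>a. A $$ a - ?B $$ a) (\<lambda>a. A $$ a - ?B $$ a)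
        = entry_prod p (\<lambda>a. A $$ a - g a) (\<lambda>a. A $$ a - g a)"
      by (rule entry_prod_cong) auto
    ultimately have "nearest_psd p (($$) A) (($$) ?B)" using g by (simp add: nearest_psd_def)
    then show ?thesis unfolding P_iff by (intro exI[of _ ?B]) simp
  qed
  moreover have "B = B'" if "?P B" "?P B'" for B B'
  proof -
    have B: "B \<in> carrier_mat p p" "nearest_psd p (($$) A) (($$) B)"
      and B': "B' \<in> carrier_mat p p" "nearest_psd p (($$) A) (($$) B')"
      using that unfolding P_iff by auto
    have "entry_prod p (\<lambda>a. B $$ a - B' $$ a) (\<lambda>a. B $$ a - B' $$ a) \<le> 0"
      using nearest_psd_nonexpansive[OF B(2) B'(2)] by (simp add: entry_prod_def)
    then have "(\<Sum>a\<in>{..<p} \<times> {..<p}. (B $$ a - B' $$ a) * (B $$ a - B' $$ a)) \<le> 0 \<or> p = 0"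
      by (auto simp: entry_prod_def divide_le_0_iff)
    then have "B $$ a = B' $$ a" if "a \<in> {..<p} \<times> {..<p}" for a
      using that sum_nonneg_eq_0_iff[of "{..<p} \<times> {..<p}" "\<lambda>a. (B $$ a - B' $$ a) * (B $$ a - B' $$ a)"]
      by (auto simp: order.antisym sum_nonneg)
    then show "B = B'" using B(1) B'(1) by (intro eq_matI) auto
  qed
  ultimately have "\<exists>!B. ?P B" by blast
  then have "?P (psd_proj p A)" unfolding psd_proj_def by (rule theI')
  then show "psd_proj p A \<in> carrier_mat p p" "nearest_psd p (($$) A) (($$) (psd_proj p A))"
    unfolding P_iff by auto
qed

lemma psd_proj_nonexpansive:
  assumes "A \<in> carrier_mat p p" "B \<in> carrier_mat p p"
  shows "entry_prod p (\<lambda>a. psd_proj p A $$ a - psd_proj p B $$ a) (\<lambda>a. psd_proj p A $$ a - psd_proj p B $$ a)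
       \<le> entry_prod p (\<lambda>a. A $$ a - B $$ a) (\<lambda>a. A $$ a - B $$ a)"
  using assms by (intro nearest_psd_nonexpansive psd_proj_nearest)

lemma psd_proj_norm_le:
  assumes "A \<in> carrier_mat p p"
  shows "entry_prod p (($$) (psd_proj p A)) (($$) (psd_proj p A)) \<le> entry_prod p (($$) A) (($$) A)"
proof -
  have "nearest_psd p (\<lambda>_. 0) (\<lambda>_. 0)"
    using entry_prod_nonneg[of p] by (auto simp: nearest_psd_def psd_entries_zero entry_prod_def sum_nonneg)
  from nearest_psd_nonexpansive[OF psd_proj_nearest(2)[OF assms] this] show ?thesis by simp
qed

text \<open>The projection is 1-Lipschitz, hence continuous as a map of the entries, hence measurable.\<close>
lemma measurable_psd_proj:
  assumes "\<And>\<omega>. \<omega> \<in> space M \<Longrightarrow> A \<omega> \<in> carrier_mat p p"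
    and meas: "\<And>i j. i < p \<Longrightarrow> j < p \<Longrightarrow> (\<lambda>\<omega>. A \<omega> $$ (i, j)) \<in> borel_measurable M"
    and ij: "i < p" "j < p"
  shows "(\<lambda>\<omega>. psd_proj p (A \<omega>) $$ (i, j)) \<in> borel_measurable M"
proof -
  let ?I = "{..<p} \<times> {..<p}"
  define F where "F f = psd_proj p (Matrix.mat p p f) $$ (i, j)" for f
  have bound: "\<bar>F g - F f\<bar> \<le> sqrt (\<Sum>a\<in>?I. (g a - f a)^2)" for g f
  proof -
    let ?d = "\<lambda>a. psd_proj p (Matrix.mat p p g) $$ a - psd_proj p (Matrix.mat p p f) $$ a"
    have "(F g - F f)^2 \<le> (\<Sum>a\<in>?I. (?d a)^2)"
      unfolding F_def using ij member_le_sum[of "(i, j)" ?I "\<lambda>a. (?d a)^2"] by auto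
    also have "\<dots> = real p * entry_prod p ?d ?d" using ij by (simp add: entry_prod_def power2_eq_square)
    also have "\<dots> \<le> real p * entry_prod p (\<lambda>a. Matrix.mat p p g $$ a - Matrix.mat p p f $$ a)
        (\<lambda>a. Matrix.mat p p g $$ a - Matrix.mat p p f $$ a)"
      by (intro mult_left_mono psd_proj_nonexpansive) auto
    also have "\<dots> = real p * entry_prod p (\<lambda>a. g a - f a) (\<lambda>a. g a - f a)"
      by (intro arg_cong2[where f = "(*)"] entry_prod_cong) auto
    also have "\<dots> = (\<Sum>a\<in>?I. (g a - f a)^2)" using ij by (simp add: entry_prod_def power2_eq_square)
    finally have "sqrt ((F g - F f)^2) \<le> sqrt (\<Sum>a\<in>?I. (g a - f a)^2)" by (rule real_sqrt_le_mono)
    then show ?thesis by simp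
  qed
  have "continuous_on UNIV F"
    unfolding continuous_on_def
  proof (intro ballI)
    fix f :: "nat \<times> nat \<Rightarrow> real"
    have coord: "((\<lambda>g. g a) \<longlongrightarrow> f a) (at f)" for a
      using continuous_on_product_coordinates[of a] unfolding continuous_on_def by blast
    have "((\<lambda>g. sqrt (\<Sum>a\<in>?I. (g a - f a)^2)) \<longlongrightarrow> sqrt (\<Sum>a\<in>?I. (f a - f a)^2)) (at f)"
      by (rule tendsto_real_sqrt, rule tendsto_sum, rule tendsto_power, rule tendsto_diff,
          rule coord, rule tendsto_const)
    then have "((\<lambda>g. sqrt (\<Sum>a\<in>?I. (g a - f a)^2)) \<longlongrightarrow> 0) (at f)" by simp
    then have "((\<lambda>g. F g - F f) \<longlongrightarrow> 0) (at f)"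
      by (rule Lim_null_comparison[rotated]) (intro always_eventually allI, simp only: real_norm_def bound)
    then show "(F \<longlongrightarrow> F f) (at f)" by (simp add: LIM_zero_iff)
  qed
  then have F: "F \<in> borel_measurable borel" by (rule borel_measurable_continuous_onI)
  define c where "c \<omega> a = (if a \<in> ?I then A \<omega> $$ a else 0)" for \<omega> a
  have "c \<in> borel_measurable M"
  proof (rule measurable_coordinatewise_then_product)
    fix a
    show "(\<lambda>\<omega>. c \<omega> a) \<in> borel_measurable M"
      using meas by (cases "a \<in> ?I") (auto simp: c_def)
  qed
  then have "(\<lambda>\<omega>. F (c \<omega>)) \<in> borel_measurable M" using F by (rule measurable_compose)
  moreover have "F (c \<omega>) = psd_proj p (A \<omega>) $$ (i, j)" if "\<omega> \<in> space M" for \<omega>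
  proof -
    have "Matrix.mat p p (c \<omega>) = A \<omega>" using assms(1)[OF that] by (intro eq_matI) (auto simp: c_def)
    then show ?thesis by (simp add: F_def)
  qed
  ultimately show ?thesis by (simp cong: measurable_cong)
qed

section \<open>A deterministic bound on the distance between the two estimators\<close>

text \<open>Here \<open>d\<close> stands for \<open>d\<^sub>n\<^sup>2\<close>, and \<open>x\<close> and \<open>y\<close> for the numerators of the estimated and of the oracle
  coefficient.  If \<open>x\<close> and \<open>y\<close> are close to \<open>a\<close> and \<open>d\<close> is close to \<open>a + v\<close>, then both coefficients are, after
  multiplication by \<open>d\<close>, close to \<open>r d\<close> with \<open>r = a / (a + v)\<close>; clamping \<open>x / d\<close> to the unit interval, which
  contains \<open>r\<close>, brings it nearer to \<open>r\<close>.  This bounds \<open>d \<bar>c - y / d\<bar>\<close> for the clamped coefficient \<open>c\<close>.  To pass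
  to \<open>d (c - y / d)\<^sup>2\<close> without a lower bound on \<open>d\<close>, two regimes are distinguished: if \<open>a \<le> 4 d\<close>, then
  \<open>\<bar>c - y / d\<bar> \<le> 1 + \<surd>(a / d)\<close> is bounded, and otherwise \<open>a\<close>, which bounds the left-hand side up to a constant,
  is itself of the order of \<open>a + v - d\<close>.\<close>
lemma clamped_ratio_bound:
  fixes d a v x y :: real
  assumes "0 \<le> d" "0 \<le> a" "0 \<le> v" "y^2 \<le> d * a"
  shows "(min (max (x / d) 0) 1 - y / d)^2 * d \<le> 3 * (\<bar>x - a\<bar> + \<bar>y - a\<bar> + 2 * \<bar>d - (a + v)\<bar>)"
proof (cases "d = 0")
  case False
  then have d: "0 < d" using assms(1) by simp
  define c where "c = min (max (x / d) 0) 1"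
  define u where "u = y / d"
  define r where "r = a / (a + v)"
  define E where "E = \<bar>x - a\<bar> + \<bar>y - a\<bar> + 2 * \<bar>d - (a + v)\<bar>"
  have r: "0 \<le> r" "r \<le> 1" "r * (a + v) = a"
    using assms(2,3) by (auto simp: r_def divide_le_eq)
  have rd: "\<bar>a - r * d\<bar> \<le> \<bar>d - (a + v)\<bar>"
  proof -
    have "a - r * d = r * ((a + v) - d)" using r(3) by (simp add: algebra_simps)
    then have "\<bar>a - r * d\<bar> = r * \<bar>d - (a + v)\<bar>" using r(1) by (simp add: abs_mult abs_minus_commute)
    then show ?thesis using r by (simp add: mult_left_le_one_le)
  qed
  have "\<bar>c - r\<bar> \<le> \<bar>x / d - r\<bar>" using r by (auto simp: c_def min_def max_def)
  then have "d * \<bar>c - r\<bar> \<le> d * \<bar>x / d - r\<bar>" using d by simp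
  also have "\<dots> = \<bar>x - r * d\<bar>"
    using d by (simp add: abs_mult_pos[symmetric] abs_mult_pos' field_simps)
  finally have 1: "d * \<bar>c - r\<bar> \<le> \<bar>x - r * d\<bar>" .
  have 2: "d * \<bar>u - r\<bar> = \<bar>y - r * d\<bar>"
    using d by (simp add: u_def abs_mult_pos[symmetric] abs_mult_pos' field_simps)
  have "d * \<bar>c - u\<bar> \<le> d * (\<bar>c - r\<bar> + \<bar>u - r\<bar>)" using d by (intro mult_left_mono) auto
  also have "\<dots> \<le> E"
  proof -
    have "\<bar>x - r * d\<bar> \<le> \<bar>x - a\<bar> + \<bar>a - r * d\<bar>" "\<bar>y - r * d\<bar> \<le> \<bar>y - a\<bar> + \<bar>a - r * d\<bar>" by linarith+
    then show ?thesis using 1 2 rd unfolding E_def distrib_left by linarith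
  qed
  finally have dE: "d * \<bar>c - u\<bar> \<le> E" .
  have c01: "0 \<le> c" "c \<le> 1" by (auto simp: c_def)
  have u2: "d * u^2 \<le> a"
  proof -
    have "d * u^2 = y^2 / d" using d by (simp add: u_def power_divide power2_eq_square)
    then show ?thesis using assms(4) d by (simp add: divide_le_eq mult.commute)
  qed
  have "(c - u)^2 * d \<le> 3 * E"
  proof (cases "a \<le> 4 * d")
    case True
    then have "d * u^2 \<le> d * 2^2" using u2 by simp
    then have "\<bar>u\<bar>^2 \<le> 2^2" using d by simp
    then have "\<bar>u\<bar> \<le> 2" by (rule power2_le_imp_le) simp
    then have "\<bar>c - u\<bar> \<le> 3" using c01 by linarith
    then have "\<bar>c - u\<bar> * (d * \<bar>c - u\<bar>) \<le> 3 * E" using dE d by (intro mult_mono) auto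
    then show ?thesis by (simp add: power2_eq_square mult_ac)
  next
    case False
    have "(c - u)^2 \<le> 2 * c^2 + 2 * u^2"
      using zero_le_power2[of "c + u"] by (simp add: power2_eq_square algebra_simps)
    moreover have "c^2 \<le> 1" using c01 by (simp add: power_le_one)
    ultimately have "(c - u)^2 * d \<le> (2 + 2 * u^2) * d" using d by (intro mult_right_mono) auto
    also have "\<dots> \<le> 2 * d + 2 * a" using u2 by (simp add: algebra_simps)
    also have "\<dots> \<le> 3 * (2 * ((a + v) - d))" 
    proof -
      have "4 * d < a" using False by simp
      then have "2 * d + 2 * a \<le> 6 * a + 6 * v - 6 * d" using d assms(3) by linarith
      then show ?thesis by (simp add: algebra_simps)
    qed
    also have "\<dots> \<le> 3 * E"
    proof -
      have "(a + v) - d \<le> \<bar>d - (a + v)\<bar>" by simp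
      then have "2 * ((a + v) - d) \<le> E" using abs_ge_zero[of "x - a"] abs_ge_zero[of "y - a"]
        unfolding E_def by argo
      then show ?thesis by simp
    qed
    finally show ?thesis .
  qed
  then show ?thesis by (simp add: c_def u_def E_def)
qed simp

lemma targets_orthonormal:
  assumes "targets p N T" shows "orthonormal p N (\<lambda>k. ($$) (T k))"
  using assms by (auto simp: targets_def orthonormal_def simp flip: inner_mat_entry_prod)

lemma targets_carrier: "targets p N T \<Longrightarrow> k < N \<Longrightarrow> T k \<in> carrier_mat p p"
  by (simp add: targets_def)

context
  fixes p N :: nat and T :: "nat \<Rightarrow> real mat" and \<Sigma> S :: "real mat"
    and t :: "nat \<Rightarrow> nat \<times> nat \<Rightarrow> real"
  assumes T: "targets p N T" and Sig: "\<Sigma> \<in> carrier_mat p p" and S: "S \<in> carrier_mat p p"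
  defines "t \<equiv> \<lambda>k. ($$) (T k)"
begin

lemma on_t: "orthonormal p N t"
  using targets_orthonormal[OF T] by (simp add: t_def)

lemma inner_mat_target:
  assumes "A \<in> carrier_mat p p" "k < N" shows "inner_mat p A (T k) = entry_prod p (($$) A) (t k)"
  using assms targets_carrier[OF T] by (simp add: t_def inner_mat_entry_prod)

lemma d_sq_residual:
  "d_sq p N T S = entry_prod p (residual p N t (($$) S)) (residual p N t (($$) S))"
proof -
  have "(\<Sum>k<N. (inner_mat p S (T k))^2) = (\<Sum>k<N. (entry_prod p (($$) S) (t k))^2)"
    using S by (intro sum.cong) (auto simp: inner_mat_target)
  then show ?thesis
    unfolding d_sq_def entry_prod_residual[OF on_t] norm_mat_sq[OF S] by (simp add: power2_eq_square)
qed

lemma oracle_c0_residual: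
  "oracle_c0 p N T \<Sigma> S
   = entry_prod p (residual p N t (($$) S)) (residual p N t (($$) \<Sigma>)) / d_sq p N T S"
proof -
  have "(\<Sum>k<N. inner_mat p S (T k) * inner_mat p \<Sigma> (T k))
      = (\<Sum>k<N. entry_prod p (($$) S) (t k) * entry_prod p (($$) \<Sigma>) (t k))"
    using S Sig by (intro sum.cong) (auto simp: inner_mat_target)
  then show ?thesis
    unfolding oracle_c0_def entry_prod_residual[OF on_t] by (simp add: inner_mat_entry_prod[OF S Sig])
qed

lemma target_comb_entry:
  assumes "i < p" "j < p"
  shows "lin_comb p N c T $$ (i, j) = (\<Sum>k<N. c k * t k (i, j))"
  using assms by (simp add: lin_comb_def t_def)

lemma oracle_matrix_entry:
  assumes "i < p" "j < p"
  shows "(oracle_c0 p N T \<Sigma> S \<cdot>\<^sub>m S + lin_comb p N (oracle_c p N T \<Sigma> S) T) $$ (i, j)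
       = oracle_c0 p N T \<Sigma> S * residual p N t (($$) S) (i, j)
         + (\<Sum>k<N. entry_prod p (($$) \<Sigma>) (t k) * t k (i, j))"
proof -
  let ?c = "oracle_c0 p N T \<Sigma> S"
  have "(\<Sum>k<N. oracle_c p N T \<Sigma> S k * t k (i, j))
      = (\<Sum>k<N. (entry_prod p (($$) \<Sigma>) (t k) - ?c * entry_prod p (($$) S) (t k)) * t k (i, j))"
    using S Sig by (intro sum.cong) (auto simp: oracle_c_def inner_mat_target)
  also have "\<dots> = (\<Sum>k<N. entry_prod p (($$) \<Sigma>) (t k) * t k (i, j))
      - ?c * (\<Sum>k<N. entry_prod p (($$) S) (t k) * t k (i, j))"
    by (simp add: sum_distrib_left sum_subtractf[symmetric] algebra_simps)
  finally show ?thesis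
    using assms S by (simp add: target_comb_entry[OF assms] residual_def algebra_simps lin_comb_def[of p N "oracle_c p N T \<Sigma> S"] t_def)
qed

lemma bona_fide_matrix_entry:
  assumes "i < p" "j < p"
  shows "(c \<cdot>\<^sub>m S + (1 - c) \<cdot>\<^sub>m lin_comb p N (\<lambda>i. inner_mat p S (T i)) T) $$ (i, j)
       = c * residual p N t (($$) S) (i, j)
         + (\<Sum>k<N. entry_prod p (($$) S) (t k) * t k (i, j))"
proof -
  have "(\<Sum>k<N. inner_mat p S (T k) * t k (i, j))
      = (\<Sum>k<N. entry_prod p (($$) S) (t k) * t k (i, j))"
    using S by (intro sum.cong) (auto simp: inner_mat_target)
  then have "lin_comb p N (\<lambda>i. inner_mat p S (T i)) T $$ (i, j)
      = (\<Sum>k<N. entry_prod p (($$) S) (t k) * t k (i, j))"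
    by (simp add: target_comb_entry[OF assms])
  moreover have "lin_comb p N (\<lambda>i. inner_mat p S (T i)) T \<in> carrier_mat p p" by (simp add: lin_comb_def)
  ultimately show ?thesis
    using assms S by (simp add: residual_def algebra_simps)
qed

text \<open>Before projection the oracle is the orthogonal projection of \<open>\<Sigma>\<close> on the span of \<open>S\<close> and the
  targets, so it is not larger than \<open>\<Sigma>\<close>; the cone contains 0, so neither is its projection.\<close>
lemma oracle_norm_le:
  "entry_prod p (($$) (oracle_est p N T \<Sigma> S)) (($$) (oracle_est p N T \<Sigma> S))
   \<le> entry_prod p (($$) \<Sigma>) (($$) \<Sigma>)"
proof -
  let ?rS = "residual p N t (($$) S)" and ?rE = "residual p N t (($$) \<Sigma>)"
  let ?B = "oracle_c0 p N T \<Sigma> S \<cdot>\<^sub>m S + lin_comb p N (oracle_c p N T \<Sigma> S) T"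
  have B: "?B \<in> carrier_mat p p" using S by (simp add: lin_comb_def)
  have "entry_prod p (($$) (oracle_est p N T \<Sigma> S)) (($$) (oracle_est p N T \<Sigma> S))
      \<le> entry_prod p (($$) ?B) (($$) ?B)"
    unfolding oracle_est_def by (rule psd_proj_norm_le[OF B])
  also have "entry_prod p (($$) ?B) (($$) ?B)
      = entry_prod p (\<lambda>a. oracle_c0 p N T \<Sigma> S * ?rS a + (\<Sum>k<N. entry_prod p (($$) \<Sigma>) (t k) * t k a))
          (\<lambda>a. oracle_c0 p N T \<Sigma> S * ?rS a + (\<Sum>k<N. entry_prod p (($$) \<Sigma>) (t k) * t k a))"
    by (intro entry_prod_cong oracle_matrix_entry)
  also have "\<dots> = (oracle_c0 p N T \<Sigma> S)^2 * d_sq p N T S + (\<Sum>k<N. (entry_prod p (($$) \<Sigma>) (t k))^2)"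
    unfolding d_sq_residual by (rule entry_prod_residual_comb[OF on_t])
  also have "(oracle_c0 p N T \<Sigma> S)^2 * d_sq p N T S \<le> entry_prod p ?rE ?rE"
  proof (cases "d_sq p N T S = 0")
    case False
    then have d: "0 < d_sq p N T S" using entry_prod_nonneg[of p ?rS] by (simp add: d_sq_residual)
    have "(oracle_c0 p N T \<Sigma> S)^2 * d_sq p N T S = (entry_prod p ?rS ?rE)^2 / d_sq p N T S"
      using d by (simp add: oracle_c0_residual power_divide power2_eq_square)
    also have "\<dots> \<le> entry_prod p ?rE ?rE"
      using entry_prod_Cauchy_Schwarz[of p ?rS ?rE] d
      by (simp add: divide_le_eq mult.commute flip: d_sq_residual)
    finally show ?thesis .
  qed (simp add: entry_prod_nonneg)
  also have "entry_prod p ?rE ?rE + (\<Sum>k<N. (entry_prod p (($$) \<Sigma>) (t k))^2) = entry_prod p (($$) \<Sigma>) (($$) \<Sigma>)"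
    by (simp add: entry_prod_residual[OF on_t] power2_eq_square)
  finally show ?thesis by simp
qed

text \<open>Nonexpansiveness removes the projections; Pythagoras then separates the error on \<open>c\<^sub>0\<close> from
  the error on the target coefficients.\<close>
lemma estimator_distance_le:
  fixes n :: nat and Z :: "real mat" and s :: mean_setting and v :: real
  defines "w \<equiv> \<lambda>a. S $$ a - \<Sigma> $$ a"
  assumes Z: "S = sample_cov s n Z" and v: "0 \<le> v"
  shows "entry_prod p (\<lambda>a. bona_fide_est s p n N T Z $$ a - oracle_est p N T \<Sigma> S $$ a)
                      (\<lambda>a. bona_fide_est s p n N T Z $$ a - oracle_est p N T \<Sigma> S $$ a)
    \<le> 3 * \<bar>var_est s p n Z - v\<bar> + 3 * \<bar>\<Sum>k<N. var_est_target s p n Z (T k)\<bar>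
      + 9 * \<bar>entry_prod p w w - v\<bar> + 21 * \<bar>entry_prod p w (residual p N t (($$) \<Sigma>))\<bar>
      + 10 * (\<Sum>k<N. (entry_prod p w (t k))^2)"
proof -
  let ?rS = "residual p N t (($$) S)" and ?rE = "residual p N t (($$) \<Sigma>)"
  let ?c = "bona_fide_c0 s p n N T Z" and ?co = "oracle_c0 p N T \<Sigma> S"
  let ?A = "?c \<cdot>\<^sub>m S + (1 - ?c) \<cdot>\<^sub>m lin_comb p N (\<lambda>i. inner_mat p S (T i)) T"
  let ?B = "?co \<cdot>\<^sub>m S + lin_comb p N (oracle_c p N T \<Sigma> S) T"
  have A: "?A \<in> carrier_mat p p" and B: "?B \<in> carrier_mat p p" using S by (simp_all add: lin_comb_def)
  define d where "d = d_sq p N T S"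
  define a where "a = entry_prod p ?rE ?rE"
  define y where "y = entry_prod p ?rS ?rE"
  define V where "V = var_est s p n Z"
  define VT where "VT = (\<Sum>k<N. var_est_target s p n Z (T k))"
  define x where "x = d - V + VT"
  define R where "R = (\<Sum>k<N. (entry_prod p w (t k))^2)"
  define L where "L = entry_prod p w ?rE"
  have R0: "0 \<le> R" by (simp add: R_def sum_nonneg)
  have d0: "0 \<le> d" by (simp add: d_def d_sq_residual entry_prod_nonneg)
  have a0: "0 \<le> a" by (simp add: a_def entry_prod_nonneg)
  have y2: "y^2 \<le> d * a"
    using entry_prod_Cauchy_Schwarz[of p ?rS ?rE] by (simp add: y_def d_def a_def d_sq_residual)
  have "(norm_mat p S)^2 - V - (\<Sum>k<N. (inner_mat p S (T k))^2 - var_est_target s p n Z (T k)) = x"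
    by (simp add: x_def d_def d_sq_def VT_def sum_subtractf)
  then have c: "?c = min (max (x / d) 0) 1"
    by (simp add: bona_fide_c0_def c0_hat_def Z[symmetric] V_def d_def)
  have c0: "?co = y / d" by (simp add: oracle_c0_residual y_def d_def)

  have w_t: "entry_prod p (($$) S) (t k) - entry_prod p (($$) \<Sigma>) (t k) = entry_prod p w (t k)" for k
    by (simp add: w_def entry_prod_diff_left)
  have res_w: "?rS = (\<lambda>a. ?rE a + residual p N t w a)"
  proof -
    have "entry_prod p (($$) S) (t k) = entry_prod p (($$) \<Sigma>) (t k) + entry_prod p w (t k)" for k
      by (simp add: w_t[symmetric])
    then show ?thesis
      unfolding residual_def by (intro ext) (simp add: distrib_right sum.distrib w_def)
  qed
  have Lw: "entry_prod p (residual p N t w) ?rE = L"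
  proof -
    have "entry_prod p (residual p N t w) ?rE
        = entry_prod p w ?rE - (\<Sum>k<N. entry_prod p w (t k) * entry_prod p (t k) ?rE)"
      by (subst (1) residual_def) (simp only: entry_prod_diff_left entry_prod_sum_left entry_prod_scale_left)
    also have "(\<Sum>k<N. entry_prod p w (t k) * entry_prod p (t k) ?rE) = 0"
      using residual_orthogonal[OF on_t] by (simp add: entry_prod_commute[of p "t _"])
    finally show ?thesis by (simp add: L_def)
  qed
  have yL: "y = a + L"
    unfolding y_def a_def res_w entry_prod_add_left Lw ..
  have "d = a + L + L + entry_prod p (residual p N t w) (residual p N t w)"
    unfolding d_def d_sq_residual a_def res_w entry_prod_add_left entry_prod_add_right
    by (simp add: Lw entry_prod_commute[of p ?rE "residual p N t w"])
  also have "entry_prod p (residual p N t w) (residual p N t w) = entry_prod p w w - R"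
    by (simp add: entry_prod_residual[OF on_t] R_def power2_eq_square)
  finally have dL: "d = a + 2 * L + (entry_prod p w w - R)" by simp

  have "entry_prod p (\<lambda>a. bona_fide_est s p n N T Z $$ a - oracle_est p N T \<Sigma> S $$ a)
                      (\<lambda>a. bona_fide_est s p n N T Z $$ a - oracle_est p N T \<Sigma> S $$ a)
      \<le> entry_prod p (\<lambda>a. ?A $$ a - ?B $$ a) (\<lambda>a. ?A $$ a - ?B $$ a)"
    using psd_proj_nonexpansive[OF A B] by (simp add: bona_fide_est_def oracle_est_def Z[symmetric] Let_def)
  also have "\<dots> = entry_prod p (\<lambda>a. (?c - ?co) * ?rS a + (\<Sum>k<N. entry_prod p w (t k) * t k a))
      (\<lambda>a. (?c - ?co) * ?rS a + (\<Sum>k<N. entry_prod p w (t k) * t k a))"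
    by (intro entry_prod_cong)
       (simp_all only: oracle_matrix_entry bona_fide_matrix_entry w_t[symmetric] left_diff_distrib
         sum_subtractf add_diff_add)
  also have "\<dots> = (?c - ?co)^2 * d + R"
    unfolding d_def d_sq_residual R_def by (rule entry_prod_residual_comb[OF on_t])
  also have "\<dots> \<le> 3 * (\<bar>x - a\<bar> + \<bar>y - a\<bar> + 2 * \<bar>d - (a + v)\<bar>) + R"
    unfolding c c0 by (intro add_right_mono clamped_ratio_bound d0 a0 v y2)
  also have "\<dots> \<le> 3 * \<bar>V - v\<bar> + 3 * \<bar>VT\<bar> + 9 * \<bar>entry_prod p w w - v\<bar> + 21 * \<bar>L\<bar> + 10 * R"
  proof -
    have "\<bar>d - (a + v)\<bar> \<le> 2 * \<bar>L\<bar> + \<bar>entry_prod p w w - v\<bar> + R"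
      using dL R0 by linarith
    moreover have "\<bar>x - a\<bar> \<le> \<bar>d - (a + v)\<bar> + \<bar>V - v\<bar> + \<bar>VT\<bar>" unfolding x_def by linarith
    moreover have "\<bar>y - a\<bar> = \<bar>L\<bar>" using yL by simp
    ultimately show ?thesis by argo
  qed
  finally show ?thesis by (simp add: V_def VT_def L_def R_def)
qed

end

section \<open>The variance estimators in terms of fourth-order sums\<close>

definition outer :: "(nat \<Rightarrow> real) \<Rightarrow> nat \<times> nat \<Rightarrow> real" where
  "outer v a = v (fst a) * v (snd a)"

text \<open>Up to relative errors \<open>O(1 / n)\<close>, the quantity by which both settings estimate the variance of \<open>S\<close>.\<close>
definition obs_power :: "nat \<Rightarrow> nat \<Rightarrow> (nat \<Rightarrow> nat \<Rightarrow> real) \<Rightarrow> real" where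
  "obs_power p n z = (\<Sum>k<n. entry_prod p (outer (z k)) (outer (z k))) / (real n)^2"

definition target_power ::
  "nat \<Rightarrow> nat \<Rightarrow> nat \<Rightarrow> (nat \<Rightarrow> nat \<times> nat \<Rightarrow> real) \<Rightarrow> (nat \<Rightarrow> nat \<Rightarrow> real) \<Rightarrow> real" where
  "target_power p n N t z = (\<Sum>l<n. \<Sum>k<N. (entry_prod p (outer (z l)) (t k))^2) / (real n)^2"

lemma entry_prod_outer: "entry_prod p (outer v) (outer w) = (\<Sum>i<p. v i * w i)^2 / real p"
  unfolding entry_prod_def outer_def power2_eq_square sum_product sum.cartesian_product
  by (intro arg_cong2[where f = "(/)"] sum.cong) (auto simp: mult_ac)

lemma obs_power_nonneg: "0 \<le> obs_power p n z"
  by (simp add: obs_power_def sum_nonneg entry_prod_nonneg)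

lemma target_power_nonneg: "0 \<le> target_power p n N t z"
  by (simp add: target_power_def sum_nonneg)

lemma sample_cov_carrier:
  assumes "Z \<in> carrier_mat p n" shows "sample_cov s n Z \<in> carrier_mat p p"
  using assms by (cases s) auto

definition dof :: "mean_setting \<Rightarrow> nat \<Rightarrow> real" where
  "dof s n = (case s of Known_Mean \<Rightarrow> real n | Unknown_Mean \<Rightarrow> real n - 1)"

lemma sample_cov_entry:
  assumes Z: "Z \<in> carrier_mat p n" and ij: "i < p" "j < p"
  shows "sample_cov s n Z $$ (i, j) = (\<Sum>k<n. outer (\<lambda>i. Z $$ (i, k)) (i, j)) / dof s n"
proof -
  have "(Z * transpose_mat Z) $$ (i, j) = (\<Sum>k<n. outer (\<lambda>i. Z $$ (i, k)) (i, j))"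
    using Z ij by (auto simp: scalar_prod_def outer_def lessThan_atLeast0 intro!: sum.cong)
  then show ?thesis using Z ij by (cases s) (auto simp: dof_def)
qed

lemma outer_col_carrier: "Z \<in> carrier_mat p n \<Longrightarrow> outer_col Z k \<in> carrier_mat p p"
  by (auto simp: outer_col_def)

lemma outer_col_entry:
  assumes "Z \<in> carrier_mat p n" "i < p" "j < p"
  shows "outer_col Z k $$ (i, j) = outer (\<lambda>i. Z $$ (i, k)) (i, j)"
  using assms by (simp add: outer_col_def outer_def)

lemma inner_mat_outer_col:
  assumes "Z \<in> carrier_mat p n" "A \<in> carrier_mat p p"
  shows "inner_mat p (outer_col Z k) A = entry_prod p (outer (\<lambda>i. Z $$ (i, k))) (($$) A)"
proof -
  have "inner_mat p (outer_col Z k) A = entry_prod p (($$) (outer_col Z k)) (($$) A)"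
    using assms by (intro inner_mat_entry_prod outer_col_carrier)
  also have "\<dots> = entry_prod p (outer (\<lambda>i. Z $$ (i, k))) (($$) A)"
    using assms by (intro entry_prod_cong outer_col_entry) auto
  finally show ?thesis .
qed

lemma sum_sq_deviations:
  assumes "\<And>i j. i < p \<Longrightarrow> j < p \<Longrightarrow> (\<Sum>k<n. f k (i, j)) = real n * s (i, j)"
  shows "(\<Sum>k<n. entry_prod p (\<lambda>a. f k a - s a) (\<lambda>a. f k a - s a))
       = (\<Sum>k<n. entry_prod p (f k) (f k)) - real n * entry_prod p s s"
proof -
  have "(\<Sum>k<n. entry_prod p (f k) s) = entry_prod p (\<lambda>a. \<Sum>k<n. f k a) s"
    by (simp add: entry_prod_sum_left)
  also have "\<dots> = entry_prod p (\<lambda>a. real n * s a) s"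
    using assms by (intro entry_prod_cong) auto
  finally have "(\<Sum>k<n. entry_prod p (f k) s) = real n * entry_prod p s s"
    by (simp add: entry_prod_scale_left)
  moreover have "entry_prod p (\<lambda>a. f k a - s a) (\<lambda>a. f k a - s a)
      = entry_prod p (f k) (f k) - 2 * entry_prod p (f k) s + entry_prod p s s" for k
    by (simp add: entry_prod_diff_left[of p "f k" s] entry_prod_diff_right[of p _ "f k" s]
        entry_prod_commute[of p s "f k"])
  ultimately show ?thesis
    by (simp add: sum.distrib sum_subtractf flip: sum_distrib_left)
qed

lemma sum_sq_deviations_real:
  fixes e :: "nat \<Rightarrow> real"
  assumes "(\<Sum>l<n. e l) = real n * c"
  shows "(\<Sum>l<n. (e l - c)^2) = (\<Sum>l<n. (e l)^2) - real n * c^2"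
proof -
  have "(\<Sum>l<n. (e l - c)^2) = (\<Sum>l<n. (e l)^2 - 2 * c * e l + c^2)"
    by (intro sum.cong) (auto simp: power2_eq_square algebra_simps)
  also have "\<dots> = (\<Sum>l<n. (e l)^2) - 2 * c * (\<Sum>l<n. e l) + real n * c^2"
    by (simp add: sum.distrib sum_subtractf sum_distrib_left)
  finally show ?thesis using assms by (simp add: power2_eq_square)
qed

text \<open>Submultiplicativity of the Frobenius norm; the factor \<open>p\<close> comes from the normalisation.\<close>
lemma entry_prod_mat_mult_le:
  assumes "A \<in> carrier_mat p p" "B \<in> carrier_mat p p"
  shows "entry_prod p (($$) (A * B)) (($$) (A * B))
       \<le> real p * (entry_prod p (($$) A) (($$) A) * entry_prod p (($$) B) (($$) B))"
proof (cases "p = 0")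
  case False
  have sq: "real p * entry_prod p (($$) C) (($$) C) = (\<Sum>i<p. \<Sum>j<p. (C $$ (i, j))^2)" for C :: "real mat"
    using False by (simp add: entry_prod_def sum.cartesian_product power2_eq_square)
  have "real p * entry_prod p (($$) (A * B)) (($$) (A * B))
      = (\<Sum>i<p. \<Sum>j<p. (\<Sum>l<p. A $$ (i, l) * B $$ (l, j))^2)"
    unfolding sq using assms
    by (intro sum.cong refl) (auto simp: scalar_prod_def lessThan_atLeast0)
  also have "\<dots> \<le> (\<Sum>i<p. \<Sum>j<p. (\<Sum>l<p. (A $$ (i, l))^2) * (\<Sum>l<p. (B $$ (l, j))^2))"
    by (intro sum_mono Cauchy_Schwarz_ineq_sum)
  also have "\<dots> = (\<Sum>i<p. \<Sum>l<p. (A $$ (i, l))^2) * (\<Sum>j<p. \<Sum>l<p. (B $$ (l, j))^2)"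
    by (simp add: sum_product)
  also have "(\<Sum>j<p. \<Sum>l<p. (B $$ (l, j))^2) = (\<Sum>j<p. \<Sum>l<p. (B $$ (j, l))^2)"
    by (rule sum.swap)
  finally have "real p * entry_prod p (($$) (A * B)) (($$) (A * B))
      \<le> real p * entry_prod p (($$) A) (($$) A) * (real p * entry_prod p (($$) B) (($$) B))"
    unfolding sq .
  then have "real p * entry_prod p (($$) (A * B)) (($$) (A * B))
      \<le> real p * (real p * (entry_prod p (($$) A) (($$) A) * entry_prod p (($$) B) (($$) B)))"
    by (simp only: mult_ac)
  then show ?thesis using False by (simp add: mult_le_cancel_left)
qed (simp add: entry_prod_def)

text \<open>Cleared of denominators, each inequality says that the product of \<open>x - 4\<close> and of a linear function that is
  positive for \<open>x \<ge> 4\<close>, possibly plus a constant, is nonnegative.\<close>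
lemma sample_size_bounds:
  fixes x :: real
  assumes "4 \<le> x"
  shows "\<bar>x^2 / ((x - 2) * (x - 3)) - 1\<bar> \<le> 28 / x"
    and "(x - 1)^2 / ((x - 2) * (x - 3)) \<le> 9 / 2"
    and "(x - 1) / (x * (x - 2) * (x - 3)) \<le> 6 / x^2"
    and "x^2 / ((x - 2) * (x - 3)) \<le> 8"
    and "(x^2 - 2 * x - 1) / (x * (x - 2) * (x - 3)) \<le> 4 / x"
proof -
  define D where "D = (x - 2) * (x - 3)"
  have D: "0 < D" "D = x^2 - 5 * x + 6"
  proof -
    show "0 < D" unfolding D_def using assms by (intro mult_pos_pos) auto
    show "D = x^2 - 5 * x + 6" by (simp add: D_def power2_eq_square algebra_simps)
  qed
  have x: "0 < x" using assms by simp
  have 1: "0 \<le> (x - 4) * (23 * x - 42)" "0 \<le> (x - 4) * (7 * x - 13)" "0 \<le> (x - 4) * (5 * x - 9)"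
    "0 \<le> (x - 4) * (7 * x - 12)" "0 \<le> (x - 4) * (3 * x - 6)"
    using assms by (auto intro!: mult_nonneg_nonneg)
  have "x^2 / D - 1 = (5 * x - 6) / D" using D by (simp add: field_simps)
  moreover have "(5 * x - 6) / D \<le> 28 / x"
    using 1(1) D x by (simp add: divide_le_eq pos_le_divide_eq) (simp add: power2_eq_square algebra_simps)
  moreover have "0 \<le> (5 * x - 6) / D" using D(1) assms by simp
  ultimately show "\<bar>x^2 / ((x - 2) * (x - 3)) - 1\<bar> \<le> 28 / x"
    by (simp only: D_def[symmetric] abs_of_nonneg)
  show "(x - 1)^2 / ((x - 2) * (x - 3)) \<le> 9 / 2"
    unfolding D_def[symmetric] using 1(2) D(1)
    by (simp add: divide_le_eq) (simp add: D(2) power2_eq_square algebra_simps)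
  have "(x - 1) / (x * D) \<le> 6 / x^2"
    using 1(3) D(1) x
    by (simp add: divide_le_eq pos_le_divide_eq power2_eq_square) (simp add: D(2) power2_eq_square algebra_simps)
  then show "(x - 1) / (x * (x - 2) * (x - 3)) \<le> 6 / x^2"
    by (simp add: D_def mult.assoc)
  show "x^2 / ((x - 2) * (x - 3)) \<le> 8"
    unfolding D_def[symmetric] using 1(4) D(1)
    by (simp add: divide_le_eq) (simp add: D(2) power2_eq_square algebra_simps)
  have "(x^2 - 2 * x - 1) / (x * D) \<le> 4 / x"
    using 1(5) D(1) x
    by (simp add: divide_le_eq) (simp add: D(2) power2_eq_square algebra_simps)
  then show "(x^2 - 2 * x - 1) / (x * (x - 2) * (x - 3)) \<le> 4 / x"
    by (simp add: D_def mult.assoc)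
qed

context
  fixes p n :: nat and Z S :: "real mat" and s :: mean_setting and z :: "nat \<Rightarrow> nat \<Rightarrow> real"
  assumes Z: "Z \<in> carrier_mat p n" and p: "1 \<le> p" and n: "min_size s \<le> n"
  defines "S \<equiv> sample_cov s n Z" and "z \<equiv> \<lambda>k i. Z $$ (i, k)"
begin

lemma S_carrier: "S \<in> carrier_mat p p"
  unfolding S_def using Z by (rule sample_cov_carrier)

lemma n_pos: "2 \<le> n" "0 < dof s n"
  using n by (cases s; simp add: dof_def)+

lemma sum_outer:
  assumes "i < p" "j < p"
  shows "(\<Sum>k<n. outer (z k) (i, j)) = dof s n * S $$ (i, j)"
  unfolding S_def sample_cov_entry[OF Z assms] z_def using n_pos by simp

lemma norm_sq_scaled_outer_diff:
  "(norm_mat p (c \<cdot>\<^sub>m outer_col Z k - S))^2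
   = entry_prod p (\<lambda>a. c * outer (z k) a - S $$ a) (\<lambda>a. c * outer (z k) a - S $$ a)"
proof -
  have "(norm_mat p (c \<cdot>\<^sub>m outer_col Z k - S))^2
      = entry_prod p (($$) (c \<cdot>\<^sub>m outer_col Z k - S)) (($$) (c \<cdot>\<^sub>m outer_col Z k - S))"
    using S_carrier by (intro norm_mat_sq minus_carrier_mat)
  also have "\<dots> = entry_prod p (\<lambda>a. c * outer (z k) a - S $$ a) (\<lambda>a. c * outer (z k) a - S $$ a)"
    using S_carrier outer_col_carrier[OF Z, of k]
    by (intro entry_prod_cong) (auto simp: outer_col_entry[OF Z] z_def)
  finally show ?thesis .
qed

lemma sum_sq_outer_deviations:
  "(\<Sum>k<n. entry_prod p (\<lambda>a. real n / dof s n * outer (z k) a - S $$ a)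
                         (\<lambda>a. real n / dof s n * outer (z k) a - S $$ a))
   = (real n / dof s n)^2 * ((real n)^2 * obs_power p n z) - real n * entry_prod p (($$) S) (($$) S)"
proof -
  have "(\<Sum>k<n. real n / dof s n * outer (z k) (i, j)) = real n * S $$ (i, j)" if "i < p" "j < p" for i j
    unfolding sum_distrib_left[symmetric] sum_outer[OF that] using n_pos by simp
  from sum_sq_deviations[where f = "\<lambda>k a. real n / dof s n * outer (z k) a" and s = "($$) S"
      and n = n and p = p, OF this]
  have "(\<Sum>k<n. entry_prod p (\<lambda>a. real n / dof s n * outer (z k) a - S $$ a)
                         (\<lambda>a. real n / dof s n * outer (z k) a - S $$ a))
    = (\<Sum>k<n. (real n / dof s n)^2 * entry_prod p (outer (z k)) (outer (z k)))
      - real n * entry_prod p (($$) S) (($$) S)"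
    by (simp only: entry_prod_scale_left entry_prod_scale_right power2_eq_square mult.assoc)
  then show ?thesis using n_pos by (simp add: obs_power_def flip: sum_distrib_left)
qed

lemma inner_identity_sq_le: "(inner_mat p S (1\<^sub>m p))^2 \<le> entry_prod p (($$) S) (($$) S)"
proof -
  have "entry_prod p (($$) (1\<^sub>m p)) (($$) (1\<^sub>m p)) = (\<Sum>i<p. \<Sum>j<p. if i = j then 1 else 0) / real p"
    unfolding entry_prod_def sum.cartesian_product
    by (intro arg_cong2[where f = "(/)"] sum.cong) (auto)
  also have "\<dots> = 1" using p by simp
  finally have "entry_prod p (($$) (1\<^sub>m p)) (($$) (1\<^sub>m p :: real mat)) = 1" .
  then show ?thesis
    using entry_prod_Cauchy_Schwarz[of p "($$) S" "($$) (1\<^sub>m p)"]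
    by (simp add: inner_mat_entry_prod[OF S_carrier one_carrier_mat])
qed

text \<open>Expanding the sums of squares around the empirical mean leaves \<^const>\<open>obs_power\<close> with a factor
  \<open>1 + O(1 / n)\<close>, and multiples of \<open>\<parallel>S\<parallel>\<^sup>2 / n\<close>.  The trace term of the unknown-mean estimator costs
  a factor \<open>p / n\<close>, because \<open>\<langle>S, I\<rangle>\<^sup>2 \<le> \<parallel>S\<parallel>\<^sup>2\<close>.\<close>
lemma var_est_bound:
  "\<bar>var_est s p n Z - obs_power p n z\<bar>
   \<le> 40 / real n * (obs_power p n z + (1 + real p / real n) * entry_prod p (($$) S) (($$) S))"
proof -
  define G where "G = obs_power p n z"
  define Q where "Q = entry_prod p (($$) S) (($$) S)"
  have GQ: "0 \<le> G" "0 \<le> Q" by (simp_all add: G_def Q_def obs_power_nonneg entry_prod_nonneg)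
  define x where "x = real n"
  have x2: "2 \<le> x" using n_pos by (simp add: x_def)
  have "\<bar>var_est s p n Z - G\<bar> \<le> 40 / x * (G + (1 + real p / x) * Q)"
  proof (cases s)
    case Known_Mean
    have "1 \<cdot>\<^sub>m outer_col Z k = outer_col Z k" for k by (intro eq_matI) auto
    then have "var_est s p n Z = 1 / (x * (x - 1)) * (x^2 * G - x * Q)"
      using sum_sq_outer_deviations norm_sq_scaled_outer_diff[of 1] n_pos(1) Known_Mean
      by (simp add: dof_def S_def G_def Q_def x_def)
    also have "x^2 * G - x * Q = x * (x * G - Q)" by (simp add: power2_eq_square algebra_simps)
    also have "1 / (x * (x - 1)) * (x * (x * G - Q)) = x / (x - 1) * G - 1 / (x - 1) * Q"
      using x2 by (simp add: diff_divide_distrib)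
    also have "x / (x - 1) = 1 + 1 / (x - 1)" using x2 by (simp add: field_simps)
    finally have "var_est s p n Z - G = 1 / (x - 1) * G - 1 / (x - 1) * Q"
      by (simp add: distrib_right)
    then have "\<bar>var_est s p n Z - G\<bar> \<le> 1 / (x - 1) * G + 1 / (x - 1) * Q"
      using GQ x2 by (simp add: abs_le_iff)
    also have "\<dots> = 1 / (x - 1) * (G + Q)" by (simp add: distrib_left)
    also have "\<dots> \<le> 40 / x * (G + (1 + real p / x) * Q)"
    proof (rule mult_mono)
      show "1 / (x - 1) \<le> 40 / x" using x2 by (simp add: field_simps)
      have "1 * Q \<le> (1 + real p / x) * Q" using GQ x2 by (intro mult_right_mono) auto
      then show "G + Q \<le> G + (1 + real p / x) * Q" by simp
    qed (use GQ x2 in auto)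
    finally show ?thesis .
  next
    case Unknown_Mean
    then have x4: "4 \<le> x" using n by (simp add: x_def)
    define D where "D = (x - 2) * (x - 3)"
    have D: "0 < D" using x4 by (simp add: D_def)
    define I2 where "I2 = (inner_mat p S (1\<^sub>m p))^2"
    have I2: "0 \<le> I2" "I2 \<le> Q" using inner_identity_sq_le by (auto simp: I2_def Q_def)
    have "b_bar_sq p n Z = 1 / x^2 * ((x / (x - 1))^2 * (x^2 * G) - x * Q)"
      using sum_sq_outer_deviations norm_sq_scaled_outer_diff[of "x / (x - 1)"] Unknown_Mean
      by (simp add: b_bar_sq_def dof_def S_def G_def Q_def x_def)
    also have "\<dots> = (x / (x - 1))^2 * G - Q / x"
      using x4 by (simp add: right_diff_distrib power2_eq_square)
    finally have b: "(x - 1)^2 / D * b_bar_sq p n Z = x^2 / D * G - (x - 1)^2 / D * (Q / x)"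
      using x4 by (simp add: right_diff_distrib power_divide)
    have "var_est s p n Z = x^2 / D * G - (x - 1)^2 / D * (Q / x) - 1 / (x * (x - 2)) * Q
        - (x - 1) / (x * (x - 2) * (x - 3)) * real p * I2"
    proof -
      have "sample_cov Unknown_Mean n Z = S" using Unknown_Mean by (simp add: S_def)
      then show ?thesis
        unfolding b[symmetric] using Unknown_Mean
        by (simp add: Let_def x_def D_def I2_def Q_def norm_mat_sq[OF S_carrier] del: sample_cov.simps)
    qed
    then have "var_est s p n Z - G = (x^2 / D - 1) * G - ((x - 1)^2 / D * (Q / x) + 1 / (x * (x - 2)) * Q
        + (x - 1) / (x * (x - 2) * (x - 3)) * real p * I2)"
      by (simp add: algebra_simps)
    then have "\<bar>var_est s p n Z - G\<bar> \<le> \<bar>(x^2 / D - 1) * G\<bar> + \<bar>(x - 1)^2 / D * (Q / x) + 1 / (x * (x - 2)) * Q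
        + (x - 1) / (x * (x - 2) * (x - 3)) * real p * I2\<bar>" by (simp only: abs_triangle_ineq4)
    also have "\<bar>(x^2 / D - 1) * G\<bar> \<le> 28 / x * G"
      using mult_right_mono[OF sample_size_bounds(1)[OF x4] GQ(1)] GQ(1) by (simp add: abs_mult D_def)
    also have "\<bar>(x - 1)^2 / D * (Q / x) + 1 / (x * (x - 2)) * Q
        + (x - 1) / (x * (x - 2) * (x - 3)) * real p * I2\<bar>
      = (x - 1)^2 / D * (Q / x) + 1 / (x * (x - 2)) * Q
        + (x - 1) / (x * (x - 2) * (x - 3)) * real p * I2"
      using x4 GQ I2 D by (intro abs_of_nonneg add_nonneg_nonneg mult_nonneg_nonneg divide_nonneg_nonneg) auto
    also have "\<dots> \<le> 9 / 2 * (Q / x) + (1 / 2) * (Q / x) + 6 / x^2 * real p * Q"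
    proof (intro add_mono)
      show "(x - 1)^2 / D * (Q / x) \<le> 9 / 2 * (Q / x)"
        using sample_size_bounds(2)[OF x4] GQ x4 by (intro mult_right_mono) (auto simp: D_def)
      show "1 / (x * (x - 2)) * Q \<le> (1 / 2) * (Q / x)"
        using x4 GQ by (simp add: field_simps mult_left_mono)
      show "(x - 1) / (x * (x - 2) * (x - 3)) * real p * I2 \<le> 6 / x^2 * real p * Q"
        using sample_size_bounds(3)[OF x4] I2 x4 by (intro mult_mono) auto
    qed
    also have "28 / x * G + (9 / 2 * (Q / x) + (1 / 2) * (Q / x) + 6 / x^2 * real p * Q)
        = 1 / x * (28 * G + 5 * Q + 6 * (real p / x * Q))"
      using x4 by (simp add: field_simps power2_eq_square)
    also have "\<dots> \<le> 1 / x * (40 * (G + (1 + real p / x) * Q))"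
    proof (rule mult_left_mono)
      have "0 \<le> real p / x * Q" using GQ x4 by simp
      then show "28 * G + 5 * Q + 6 * (real p / x * Q) \<le> 40 * (G + (1 + real p / x) * Q)"
        using GQ unfolding distrib_right by argo
    qed (use x4 in simp)
    finally show ?thesis by simp
  qed
  then show ?thesis by (simp add: G_def Q_def x_def)
qed

text \<open>The sum of these estimators tends to 0, so an upper bound is enough.  Terms in \<open>\<langle>S, T\<rangle>\<^sup>2\<close> are summed
  by Bessel; a term \<open>\<langle>S T, T S\<rangle> / p\<close> is at most \<open>\<parallel>S\<parallel>\<^sup>2\<close>, and there are \<open>N\<close> of them with a
  factor \<open>O(1 / n\<^sup>2)\<close>.\<close>
lemma var_est_target_bound:
  assumes T: "targets p N T"
  shows "\<bar>\<Sum>k<N. var_est_target s p n Z (T k)\<bar>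
   \<le> 8 * target_power p n N (\<lambda>k. ($$) (T k)) z
     + 12 / real n * (1 + real N / real n) * entry_prod p (($$) S) (($$) S)"
proof -
  define t where "t = (\<lambda>k. ($$) (T k))"
  define H where "H = target_power p n N t z"
  define Q where "Q = entry_prod p (($$) S) (($$) S)"
  define B where "B = (\<Sum>k<N. (entry_prod p (($$) S) (t k))^2)"
  have on: "orthonormal p N t" using targets_orthonormal[OF T] by (simp add: t_def)
  have BQ: "B \<le> Q" unfolding B_def Q_def by (rule bessel[OF on])
  have B0: "0 \<le> B" by (simp add: B_def sum_nonneg)
  have H0: "0 \<le> H" by (simp add: H_def target_power_nonneg)
  have Q0: "0 \<le> Q" using B0 BQ by simp
  define x where "x = real n"
  have x2: "2 \<le> x" using n_pos by (simp add: x_def)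
  have Tk: "T k \<in> carrier_mat p p" if "k < N" for k using targets_carrier[OF T that] .
  have inner_S: "inner_mat p S (T k) = entry_prod p (($$) S) (t k)" if "k < N" for k
    using inner_mat_entry_prod[OF S_carrier Tk[OF that]] by (simp add: t_def)
  have inner_o: "inner_mat p (outer_col Z l) (T k) = entry_prod p (outer (z l)) (t k)" if "k < N" for k l
    using inner_mat_outer_col[OF Z Tk[OF that], of l] by (simp add: t_def z_def)
  have sumH: "(\<Sum>k<N. \<Sum>l<n. (entry_prod p (outer (z l)) (t k))^2) = x^2 * H"
    unfolding H_def target_power_def x_def using n_pos(1)
    by (subst sum.swap) simp
  have "\<bar>\<Sum>k<N. var_est_target s p n Z (T k)\<bar> \<le> 8 * H + 12 / x * (1 + real N / x) * Q"
  proof (cases s)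
    case Known_Mean
    have dev: "(\<Sum>l<n. (inner_mat p (outer_col Z l - S) (T k))^2)
        = (\<Sum>l<n. (entry_prod p (outer (z l)) (t k))^2) - x * (entry_prod p (($$) S) (t k))^2"
      if k: "k < N" for k
    proof -
      have "inner_mat p (outer_col Z l - S) (T k)
          = entry_prod p (outer (z l)) (t k) - entry_prod p (($$) S) (t k)" for l
      proof -
        have "inner_mat p (outer_col Z l - S) (T k) = entry_prod p (($$) (outer_col Z l - S)) (t k)"
          unfolding t_def by (rule inner_mat_entry_prod[OF minus_carrier_mat[OF S_carrier] Tk[OF k]])
        also have "\<dots> = entry_prod p (\<lambda>a. outer (z l) a - S $$ a) (t k)"
          using S_carrier outer_col_carrier[OF Z, of l]
          by (intro entry_prod_cong) (auto simp: outer_col_entry[OF Z] z_def)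
        finally show ?thesis by (simp add: entry_prod_diff_left)
      qed
      moreover have "(\<Sum>l<n. entry_prod p (outer (z l)) (t k)) = x * entry_prod p (($$) S) (t k)"
      proof -
        have "(\<Sum>l<n. entry_prod p (outer (z l)) (t k)) = entry_prod p (\<lambda>a. \<Sum>l<n. outer (z l) a) (t k)"
          by (simp add: entry_prod_sum_left)
        also have "\<dots> = entry_prod p (\<lambda>a. x * S $$ a) (t k)"
          using Known_Mean by (intro entry_prod_cong) (auto simp: sum_outer dof_def x_def)
        finally show ?thesis by (simp add: entry_prod_scale_left)
      qed
      ultimately show ?thesis
        using sum_sq_deviations_real[where n = n and e = "\<lambda>l. entry_prod p (outer (z l)) (t k)"
            and c = "entry_prod p (($$) S) (t k)"] by (simp add: x_def)
    qed
    have "(\<Sum>k<N. var_est_target s p n Z (T k))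
        = (\<Sum>k<N. 1 / (x * (x - 1)) * ((\<Sum>l<n. (entry_prod p (outer (z l)) (t k))^2)
            - x * (entry_prod p (($$) S) (t k))^2))"
      using Known_Mean dev by (intro sum.cong) (auto simp: S_def x_def)
    also have "\<dots> = 1 / (x * (x - 1)) * (x^2 * H - x * B)"
      unfolding sum_distrib_left[symmetric] sum_subtractf sumH B_def ..
    also have "x^2 * H - x * B = x * (x * H - B)" by (simp add: power2_eq_square algebra_simps)
    also have "1 / (x * (x - 1)) * (x * (x * H - B)) = x / (x - 1) * H - 1 / (x - 1) * B"
      using x2 by (simp add: diff_divide_distrib)
    finally have "\<bar>\<Sum>k<N. var_est_target s p n Z (T k)\<bar> = \<bar>x / (x - 1) * H - 1 / (x - 1) * B\<bar>" by simp
    also have "\<dots> \<le> x / (x - 1) * H + 1 / (x - 1) * B"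
    proof -
      have "\<bar>a - b\<bar> \<le> a + b" if "0 \<le> a" "0 \<le> b" for a b :: real using that by linarith
      then show ?thesis using H0 B0 x2 by auto
    qed
    also have "\<dots> \<le> 8 * H + 12 / x * ((1 + real N / x) * Q)"
    proof (intro add_mono mult_mono)
      show "x / (x - 1) \<le> 8" "1 / (x - 1) \<le> 12 / x" using x2 by (simp_all add: field_simps)
      have "1 * Q \<le> (1 + real N / x) * Q" using Q0 x2 by (intro mult_right_mono) auto
      then show "B \<le> (1 + real N / x) * Q" using BQ by simp
    qed (use H0 B0 x2 in auto)
    finally show ?thesis by (simp only: mult.assoc)
  next
    case Unknown_Mean
    then have x4: "4 \<le> x" using n by (simp add: x_def)
    define D where "D = (x - 2) * (x - 3)"
    have D: "0 < D" using x4 by (simp add: D_def)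
    define c where "c k = inner_mat p (S * T k) (T k * S)" for k
    have c: "\<bar>c k\<bar> \<le> real p * Q" if k: "k < N" for k
    proof -
      have car: "S * T k \<in> carrier_mat p p" "T k * S \<in> carrier_mat p p"
        using S_carrier Tk[OF k] by auto
      have tt: "entry_prod p (($$) (T k)) (($$) (T k)) = 1"
        using on k by (simp add: orthonormal_def t_def)
      have "(c k)^2 \<le> entry_prod p (($$) (S * T k)) (($$) (S * T k)) * entry_prod p (($$) (T k * S)) (($$) (T k * S))"
        unfolding c_def inner_mat_entry_prod[OF car] by (rule entry_prod_Cauchy_Schwarz)
      also have "\<dots> \<le> (real p * Q) * (real p * Q)"
        using entry_prod_mat_mult_le[OF S_carrier Tk[OF k]] entry_prod_mat_mult_le[OF Tk[OF k] S_carrier]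
        by (intro mult_mono) (auto simp: tt Q_def entry_prod_nonneg)
      finally have "\<bar>c k\<bar>^2 \<le> (real p * Q)^2" by (simp add: power2_eq_square)
      then show ?thesis by (rule power2_le_imp_le) (simp add: Q0)
    qed
    have V: "var_est_target s p n Z (T k)
        = 1 / D * (\<Sum>l<n. (entry_prod p (outer (z l)) (t k))^2)
          - 2 * ((x - 1) / (x * (x - 2) * (x - 3))) * (c k / real p)
          - q2 n * (entry_prod p (($$) S) (t k))^2" if k: "k < N" for k
    proof -
      define O2 where "O2 = (\<Sum>l<n. (entry_prod p (outer (z l)) (t k))^2)"
      have bb: "b_bar_target_sq p n Z (T k) = real p / (x - 1)^2 * O2 - 1 / x * c k"
        using Unknown_Mean by (simp add: b_bar_target_sq_def O2_def x_def c_def S_def inner_o[OF k] Let_def)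
      have "var_est_target s p n Z (T k) = q0 p n * b_bar_target_sq p n Z (T k) + q1 p n * c k
          - q2 n * (entry_prod p (($$) S) (t k))^2"
        using Unknown_Mean inner_S[OF k] by (simp add: c_def S_def Let_def)
      moreover have "q0 p n * b_bar_target_sq p n Z (T k)
          = 1 / D * O2 - (x - 1)^2 / (x * D) * (c k / real p)"
      proof -
        have "q0 p n = (x - 1)^2 / (real p * D)" by (simp add: q0_def D_def x_def mult_ac)
        then show ?thesis unfolding bb using x4 p D by (simp add: right_diff_distrib)
      qed
      moreover have "q1 p n * c k = (x - 1) * (x - 3) / (x * D) * (c k / real p)"
        using x4 by (simp add: q1_def D_def x_def[symmetric] divide_simps)
      moreover have "(x - 1) * (x - 3) / (x * D) - (x - 1)^2 / (x * D)
          = - 2 * ((x - 1) / (x * (x - 2) * (x - 3)))"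
      proof -
        have "(x - 1) * (x - 3) - (x - 1)^2 = - 2 * (x - 1)" by (simp add: power2_eq_square algebra_simps)
        then show ?thesis
          unfolding diff_divide_distrib[symmetric] by (simp only: D_def mult.assoc times_divide_eq_right)
      qed
      moreover have "V = o' - 2 * m * w - e"
        if "V = A + B - e" "A = o' - u * w" "B = r * w" "r - u = - 2 * m" for V A B e o' u w r m :: real
      proof -
        have r: "r = u - 2 * m" using that(4) by simp
        show ?thesis unfolding that(1-3) r by (simp add: algebra_simps)
      qed
      ultimately show ?thesis unfolding O2_def[symmetric] by blast
    qed
    have "(\<Sum>k<N. var_est_target s p n Z (T k))
        = 1 / D * (x^2 * H) - (\<Sum>k<N. 2 * ((x - 1) / (x * (x - 2) * (x - 3))) * (c k / real p)) - q2 n * B"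
      by (simp add: V sum_subtractf sumH[symmetric] B_def sum_distrib_left)
    moreover have "0 \<le> 1 / D * (x^2 * H)" using D H0 by simp
    moreover have "1 / D * (x^2 * H) \<le> 8 * H"
      using mult_right_mono[OF sample_size_bounds(4)[OF x4] H0] by (simp add: D_def)
    moreover have "\<bar>\<Sum>k<N. 2 * ((x - 1) / (x * (x - 2) * (x - 3))) * (c k / real p)\<bar>
        \<le> (\<Sum>k<N. 2 * (6 / x^2) * Q)"
    proof (rule order_trans[OF sum_abs sum_mono])
      fix k assume "k \<in> {..<N}"
      then have "\<bar>c k\<bar> / real p \<le> Q" using c[of k] p by (simp add: divide_le_eq mult.commute)
      then have "\<bar>c k / real p\<bar> \<le> Q" by simp
      moreover have "\<bar>(x - 1) / (x * (x - 2) * (x - 3))\<bar> \<le> 6 / x^2"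
        using sample_size_bounds(3)[OF x4] x4 by (subst abs_of_nonneg) auto
      ultimately show "\<bar>2 * ((x - 1) / (x * (x - 2) * (x - 3))) * (c k / real p)\<bar> \<le> 2 * (6 / x^2) * Q"
        unfolding abs_mult[of _ "c k / real p"] abs_mult[of 2] by (intro mult_mono) auto
    qed
    moreover have "0 \<le> q2 n * B"
    proof -
      have "0 \<le> (x - 4) * (x + 2) + 7" using x4 by (intro add_nonneg_nonneg mult_nonneg_nonneg) auto
      then have "0 \<le> x^2 - 2 * x - 1" by (simp add: power2_eq_square algebra_simps)
      then have "0 \<le> q2 n" unfolding q2_def x_def[symmetric] using x4 by (intro divide_nonneg_nonneg) auto
      then show ?thesis using B0 by simp
    qed
    moreover have "q2 n * B \<le> 4 / x * Q"
      using sample_size_bounds(5)[OF x4] BQ B0 x4 by (intro mult_mono) (auto simp: q2_def x_def)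
    ultimately have "\<bar>\<Sum>k<N. var_est_target s p n Z (T k)\<bar> \<le> 8 * H + ((\<Sum>k<N. 2 * (6 / x^2) * Q) + 4 / x * Q)"
      by linarith
    also have "(\<Sum>k<N. 2 * (6 / x^2) * Q) + 4 / x * Q \<le> 12 / x * (1 + real N / x) * Q"
    proof -
      have "(\<Sum>k<N. 2 * (6 / x^2) * Q) = 12 / x * (real N / x) * Q"
        by (simp add: power2_eq_square)
      moreover have "4 / x * Q \<le> 12 / x * Q"
        using x4 Q0 by (intro mult_right_mono divide_right_mono) auto
      ultimately show ?thesis by (simp add: distrib_left distrib_right)
    qed
    finally show ?thesis by simp
  qed
  then show ?thesis by (simp add: H_def t_def Q_def x_def)
qed

end

section \<open>Families of random variables that vanish in mean\<close>

text \<open>Integrability is required separately because the Bochner integral of a non-integrable function is 0.\<close>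
definition L1_bounded :: "nat \<Rightarrow> (nat \<Rightarrow> 'a measure) \<Rightarrow> (nat \<Rightarrow> 'a \<Rightarrow> real) \<Rightarrow> bool" where
  "L1_bounded n0 M f \<longleftrightarrow> (\<forall>n\<ge>n0. integrable (M n) (f n)) \<and>
     (\<exists>B. \<forall>n\<ge>n0. integral\<^sup>L (M n) (\<lambda>\<omega>. \<bar>f n \<omega>\<bar>) \<le> B)"

definition L1_null :: "nat \<Rightarrow> (nat \<Rightarrow> 'a measure) \<Rightarrow> (nat \<Rightarrow> 'a \<Rightarrow> real) \<Rightarrow> bool" where
  "L1_null n0 M f \<longleftrightarrow> (\<forall>n\<ge>n0. integrable (M n) (f n)) \<and>
     (\<lambda>n. integral\<^sup>L (M n) (\<lambda>\<omega>. \<bar>f n \<omega>\<bar>)) \<longlonglongrightarrow> 0"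

lemma L1_nullI:
  assumes "\<And>n. n \<ge> n0 \<Longrightarrow> integrable (M n) (f n)"
    and "\<And>n. n \<ge> n0 \<Longrightarrow> integral\<^sup>L (M n) (\<lambda>\<omega>. \<bar>f n \<omega>\<bar>) \<le> e n" and "e \<longlonglongrightarrow> 0"
  shows "L1_null n0 M f"
proof -
  have "(\<lambda>n. integral\<^sup>L (M n) (\<lambda>\<omega>. \<bar>f n \<omega>\<bar>)) \<longlonglongrightarrow> 0"
  proof (rule tendsto_sandwich[OF _ _ tendsto_const assms(3)])
    show "\<forall>\<^sub>F n in sequentially. 0 \<le> integral\<^sup>L (M n) (\<lambda>\<omega>. \<bar>f n \<omega>\<bar>)"
      by (intro always_eventually allI Bochner_Integration.integral_nonneg) auto
    show "\<forall>\<^sub>F n in sequentially. integral\<^sup>L (M n) (\<lambda>\<omega>. \<bar>f n \<omega>\<bar>) \<le> e n"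
      using assms(2) by (auto simp: eventually_sequentially)
  qed
  then show ?thesis using assms(1) by (simp add: L1_null_def)
qed

lemma L1_boundedI:
  assumes "\<And>n. n \<ge> n0 \<Longrightarrow> integrable (M n) (f n)"
    and "\<And>n. n \<ge> n0 \<Longrightarrow> integral\<^sup>L (M n) (\<lambda>\<omega>. \<bar>f n \<omega>\<bar>) \<le> B"
  shows "L1_bounded n0 M f"
  using assms by (auto simp: L1_bounded_def)

lemma L1_null_imp_mean_tends_to_zero:
  assumes "L1_null n0 M f" shows "mean_tends_to_zero n0 M f"
proof -
  have "(\<lambda>n. integral\<^sup>L (M n) (f n)) \<longlonglongrightarrow> 0"
  proof (rule Lim_null_comparison)
    show "\<forall>\<^sub>F n in sequentially. norm (integral\<^sup>L (M n) (f n)) \<le> integral\<^sup>L (M n) (\<lambda>\<omega>. \<bar>f n \<omega>\<bar>)"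
      by (intro always_eventually allI) (use integral_norm_bound in fastforce)
  qed (use assms in \<open>simp add: L1_null_def\<close>)
  then show ?thesis using assms by (simp add: mean_tends_to_zero_def L1_null_def)
qed

lemma L1_null_add:
  assumes "L1_null n0 M f" "L1_null n0 M g"
  shows "L1_null n0 M (\<lambda>n \<omega>. f n \<omega> + g n \<omega>)"
proof (rule L1_nullI)
  fix n assume n: "n \<ge> n0"
  have i: "integrable (M n) (f n)" "integrable (M n) (g n)" using assms n by (auto simp: L1_null_def)
  then show "integrable (M n) (\<lambda>\<omega>. f n \<omega> + g n \<omega>)" by simp
  have "integral\<^sup>L (M n) (\<lambda>\<omega>. \<bar>f n \<omega> + g n \<omega>\<bar>) \<le> integral\<^sup>L (M n) (\<lambda>\<omega>. \<bar>f n \<omega>\<bar> + \<bar>g n \<omega>\<bar>)"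
    using i by (intro integral_mono) auto
  then show "integral\<^sup>L (M n) (\<lambda>\<omega>. \<bar>f n \<omega> + g n \<omega>\<bar>)
      \<le> integral\<^sup>L (M n) (\<lambda>\<omega>. \<bar>f n \<omega>\<bar>) + integral\<^sup>L (M n) (\<lambda>\<omega>. \<bar>g n \<omega>\<bar>)"
    using i by simp
next
  show "(\<lambda>n. integral\<^sup>L (M n) (\<lambda>\<omega>. \<bar>f n \<omega>\<bar>) + integral\<^sup>L (M n) (\<lambda>\<omega>. \<bar>g n \<omega>\<bar>)) \<longlonglongrightarrow> 0"
    using assms tendsto_add[of "\<lambda>n. integral\<^sup>L (M n) (\<lambda>\<omega>. \<bar>f n \<omega>\<bar>)" 0 sequentially
        "\<lambda>n. integral\<^sup>L (M n) (\<lambda>\<omega>. \<bar>g n \<omega>\<bar>)" 0] by (simp add: L1_null_def)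
qed

lemma L1_bounded_add:
  assumes "L1_bounded n0 M f" "L1_bounded n0 M g"
  shows "L1_bounded n0 M (\<lambda>n \<omega>. f n \<omega> + g n \<omega>)"
proof -
  obtain B C where B: "\<forall>n\<ge>n0. integral\<^sup>L (M n) (\<lambda>\<omega>. \<bar>f n \<omega>\<bar>) \<le> B"
    and C: "\<forall>n\<ge>n0. integral\<^sup>L (M n) (\<lambda>\<omega>. \<bar>g n \<omega>\<bar>) \<le> C"
    using assms by (auto simp: L1_bounded_def)
  show ?thesis
  proof (rule L1_boundedI)
    fix n assume n: "n \<ge> n0"
    have i: "integrable (M n) (f n)" "integrable (M n) (g n)" using assms n by (auto simp: L1_bounded_def)
    then show "integrable (M n) (\<lambda>\<omega>. f n \<omega> + g n \<omega>)" by simp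
    have "integral\<^sup>L (M n) (\<lambda>\<omega>. \<bar>f n \<omega> + g n \<omega>\<bar>) \<le> integral\<^sup>L (M n) (\<lambda>\<omega>. \<bar>f n \<omega>\<bar> + \<bar>g n \<omega>\<bar>)"
      using i by (intro integral_mono) auto
    also have "\<dots> = integral\<^sup>L (M n) (\<lambda>\<omega>. \<bar>f n \<omega>\<bar>) + integral\<^sup>L (M n) (\<lambda>\<omega>. \<bar>g n \<omega>\<bar>)" using i by simp
    also have "\<dots> \<le> B + C" using B C n by (intro add_mono) auto
    finally show "integral\<^sup>L (M n) (\<lambda>\<omega>. \<bar>f n \<omega> + g n \<omega>\<bar>) \<le> B + C" .
  qed
qed

lemma L1_null_imp_bounded:
  assumes "L1_null n0 M f" shows "L1_bounded n0 M f"
proof -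
  have "convergent (\<lambda>n. integral\<^sup>L (M n) (\<lambda>\<omega>. \<bar>f n \<omega>\<bar>))"
    using assms by (auto simp: L1_null_def convergent_def)
  then have "Bseq (\<lambda>n. integral\<^sup>L (M n) (\<lambda>\<omega>. \<bar>f n \<omega>\<bar>))" by (rule convergent_imp_Bseq)
  then obtain B where "\<forall>n. norm (integral\<^sup>L (M n) (\<lambda>\<omega>. \<bar>f n \<omega>\<bar>)) \<le> B" by (auto simp: Bseq_def)
  then have "\<forall>n. integral\<^sup>L (M n) (\<lambda>\<omega>. \<bar>f n \<omega>\<bar>) \<le> B" using norm_ge_zero by (metis abs_le_D1 real_norm_def)
  then show ?thesis using assms by (auto simp: L1_null_def L1_bounded_def)
qed

lemma L1_null_scale_bounded:
  assumes "L1_bounded n0 M f" "c \<longlonglongrightarrow> 0"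
  shows "L1_null n0 M (\<lambda>n \<omega>. c n * f n \<omega>)"
proof -
  obtain B where B: "\<forall>n\<ge>n0. integral\<^sup>L (M n) (\<lambda>\<omega>. \<bar>f n \<omega>\<bar>) \<le> B"
    using assms by (auto simp: L1_bounded_def)
  show ?thesis
  proof (rule L1_nullI)
    fix n assume n: "n \<ge> n0"
    then show "integrable (M n) (\<lambda>\<omega>. c n * f n \<omega>)" using assms(1) by (auto simp: L1_bounded_def)
    show "integral\<^sup>L (M n) (\<lambda>\<omega>. \<bar>c n * f n \<omega>\<bar>) \<le> \<bar>c n\<bar> * B"
      using B n by (simp add: abs_mult mult_left_mono)
  next
    have "(\<lambda>n. \<bar>c n\<bar>) \<longlonglongrightarrow> 0" using assms(2) by (rule tendsto_rabs_zero)
    then show "(\<lambda>n. \<bar>c n\<bar> * B) \<longlonglongrightarrow> 0" by (rule tendsto_mult_left_zero)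
  qed
qed

lemma L1_bounded_cmult:
  assumes "L1_bounded n0 M f" shows "L1_bounded n0 M (\<lambda>n \<omega>. c * f n \<omega>)"
proof -
  obtain B where B: "\<forall>n\<ge>n0. integral\<^sup>L (M n) (\<lambda>\<omega>. \<bar>f n \<omega>\<bar>) \<le> B"
    using assms by (auto simp: L1_bounded_def)
  show ?thesis
  proof (rule L1_boundedI)
    fix n assume n: "n \<ge> n0"
    then show "integrable (M n) (\<lambda>\<omega>. c * f n \<omega>)" using assms(1) by (auto simp: L1_bounded_def)
    show "integral\<^sup>L (M n) (\<lambda>\<omega>. \<bar>c * f n \<omega>\<bar>) \<le> \<bar>c\<bar> * B"
      using B n by (simp add: abs_mult mult_left_mono)
  qed
qed

lemma L1_null_cmult:
  assumes "L1_null n0 M f" shows "L1_null n0 M (\<lambda>n \<omega>. c * f n \<omega>)"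
proof (rule L1_nullI)
  fix n assume n: "n \<ge> n0"
  then show "integrable (M n) (\<lambda>\<omega>. c * f n \<omega>)" using assms(1) by (auto simp: L1_null_def)
  show "integral\<^sup>L (M n) (\<lambda>\<omega>. \<bar>c * f n \<omega>\<bar>) \<le> \<bar>c\<bar> * integral\<^sup>L (M n) (\<lambda>\<omega>. \<bar>f n \<omega>\<bar>)"
    by (simp add: abs_mult)
next
  show "(\<lambda>n. \<bar>c\<bar> * integral\<^sup>L (M n) (\<lambda>\<omega>. \<bar>f n \<omega>\<bar>)) \<longlonglongrightarrow> 0"
    using assms by (intro tendsto_mult_right_zero) (simp add: L1_null_def)
qed

lemma L1_null_abs:
  assumes "L1_null n0 M f" shows "L1_null n0 M (\<lambda>n \<omega>. \<bar>f n \<omega>\<bar>)"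
  using assms by (simp add: L1_null_def)

lemma L1_null_dominated:
  assumes g: "L1_null n0 M g"
    and f: "\<And>n. n \<ge> n0 \<Longrightarrow> f n \<in> borel_measurable (M n)"
    and le: "\<And>n \<omega>. n \<ge> n0 \<Longrightarrow> \<omega> \<in> space (M n) \<Longrightarrow> \<bar>f n \<omega>\<bar> \<le> g n \<omega>"
  shows "L1_null n0 M f"
proof (rule L1_nullI)
  fix n assume n: "n \<ge> n0"
  have i: "integrable (M n) (g n)" using g n by (simp add: L1_null_def)
  show i': "integrable (M n) (f n)"
    using le n by (intro Bochner_Integration.integrable_bound[OF i f]) fastforce+
  show "integral\<^sup>L (M n) (\<lambda>\<omega>. \<bar>f n \<omega>\<bar>) \<le> integral\<^sup>L (M n) (\<lambda>\<omega>. \<bar>g n \<omega>\<bar>)"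
    using i i' le n by (intro integral_mono) fastforce+
qed (use g in \<open>simp add: L1_null_def\<close>)

lemma L1_bounded_dominated:
  assumes g: "L1_bounded n0 M g"
    and f: "\<And>n. n \<ge> n0 \<Longrightarrow> f n \<in> borel_measurable (M n)"
    and le: "\<And>n \<omega>. n \<ge> n0 \<Longrightarrow> \<omega> \<in> space (M n) \<Longrightarrow> \<bar>f n \<omega>\<bar> \<le> g n \<omega>"
  shows "L1_bounded n0 M f"
proof -
  obtain B where B: "\<forall>n\<ge>n0. integral\<^sup>L (M n) (\<lambda>\<omega>. \<bar>g n \<omega>\<bar>) \<le> B"
    using g by (auto simp: L1_bounded_def)
  show ?thesis
  proof (rule L1_boundedI)
    fix n assume n: "n \<ge> n0"
    have i: "integrable (M n) (g n)" using g n by (simp add: L1_bounded_def)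
    show i': "integrable (M n) (f n)"
      using le n by (intro Bochner_Integration.integrable_bound[OF i f]) fastforce+
    have "integral\<^sup>L (M n) (\<lambda>\<omega>. \<bar>f n \<omega>\<bar>) \<le> integral\<^sup>L (M n) (\<lambda>\<omega>. \<bar>g n \<omega>\<bar>)"
      using i i' le n by (intro integral_mono) fastforce+
    then show "integral\<^sup>L (M n) (\<lambda>\<omega>. \<bar>f n \<omega>\<bar>) \<le> B" using B n by force
  qed
qed

text \<open>Cauchy--Schwarz, through \<open>\<surd>(f g) \<le> (t f + g / t) / 2\<close> with a large constant \<open>t\<close>.\<close>
lemma L1_null_geometric_mean:
  assumes f: "L1_null n0 M f" and g: "L1_bounded n0 M g"
    and nonneg: "\<And>n \<omega>. n \<ge> n0 \<Longrightarrow> \<omega> \<in> space (M n) \<Longrightarrow> 0 \<le> f n \<omega> \<and> 0 \<le> g n \<omega>"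
  shows "L1_null n0 M (\<lambda>n \<omega>. sqrt (f n \<omega>) * sqrt (g n \<omega>))"
proof -
  obtain B where B: "\<forall>n\<ge>n0. integral\<^sup>L (M n) (\<lambda>\<omega>. \<bar>g n \<omega>\<bar>) \<le> B"
    using g by (auto simp: L1_bounded_def)
  have if': "integrable (M n) (f n)" and ig: "integrable (M n) (g n)" if "n \<ge> n0" for n
    using f g that by (auto simp: L1_null_def L1_bounded_def)
  have pt: "sqrt (f n \<omega>) * sqrt (g n \<omega>) \<le> t / 2 * f n \<omega> + 1 / (2 * t) * g n \<omega>"
    if "n \<ge> n0" "\<omega> \<in> space (M n)" "0 < t" for n \<omega> t
  proof -
    define a where "a = sqrt (f n \<omega>)"
    define b where "b = sqrt (g n \<omega>)"
    have ab: "f n \<omega> = a^2" "g n \<omega> = b^2" using nonneg[OF that(1,2)] by (auto simp: a_def b_def)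
    have "0 \<le> (t * a - b)^2 / (2 * t)" using that(3) by simp
    also have "\<dots> = t / 2 * a^2 + 1 / (2 * t) * b^2 - a * b"
      using that(3) by (simp add: field_simps power2_eq_square)
    finally show ?thesis unfolding ab by (simp add: a_def[symmetric] b_def[symmetric] ab[symmetric])
  qed
  have int: "integrable (M n) (\<lambda>\<omega>. sqrt (f n \<omega>) * sqrt (g n \<omega>))" if n: "n \<ge> n0" for n
  proof (rule Bochner_Integration.integrable_bound)
    show "integrable (M n) (\<lambda>\<omega>. 1 / 2 * f n \<omega> + 1 / (2 * 1) * g n \<omega>)"
      using if'[OF n] ig[OF n] by simp
    show "(\<lambda>\<omega>. sqrt (f n \<omega>) * sqrt (g n \<omega>)) \<in> borel_measurable (M n)"
      using borel_measurable_integrable[OF if'[OF n]] borel_measurable_integrable[OF ig[OF n]] by measurable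
    show "AE \<omega> in M n. norm (sqrt (f n \<omega>) * sqrt (g n \<omega>)) \<le> norm (1 / 2 * f n \<omega> + 1 / (2 * 1) * g n \<omega>)"
    proof (rule AE_I2)
      fix \<omega> assume w: "\<omega> \<in> space (M n)"
      then show "norm (sqrt (f n \<omega>) * sqrt (g n \<omega>)) \<le> norm (1 / 2 * f n \<omega> + 1 / (2 * 1) * g n \<omega>)"
        using pt[OF n w, of 1] nonneg[OF n w] by simp
    qed
  qed
  have bound: "integral\<^sup>L (M n) (\<lambda>\<omega>. \<bar>sqrt (f n \<omega>) * sqrt (g n \<omega>)\<bar>)
      \<le> t / 2 * integral\<^sup>L (M n) (\<lambda>\<omega>. \<bar>f n \<omega>\<bar>) + 1 / (2 * t) * B" if n: "n \<ge> n0" and t: "0 < t" for n t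
  proof -
    have "integral\<^sup>L (M n) (\<lambda>\<omega>. \<bar>sqrt (f n \<omega>) * sqrt (g n \<omega>)\<bar>)
        \<le> integral\<^sup>L (M n) (\<lambda>\<omega>. t / 2 * \<bar>f n \<omega>\<bar> + 1 / (2 * t) * \<bar>g n \<omega>\<bar>)"
    proof (rule integral_mono)
      fix \<omega> assume w: "\<omega> \<in> space (M n)"
      then show "\<bar>sqrt (f n \<omega>) * sqrt (g n \<omega>)\<bar> \<le> t / 2 * \<bar>f n \<omega>\<bar> + 1 / (2 * t) * \<bar>g n \<omega>\<bar>"
        using pt[OF n w t] nonneg[OF n w] by simp
    qed (use if'[OF n] ig[OF n] int[OF n] in auto)
    also have "\<dots> = t / 2 * integral\<^sup>L (M n) (\<lambda>\<omega>. \<bar>f n \<omega>\<bar>) + 1 / (2 * t) * integral\<^sup>L (M n) (\<lambda>\<omega>. \<bar>g n \<omega>\<bar>)"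
      using if'[OF n] ig[OF n] by simp
    also have "\<dots> \<le> t / 2 * integral\<^sup>L (M n) (\<lambda>\<omega>. \<bar>f n \<omega>\<bar>) + 1 / (2 * t) * B"
      using B n t by (intro add_left_mono mult_left_mono) auto
    finally show ?thesis .
  qed
  have "(\<lambda>n. integral\<^sup>L (M n) (\<lambda>\<omega>. \<bar>sqrt (f n \<omega>) * sqrt (g n \<omega>)\<bar>)) \<longlonglongrightarrow> 0"
  proof (rule LIMSEQ_I)
    fix e :: real assume e: "0 < e"
    define t where "t = (\<bar>B\<bar> + 1) / e"
    have t: "0 < t" using e by (simp add: t_def add_nonneg_pos)
    have tB: "1 / (2 * t) * B \<le> e / 2"
    proof -
      have "1 / (2 * t) * B \<le> 1 / (2 * t) * (\<bar>B\<bar> + 1)" using t by (intro mult_left_mono) auto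
      also have "\<bar>B\<bar> + 1 = t * e" using e by (simp add: t_def)
      also have "1 / (2 * t) * (t * e) = e / 2" using t by simp
      finally show ?thesis .
    qed
    have "(\<lambda>n. t / 2 * integral\<^sup>L (M n) (\<lambda>\<omega>. \<bar>f n \<omega>\<bar>)) \<longlonglongrightarrow> 0"
      using f by (intro tendsto_mult_right_zero) (simp add: L1_null_def)
    then have "\<forall>\<^sub>F n in sequentially. t / 2 * integral\<^sup>L (M n) (\<lambda>\<omega>. \<bar>f n \<omega>\<bar>) < e / 2"
      by (rule order_tendstoD) (use e in simp)
    then obtain m where m: "\<And>n. n \<ge> m \<Longrightarrow> t / 2 * integral\<^sup>L (M n) (\<lambda>\<omega>. \<bar>f n \<omega>\<bar>) < e / 2"
      by (auto simp: eventually_sequentially)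
    show "\<exists>no. \<forall>n\<ge>no. norm (integral\<^sup>L (M n) (\<lambda>\<omega>. \<bar>sqrt (f n \<omega>) * sqrt (g n \<omega>)\<bar>) - 0) < e"
    proof (intro exI allI impI)
      fix n assume n: "n \<ge> max m n0"
      then have "integral\<^sup>L (M n) (\<lambda>\<omega>. \<bar>sqrt (f n \<omega>) * sqrt (g n \<omega>)\<bar>) < e"
        using bound[of n t] t m[of n] tB by fastforce
      moreover have "0 \<le> integral\<^sup>L (M n) (\<lambda>\<omega>. \<bar>sqrt (f n \<omega>) * sqrt (g n \<omega>)\<bar>)"
        by (intro Bochner_Integration.integral_nonneg) auto
      ultimately show "norm (integral\<^sup>L (M n) (\<lambda>\<omega>. \<bar>sqrt (f n \<omega>) * sqrt (g n \<omega>)\<bar>) - 0) < e" by simp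
    qed
  qed
  then show ?thesis using int by (simp add: L1_null_def)
qed

lemma L1_null_sqrt:
  assumes f: "L1_null n0 M f" and prob: "\<And>n. n \<ge> n0 \<Longrightarrow> prob_space (M n)"
    and nonneg: "\<And>n \<omega>. n \<ge> n0 \<Longrightarrow> \<omega> \<in> space (M n) \<Longrightarrow> 0 \<le> f n \<omega>"
  shows "L1_null n0 M (\<lambda>n \<omega>. sqrt (f n \<omega>))"
proof -
  have "L1_bounded n0 M (\<lambda>n \<omega>. 1)"
  proof (rule L1_boundedI[where B = 1])
    fix n assume "n \<ge> n0"
    then interpret prob_space "M n" by (rule prob)
    show "integrable (M n) (\<lambda>\<omega>. 1 :: real)" "integral\<^sup>L (M n) (\<lambda>\<omega>. \<bar>1 :: real\<bar>) \<le> 1"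
      by (simp_all add: prob_space)
  qed
  from L1_null_geometric_mean[OF f this] nonneg show ?thesis by simp
qed

lemma L1_bounded_const:
  assumes "\<And>n. n \<ge> n0 \<Longrightarrow> prob_space (M n)" "\<And>n. n \<ge> n0 \<Longrightarrow> \<bar>c n\<bar> \<le> B"
  shows "L1_bounded n0 M (\<lambda>n \<omega>. c n)"
proof (rule L1_boundedI[where B = B])
  fix n assume n: "n \<ge> n0"
  then interpret prob_space "M n" by (rule assms(1))
  show "integrable (M n) (\<lambda>\<omega>. c n)" "integral\<^sup>L (M n) (\<lambda>\<omega>. \<bar>c n\<bar>) \<le> B"
    using assms(2)[OF n] by (simp_all add: prob_space)
qed

section \<open>Second moments of sums of independent terms\<close>

text \<open>Orders are natural numbers, and are halved by products: this is all that is needed to propagate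
  integrability from eighth moments of the coordinates.\<close>
definition Lp_fun :: "'a measure \<Rightarrow> nat \<Rightarrow> ('a \<Rightarrow> real) \<Rightarrow> bool" where
  "Lp_fun M q f \<longleftrightarrow> f \<in> borel_measurable M \<and> integrable M (\<lambda>\<omega>. \<bar>f \<omega>\<bar> ^ q)"

lemma Lp_fun_1: "Lp_fun M 1 f \<longleftrightarrow> integrable M f"
  unfolding Lp_fun_def by (auto simp: integrable_abs_iff)

lemma Lp_fun_measurable: "Lp_fun M q f \<Longrightarrow> f \<in> borel_measurable M"
  by (simp add: Lp_fun_def)

lemma Lp_fun_add:
  assumes "Lp_fun M q f" "Lp_fun M q g" shows "Lp_fun M q (\<lambda>\<omega>. f \<omega> + g \<omega>)"
proof -
  have m: "f \<in> borel_measurable M" "g \<in> borel_measurable M" using assms by (auto simp: Lp_fun_def)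
  have "\<bar>x + y\<bar> ^ q \<le> 2 ^ q * (\<bar>x\<bar> ^ q + \<bar>y\<bar> ^ q)" for x y :: real
  proof -
    have "\<bar>x + y\<bar> ^ q \<le> (2 * max \<bar>x\<bar> \<bar>y\<bar>) ^ q" by (intro power_mono) auto
    also have "\<dots> \<le> 2 ^ q * (\<bar>x\<bar> ^ q + \<bar>y\<bar> ^ q)"
      unfolding power_mult_distrib by (intro mult_left_mono) (auto simp: max_def)
    finally show ?thesis .
  qed
  moreover have "integrable M (\<lambda>\<omega>. 2 ^ q * (\<bar>f \<omega>\<bar> ^ q + \<bar>g \<omega>\<bar> ^ q))"
    using assms by (auto simp: Lp_fun_def)
  ultimately have "integrable M (\<lambda>\<omega>. \<bar>f \<omega> + g \<omega>\<bar> ^ q)"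
    using m by (elim Bochner_Integration.integrable_bound) auto
  then show ?thesis using m by (simp add: Lp_fun_def)
qed

lemma Lp_fun_cmult:
  assumes "Lp_fun M q f" shows "Lp_fun M q (\<lambda>\<omega>. c * f \<omega>)"
  using assms by (auto simp: Lp_fun_def abs_mult power_mult_distrib)

lemma Lp_fun_mult:
  assumes "Lp_fun M (2 * q) f" "Lp_fun M (2 * q) g" shows "Lp_fun M q (\<lambda>\<omega>. f \<omega> * g \<omega>)"
proof -
  have m: "f \<in> borel_measurable M" "g \<in> borel_measurable M" using assms by (auto simp: Lp_fun_def)
  have "\<bar>x * y\<bar> ^ q \<le> \<bar>x\<bar> ^ (2 * q) + \<bar>y\<bar> ^ (2 * q)" for x y :: real
  proof -
    define a b where "a = \<bar>x\<bar> ^ q" "b = \<bar>y\<bar> ^ q"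
    have "a * b \<le> a^2 + b^2"
    proof -
      have "0 \<le> (a - b)^2" "0 \<le> a * b" by (simp_all add: a_b_def)
      moreover have "(a - b)^2 = a^2 + b^2 - 2 * (a * b)" by (simp add: power2_eq_square algebra_simps)
      ultimately show ?thesis by linarith
    qed
    then show ?thesis by (simp add: a_b_def abs_mult power_mult_distrib power_mult power2_eq_square
          mult_2 power_add)
  qed
  moreover have "integrable M (\<lambda>\<omega>. \<bar>f \<omega>\<bar> ^ (2 * q) + \<bar>g \<omega>\<bar> ^ (2 * q))"
    using assms by (auto simp: Lp_fun_def)
  ultimately have "integrable M (\<lambda>\<omega>. \<bar>f \<omega> * g \<omega>\<bar> ^ q)"
    using m by (elim Bochner_Integration.integrable_bound) auto
  then show ?thesis using m by (simp add: Lp_fun_def)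
qed

context prob_space
begin

lemma Lp_fun_const: "Lp_fun M q (\<lambda>_. c)"
  by (simp add: Lp_fun_def)

lemma Lp_fun_if:
  assumes "c \<Longrightarrow> Lp_fun M q f" "\<not> c \<Longrightarrow> Lp_fun M q g"
  shows "Lp_fun M q (\<lambda>\<omega>. if c then f \<omega> else g \<omega>)"
  using assms by (cases c) simp_all

lemma Lp_fun_sum:
  assumes "\<And>i. i \<in> I \<Longrightarrow> Lp_fun M q (f i)" shows "Lp_fun M q (\<lambda>\<omega>. \<Sum>i\<in>I. f i \<omega>)"
  using assms by (induction I rule: infinite_finite_induct) (auto intro: Lp_fun_add Lp_fun_const)

lemma Lp_fun_diff:
  assumes "Lp_fun M q f" "Lp_fun M q g" shows "Lp_fun M q (\<lambda>\<omega>. f \<omega> - g \<omega>)"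
  using Lp_fun_add[OF assms(1) Lp_fun_cmult[OF assms(2), of "-1"]] by simp

lemma Lp_fun_halve:
  assumes "Lp_fun M (2 * q) f" shows "Lp_fun M q f"
  using Lp_fun_mult[OF assms Lp_fun_const[of _ 1]] by simp

lemma Lp_fun_4_2: "Lp_fun M 4 f \<Longrightarrow> Lp_fun M 2 f"
  and Lp_fun_2_1: "Lp_fun M 2 f \<Longrightarrow> integrable M f"
  and Lp_fun_8_4: "Lp_fun M 8 f \<Longrightarrow> Lp_fun M 4 f"
  using Lp_fun_halve[of 2 f] Lp_fun_halve[of 1 f] Lp_fun_halve[of 4 f] by (simp_all add: Lp_fun_1[symmetric])

lemma Lp_fun_mult_8: "Lp_fun M 8 f \<Longrightarrow> Lp_fun M 8 g \<Longrightarrow> Lp_fun M 4 (\<lambda>\<omega>. f \<omega> * g \<omega>)"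
  and Lp_fun_mult_4: "Lp_fun M 4 f \<Longrightarrow> Lp_fun M 4 g \<Longrightarrow> Lp_fun M 2 (\<lambda>\<omega>. f \<omega> * g \<omega>)"
  and Lp_fun_mult_2: "Lp_fun M 2 f \<Longrightarrow> Lp_fun M 2 g \<Longrightarrow> integrable M (\<lambda>\<omega>. f \<omega> * g \<omega>)"
  using Lp_fun_mult[of M 4 f g] Lp_fun_mult[of M 2 f g] Lp_fun_mult[of M 1 f g]
  by (simp_all add: Lp_fun_1[symmetric])

lemma expectation_prod_pair:
  fixes Y :: "nat \<Rightarrow> 'a \<Rightarrow> 'b" and f g :: "'b \<Rightarrow> real"
  assumes indep: "indep_vars (\<lambda>_. R) Y {..<n}" and kl: "k < n" "l < n" "k \<noteq> l"
    and meas: "f \<in> borel_measurable R" "g \<in> borel_measurable R"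
    and int: "integrable M (\<lambda>\<omega>. f (Y k \<omega>))" "integrable M (\<lambda>\<omega>. g (Y l \<omega>))"
  shows "expectation (\<lambda>\<omega>. f (Y k \<omega>) * g (Y l \<omega>))
       = expectation (\<lambda>\<omega>. f (Y k \<omega>)) * expectation (\<lambda>\<omega>. g (Y l \<omega>))"
proof -
  define h where "h i = (if i = k then f else g)" for i
  have "indep_vars (\<lambda>_. borel) (\<lambda>i \<omega>. h i (Y i \<omega>)) {k, l}"
    using meas kl by (intro indep_vars_compose2[OF indep_vars_subset[OF indep]]) (auto simp: h_def)
  moreover have "integrable M (\<lambda>\<omega>. h i (Y i \<omega>))" if "i \<in> {k, l}" for i
    using that int by (auto simp: h_def)
  ultimately have "expectation (\<lambda>\<omega>. \<Prod>i\<in>{k, l}. h i (Y i \<omega>)) = (\<Prod>i\<in>{k, l}. expectation (\<lambda>\<omega>. h i (Y i \<omega>)))"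
    by (intro indep_vars_lebesgue_integral) auto
  then show ?thesis using kl by (simp add: h_def)
qed

text \<open>The index \<open>k\<close> occurs only once among the four, so its centred factor splits off.\<close>
lemma expectation_prod_isolated:
  fixes Y :: "nat \<Rightarrow> 'a \<Rightarrow> 'b"
  assumes indep: "indep_vars (\<lambda>_. R) Y {..<n}"
    and idx: "k < n" "l < n" "k' < n" "l' < n" "k \<noteq> l" "k \<noteq> k'" "k \<noteq> l'"
    and meas: "f \<in> borel_measurable R" "g \<in> borel_measurable R" "f' \<in> borel_measurable R" "g' \<in> borel_measurable R"
    and L4: "Lp_fun M 4 (\<lambda>\<omega>. f (Y k \<omega>))" "\<And>i. i < n \<Longrightarrow> Lp_fun M 4 (\<lambda>\<omega>. g (Y i \<omega>))"
      "\<And>i. i < n \<Longrightarrow> Lp_fun M 4 (\<lambda>\<omega>. f' (Y i \<omega>))" "\<And>i. i < n \<Longrightarrow> Lp_fun M 4 (\<lambda>\<omega>. g' (Y i \<omega>))"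
    and centred: "expectation (\<lambda>\<omega>. f (Y k \<omega>)) = 0"
  shows "expectation (\<lambda>\<omega>. f (Y k \<omega>) * g (Y l \<omega>) * (f' (Y k' \<omega>) * g' (Y l' \<omega>))) = 0"
proof -
  \<comment> \<open>The factors are regrouped by index, because \<open>l\<close>, \<open>k'\<close> and \<open>l'\<close> may coincide.\<close>
  define h where "h m y = (if m = k then f y else 1) * (if m = l then g y else 1)
      * ((if m = k' then f' y else 1) * (if m = l' then g' y else 1))" for m y
  have L4h: "integrable M (\<lambda>\<omega>. h m (Y m \<omega>))" if "m < n" for m
    unfolding h_def using L4 idx that
    by (intro Lp_fun_mult_2 Lp_fun_mult_4) (auto intro!: Lp_fun_if Lp_fun_const)
  have "indep_vars (\<lambda>_. borel) (\<lambda>i \<omega>. h i (Y i \<omega>)) {..<n}"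
    using meas by (intro indep_vars_compose2[OF indep]) (auto simp: h_def)
  from indep_vars_lebesgue_integral[OF _ this] L4h
  have "expectation (\<lambda>\<omega>. \<Prod>m<n. h m (Y m \<omega>)) = (\<Prod>m<n. expectation (\<lambda>\<omega>. h m (Y m \<omega>)))" by simp
  also have "\<dots> = 0"
  proof (rule prod_zero)
    have "h k y = f y" for y using idx by (auto simp: h_def)
    then have "expectation (\<lambda>\<omega>. h k (Y k \<omega>)) = 0" using centred by simp
    then show "\<exists>a\<in>{..<n}. expectation (\<lambda>\<omega>. h a (Y a \<omega>)) = 0" using idx by blast
  qed simp
  also have "(\<lambda>\<omega>. \<Prod>m<n. h m (Y m \<omega>)) = (\<lambda>\<omega>. f (Y k \<omega>) * g (Y l \<omega>) * (f' (Y k' \<omega>) * g' (Y l' \<omega>)))"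
    using idx by (auto simp: h_def prod.distrib prod.delta)
  finally show ?thesis .
qed

text \<open>Only equal indices contribute to the second moment of a sum of centred independent terms.\<close>
lemma expectation_mult_sums:
  fixes Y :: "nat \<Rightarrow> 'a \<Rightarrow> 'b" and f g :: "'b \<Rightarrow> real"
  assumes indep: "indep_vars (\<lambda>_. R) Y {..<n}"
    and meas: "f \<in> borel_measurable R" "g \<in> borel_measurable R"
    and L2: "\<And>k. k < n \<Longrightarrow> Lp_fun M 2 (\<lambda>\<omega>. f (Y k \<omega>))" "\<And>k. k < n \<Longrightarrow> Lp_fun M 2 (\<lambda>\<omega>. g (Y k \<omega>))"
    and centred: "\<And>k. k < n \<Longrightarrow> expectation (\<lambda>\<omega>. f (Y k \<omega>)) = 0"
  shows "expectation (\<lambda>\<omega>. (\<Sum>k<n. f (Y k \<omega>)) * (\<Sum>k<n. g (Y k \<omega>)))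
       = (\<Sum>k<n. expectation (\<lambda>\<omega>. f (Y k \<omega>) * g (Y k \<omega>)))"
proof -
  have "expectation (\<lambda>\<omega>. (\<Sum>k<n. f (Y k \<omega>)) * (\<Sum>k<n. g (Y k \<omega>)))
      = (\<Sum>k<n. \<Sum>l<n. expectation (\<lambda>\<omega>. f (Y k \<omega>) * g (Y l \<omega>)))"
    unfolding sum_product using L2
    by (subst Bochner_Integration.integral_sum) (auto intro!: Lp_fun_mult_2 Bochner_Integration.integrable_sum sum.cong
        Bochner_Integration.integral_sum)
  also have "\<dots> = (\<Sum>k<n. \<Sum>l<n. if l = k then expectation (\<lambda>\<omega>. f (Y k \<omega>) * g (Y k \<omega>)) else 0)"
  proof (intro sum.cong refl)
    fix k l assume "k \<in> {..<n}" "l \<in> {..<n}"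
    then show "expectation (\<lambda>\<omega>. f (Y k \<omega>) * g (Y l \<omega>))
        = (if l = k then expectation (\<lambda>\<omega>. f (Y k \<omega>) * g (Y k \<omega>)) else 0)"
      using expectation_prod_pair[OF indep, of k l f g] meas L2 centred[of k] by (auto intro: Lp_fun_2_1)
  qed
  also have "\<dots> = (\<Sum>k<n. expectation (\<lambda>\<omega>. f (Y k \<omega>) * g (Y k \<omega>)))"
    by (simp add: sum.delta)
  finally show ?thesis .
qed

text \<open>A term indexed by \<open>(k, l)\<close> and a term indexed by \<open>(k', l')\<close> of a degenerate double sum are
  uncorrelated unless \<open>{k, l} = {k', l'}\<close>: otherwise some index occurs only once among the four,
  and its factor is independent of the others and centred.\<close>
lemma degenerate_double_sum_second_moment:
  fixes Y :: "nat \<Rightarrow> 'a \<Rightarrow> 'b" and \<phi> :: "'c \<Rightarrow> 'b \<Rightarrow> real"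
  assumes indep: "indep_vars (\<lambda>_. R) Y {..<n}" and I: "finite I"
    and meas: "\<And>a. a \<in> I \<Longrightarrow> \<phi> a \<in> borel_measurable R"
    and L4: "\<And>a k. a \<in> I \<Longrightarrow> k < n \<Longrightarrow> Lp_fun M 4 (\<lambda>\<omega>. \<phi> a (Y k \<omega>))"
    and centred: "\<And>a k. a \<in> I \<Longrightarrow> k < n \<Longrightarrow> expectation (\<lambda>\<omega>. \<phi> a (Y k \<omega>)) = 0"
    and cov: "\<And>a b k. a \<in> I \<Longrightarrow> b \<in> I \<Longrightarrow> k < n \<Longrightarrow> expectation (\<lambda>\<omega>. \<phi> a (Y k \<omega>) * \<phi> b (Y k \<omega>)) = C a b"
  shows "expectation (\<lambda>\<omega>. (\<Sum>k<n. \<Sum>l\<in>{..<n} - {k}. \<Sum>a\<in>I. \<phi> a (Y k \<omega>) * \<phi> a (Y l \<omega>))^2)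
       \<le> 2 * (real n)^2 * (\<Sum>a\<in>I. \<Sum>b\<in>I. (C a b)^2)"
proof -
  define P where "P = (SIGMA k:{..<n}. {..<n} - {k})"
  have finP: "finite P" by (simp add: P_def)
  have P: "fst q < n" "snd q < n" "fst q \<noteq> snd q" if "q \<in> P" for q using that by (auto simp: P_def)
  define F where "F q a \<omega> = \<phi> a (Y (fst q) \<omega>) * \<phi> a (Y (snd q) \<omega>)" for q a \<omega>
  have FL2: "Lp_fun M 2 (F q a)" if "q \<in> P" "a \<in> I" for q a
    unfolding F_def using that P by (intro Lp_fun_mult_4 L4) auto
  have term_le: "expectation (\<lambda>\<omega>. F q a \<omega> * F q' b \<omega>)
      \<le> (if q' = q \<or> q' = prod.swap q then (C a b)^2 else 0)"
    if q: "q \<in> P" "q' \<in> P" and ab: "a \<in> I" "b \<in> I" for q q' a b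
  proof -
    obtain k l where kl: "q = (k, l)" "k < n" "l < n" "k \<noteq> l" using q(1) by (auto simp: P_def)
    obtain k' l' where kl': "q' = (k', l')" "k' < n" "l' < n" "k' \<noteq> l'" using q(2) by (auto simp: P_def)
    consider "q' = q \<or> q' = prod.swap q" | "k \<noteq> k'" "k \<noteq> l'" | "l \<noteq> k'" "l \<noteq> l'"
      using kl kl' by auto
    then show ?thesis
    proof cases
      case 1
      have "F q' b \<omega> = \<phi> b (Y k \<omega>) * \<phi> b (Y l \<omega>)" for \<omega> using 1 kl by (auto simp: F_def)
      then have "expectation (\<lambda>\<omega>. F q a \<omega> * F q' b \<omega>)
          = expectation (\<lambda>\<omega>. (\<phi> a (Y k \<omega>) * \<phi> b (Y k \<omega>)) * (\<phi> a (Y l \<omega>) * \<phi> b (Y l \<omega>)))"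
        using kl by (simp add: F_def mult_ac)
      also have "\<dots> = C a b * C a b"
      proof -
        have "integrable M (\<lambda>\<omega>. \<phi> a (Y i \<omega>) * \<phi> b (Y i \<omega>))" if "i < n" for i
          using L4 ab that by (intro Lp_fun_mult_2 Lp_fun_4_2) auto
        then show ?thesis
          using expectation_prod_pair[OF indep kl(2-4), of "\<lambda>y. \<phi> a y * \<phi> b y" "\<lambda>y. \<phi> a y * \<phi> b y"]
            meas ab kl cov by auto
      qed
      finally show ?thesis using 1 by (simp add: power2_eq_square)
    next
      case 2
      have "expectation (\<lambda>\<omega>. \<phi> a (Y k \<omega>) * \<phi> a (Y l \<omega>) * (\<phi> b (Y k' \<omega>) * \<phi> b (Y l' \<omega>))) = 0"
        using kl kl' 2 meas ab L4 centred by (intro expectation_prod_isolated[OF indep]) auto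
      then show ?thesis using kl kl' by (simp add: F_def)
    next
      case 3
      have "expectation (\<lambda>\<omega>. \<phi> a (Y l \<omega>) * \<phi> a (Y k \<omega>) * (\<phi> b (Y k' \<omega>) * \<phi> b (Y l' \<omega>))) = 0"
        using kl kl' 3 meas ab L4 centred by (intro expectation_prod_isolated[OF indep]) auto
      then show ?thesis using kl kl' by (simp add: F_def mult.commute[of "\<phi> a (Y k _)"])
    qed
  qed
  have "(\<Sum>k<n. \<Sum>l\<in>{..<n} - {k}. \<Sum>a\<in>I. \<phi> a (Y k \<omega>) * \<phi> a (Y l \<omega>)) = (\<Sum>q\<in>P. \<Sum>a\<in>I. F q a \<omega>)" for \<omega>
    unfolding P_def F_def by (subst sum.Sigma) (auto simp: case_prod_beta)
  then have "expectation (\<lambda>\<omega>. (\<Sum>k<n. \<Sum>l\<in>{..<n} - {k}. \<Sum>a\<in>I. \<phi> a (Y k \<omega>) * \<phi> a (Y l \<omega>))^2)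
      = expectation (\<lambda>\<omega>. \<Sum>r\<in>P \<times> I. \<Sum>r'\<in>P \<times> I. F (fst r) (snd r) \<omega> * F (fst r') (snd r') \<omega>)"
    by (simp add: power2_eq_square sum.cartesian_product sum_product case_prod_beta)
  also have "\<dots> = (\<Sum>r\<in>P \<times> I. \<Sum>r'\<in>P \<times> I. expectation (\<lambda>\<omega>. F (fst r) (snd r) \<omega> * F (fst r') (snd r') \<omega>))"
    using FL2
    by (subst Bochner_Integration.integral_sum) (auto intro!: Lp_fun_mult_2 Bochner_Integration.integrable_sum sum.cong
        Bochner_Integration.integral_sum)
  also have "\<dots> \<le> (\<Sum>r\<in>P \<times> I. \<Sum>r'\<in>P \<times> I.
      if fst r' = fst r \<or> fst r' = prod.swap (fst r) then (C (snd r) (snd r'))^2 else 0)"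
    by (intro sum_mono term_le) auto
  also have "\<dots> = (\<Sum>q\<in>P. \<Sum>a\<in>I. \<Sum>q'\<in>P. \<Sum>b\<in>I. if q' = q \<or> q' = prod.swap q then (C a b)^2 else 0)"
    by (simp add: sum.cartesian_product' cong: if_cong)
  also have "\<dots> \<le> (\<Sum>q\<in>P. \<Sum>a\<in>I. 2 * (\<Sum>b\<in>I. (C a b)^2))"
  proof (intro sum_mono)
    fix q a assume "q \<in> P" "a \<in> I"
    have "(\<Sum>q'\<in>P. \<Sum>b\<in>I. if q' = q \<or> q' = prod.swap q then (C a b)^2 else 0)
        = (\<Sum>q'\<in>P. if q' \<in> {q, prod.swap q} then (\<Sum>b\<in>I. (C a b)^2) else 0)"
      by (intro sum.cong) auto
    also have "\<dots> = real (card (P \<inter> {q, prod.swap q})) * (\<Sum>b\<in>I. (C a b)^2)"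
      using finP by (subst sum.inter_restrict[symmetric]) auto
    also have "\<dots> \<le> 2 * (\<Sum>b\<in>I. (C a b)^2)"
    proof (intro mult_right_mono)
      have "card (P \<inter> {q, prod.swap q}) \<le> card {q, prod.swap q}" by (intro card_mono) auto
      also have "\<dots> \<le> 2" by (simp add: card_insert_if)
      finally show "real (card (P \<inter> {q, prod.swap q})) \<le> 2" by simp
    qed (simp add: sum_nonneg)
    finally show "(\<Sum>q'\<in>P. \<Sum>b\<in>I. if q' = q \<or> q' = prod.swap q then (C a b)^2 else 0)
        \<le> 2 * (\<Sum>b\<in>I. (C a b)^2)" .
  qed
  also have "\<dots> = real (card P) * (2 * (\<Sum>a\<in>I. \<Sum>b\<in>I. (C a b)^2))" by (simp add: sum_distrib_left)
  also have "\<dots> \<le> (real n)^2 * (2 * (\<Sum>a\<in>I. \<Sum>b\<in>I. (C a b)^2))"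
  proof (intro mult_right_mono)
    have "card P \<le> card ({..<n} \<times> {..<n})" by (intro card_mono) (auto simp: P_def)
    then have "real (card P) \<le> real (n * n)" by (simp only: card_cartesian_product card_lessThan of_nat_le_iff)
    then show "real (card P) \<le> (real n)^2" by (simp add: power2_eq_square)
  qed (simp add: sum_nonneg)
  finally show ?thesis by (simp add: mult_ac)
qed

end

section \<open>Moments of a sample of fixed size\<close>

locale iid_sample = prob_space M for M :: "'a measure" +
  fixes X :: "'a \<Rightarrow> real mat" and p n :: nat
  assumes iid: "iid_columns M X p n"
    and n_pos: "1 \<le> n" and p_pos: "1 \<le> p"
    and L8: "\<And>i. i < p \<Longrightarrow> Lp_fun M 8 (\<lambda>\<omega>. X \<omega> $$ (i, 0))"
begin

abbreviation "grid \<equiv> {..<p} \<times> {..<p}"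
abbreviation "R \<equiv> PiM {..<p} (\<lambda>_::nat. borel :: real measure)"

lemma indep_cols: "indep_vars (\<lambda>_. R) (col_rv X p) {..<n}"
  using iid unfolding iid_columns_def by blast

lemma col_measurable: "k < n \<Longrightarrow> col_rv X p k \<in> measurable M R"
  using indep_cols by (auto simp: indep_vars_def)

lemma distr_col: "k < n \<Longrightarrow> distr M R (col_rv X p k) = distr M R (col_rv X p 0)"
  using iid unfolding iid_columns_def by blast

lemma expectation_col:
  assumes "k < n" "g \<in> borel_measurable R"
  shows "expectation (\<lambda>\<omega>. g (col_rv X p k \<omega>) :: real) = expectation (\<lambda>\<omega>. g (col_rv X p 0 \<omega>))"
proof -
  have "0 < n" using n_pos by simp
  show ?thesis
    unfolding integral_distr[OF col_measurable[OF assms(1)] assms(2), symmetric]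
      integral_distr[OF col_measurable[OF \<open>0 < n\<close>] assms(2), symmetric] distr_col[OF assms(1)] ..
qed

lemma Lp_fun_col:
  assumes "k < n" "g \<in> borel_measurable R" "Lp_fun M q (\<lambda>\<omega>. g (col_rv X p 0 \<omega>))"
  shows "Lp_fun M q (\<lambda>\<omega>. g (col_rv X p k \<omega>))"
proof -
  have m: "(\<lambda>v. \<bar>g v\<bar> ^ q) \<in> borel_measurable R" using assms(2) by measurable
  have "integrable M (\<lambda>\<omega>. \<bar>g (col_rv X p k \<omega>)\<bar> ^ q) \<longleftrightarrow> integrable M (\<lambda>\<omega>. \<bar>g (col_rv X p 0 \<omega>)\<bar> ^ q)"
  proof -
    have "0 < n" using n_pos by simp
    show ?thesis
      unfolding integrable_distr_eq[OF col_measurable[OF assms(1)] m, symmetric]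
        integrable_distr_eq[OF col_measurable[OF \<open>0 < n\<close>] m, symmetric] distr_col[OF assms(1)] ..
  qed
  then show ?thesis
    using assms(3) measurable_compose[OF col_measurable[OF assms(1)] assms(2)] by (simp add: Lp_fun_def)
qed

definition mean_coord :: "nat \<Rightarrow> real" where
  "mean_coord i = expectation (\<lambda>\<omega>. X \<omega> $$ (i, 0))"

definition obs :: "nat \<Rightarrow> 'a \<Rightarrow> nat \<Rightarrow> real" where
  "obs k \<omega> i = X \<omega> $$ (i, k) - mean_coord i"

definition sigma :: "nat \<times> nat \<Rightarrow> real" where
  "sigma a = expectation (\<lambda>\<omega>. outer (obs 0 \<omega>) a)"

definition dev :: "nat \<Rightarrow> 'a \<Rightarrow> nat \<times> nat \<Rightarrow> real" where
  "dev k \<omega> a = outer (obs k \<omega>) a - sigma a"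

definition dev_cov :: "nat \<times> nat \<Rightarrow> nat \<times> nat \<Rightarrow> real" where
  "dev_cov a b = expectation (\<lambda>\<omega>. dev 0 \<omega> a * dev 0 \<omega> b)"

text \<open>The squared Frobenius norm of the covariance of the outer product, or, equivalently, the mean square of
  the inner product of the deviations of two independent observations.\<close>
definition dev_power :: real where
  "dev_power = (\<Sum>a\<in>grid. \<Sum>b\<in>grid. (dev_cov a b)^2) / (real p)^2"

definition mean_dev :: "'a \<Rightarrow> nat \<times> nat \<Rightarrow> real" where
  "mean_dev \<omega> a = (\<Sum>k<n. dev k \<omega> a) / real n"

definition mean_sq :: "nat \<Rightarrow> 'a \<Rightarrow> real" where
  "mean_sq k \<omega> = (\<Sum>i<p. (obs k \<omega> i)^2) / real p"

definition mean_obs :: "'a \<Rightarrow> nat \<Rightarrow> real" where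
  "mean_obs \<omega> i = (\<Sum>k<n. obs k \<omega> i) / real n"

lemma mean_mat_entry:
  assumes "i < p" "k < n" shows "mean_mat M p n X $$ (i, k) = mean_coord i"
proof -
  have "expectation (\<lambda>\<omega>. col_rv X p k \<omega> i) = expectation (\<lambda>\<omega>. col_rv X p 0 \<omega> i)"
    using assms by (intro expectation_col measurable_component_singleton) auto
  then show ?thesis using assms by (simp add: mean_mat_def mean_coord_def col_rv_def)
qed

lemma cov_mat_entry:
  assumes "i < p" "j < p" shows "cov_mat M p X $$ (i, j) = sigma (i, j)"
  using assms by (simp add: cov_mat_def covar_def sigma_def outer_def obs_def mean_coord_def)

text \<open>The quantities attached to an observation are also needed as functions of the column, since
  independence and equality in distribution are statements about columns.\<close>
definition coord :: "nat \<Rightarrow> (nat \<Rightarrow> real) \<Rightarrow> real" where "coord i v = v i - mean_coord i"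

lemma coord_measurable: "i < p \<Longrightarrow> coord i \<in> borel_measurable R"
  unfolding coord_def by (intro borel_measurable_diff measurable_component_singleton) auto

lemma obs_coord: "i < p \<Longrightarrow> obs k \<omega> i = coord i (col_rv X p k \<omega>)"
  by (simp add: obs_def coord_def col_rv_def)

lemma obs_L8: assumes "i < p" "k < n" shows "Lp_fun M 8 (\<lambda>\<omega>. obs k \<omega> i)"
proof -
  have "Lp_fun M 8 (\<lambda>\<omega>. X \<omega> $$ (i, 0) - mean_coord i)"
    using assms by (intro Lp_fun_diff L8 Lp_fun_const)
  then have "Lp_fun M 8 (\<lambda>\<omega>. coord i (col_rv X p 0 \<omega>))"
    using assms by (simp add: coord_def col_rv_def)
  from Lp_fun_col[OF assms(2) coord_measurable[OF assms(1)] this] show ?thesis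
    using assms by (simp add: obs_coord)
qed

lemma obs_centred: assumes "i < p" "k < n" shows "expectation (\<lambda>\<omega>. obs k \<omega> i) = 0"
proof -
  have "integrable M (\<lambda>\<omega>. X \<omega> $$ (i, 0))"
    using L8[OF assms(1)] by (intro Lp_fun_2_1 Lp_fun_4_2 Lp_fun_8_4)
  then have "expectation (\<lambda>\<omega>. obs 0 \<omega> i) = 0"
    by (simp add: obs_def mean_coord_def prob_space)
  then show ?thesis
    using expectation_col[OF assms(2) coord_measurable[OF assms(1)]] assms by (simp add: obs_coord)
qed

lemma outer_obs_L4: assumes "a \<in> grid" "k < n" shows "Lp_fun M 4 (\<lambda>\<omega>. outer (obs k \<omega>) a)"
  unfolding outer_def using assms by (intro Lp_fun_mult_8 obs_L8) auto

definition dev_coord :: "nat \<times> nat \<Rightarrow> (nat \<Rightarrow> real) \<Rightarrow> real" where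
  "dev_coord a v = coord (fst a) v * coord (snd a) v - sigma a"

lemma dev_coord_measurable: "a \<in> grid \<Longrightarrow> dev_coord a \<in> borel_measurable R"
  unfolding dev_coord_def
  by (intro borel_measurable_diff borel_measurable_times coord_measurable) auto

lemma dev_eq: "a \<in> grid \<Longrightarrow> dev k \<omega> a = dev_coord a (col_rv X p k \<omega>)"
  by (auto simp: dev_def dev_coord_def outer_def obs_coord)

lemma dev_L4: assumes "a \<in> grid" "k < n" shows "Lp_fun M 4 (\<lambda>\<omega>. dev k \<omega> a)"
  unfolding dev_def using assms by (intro Lp_fun_diff outer_obs_L4 Lp_fun_const)

lemma dev_centred: assumes "a \<in> grid" "k < n" shows "expectation (\<lambda>\<omega>. dev k \<omega> a) = 0"
proof -
  have "integrable M (\<lambda>\<omega>. outer (obs 0 \<omega>) a)"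
    using assms n_pos by (intro Lp_fun_2_1 Lp_fun_4_2 outer_obs_L4) auto
  then have "expectation (\<lambda>\<omega>. dev 0 \<omega> a) = 0" by (simp add: dev_def sigma_def prob_space)
  then show ?thesis
    using expectation_col[OF assms(2) dev_coord_measurable[OF assms(1)]] assms by (simp add: dev_eq)
qed

lemma dev_cov_col:
  assumes "a \<in> grid" "b \<in> grid" "k < n"
  shows "expectation (\<lambda>\<omega>. dev k \<omega> a * dev k \<omega> b) = dev_cov a b"
proof -
  have "(\<lambda>v. dev_coord a v * dev_coord b v) \<in> borel_measurable R"
    using assms by (intro borel_measurable_times dev_coord_measurable)
  from expectation_col[OF assms(3) this] show ?thesis
    using assms by (simp add: dev_eq dev_cov_def)
qed

lemma mean_sq_L4: assumes "k < n" shows "Lp_fun M 4 (mean_sq k)"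
proof -
  have "mean_sq k = (\<lambda>\<omega>. (1 / real p) * (\<Sum>i<p. obs k \<omega> i * obs k \<omega> i))"
    by (auto simp: mean_sq_def power2_eq_square)
  then show ?thesis using assms
    by (simp only:) (intro Lp_fun_cmult Lp_fun_sum Lp_fun_mult_8 obs_L8, auto)
qed

lemma mean_sq_sq_L2: "k < n \<Longrightarrow> Lp_fun M 2 (\<lambda>\<omega>. (mean_sq k \<omega>)^2)"
  unfolding power2_eq_square by (intro Lp_fun_mult_4 mean_sq_L4)

lemma entry_prod_outer_obs: "entry_prod p (outer (obs k \<omega>)) (outer (obs k \<omega>)) = real p * (mean_sq k \<omega>)^2"
  using p_pos by (simp add: entry_prod_outer mean_sq_def power2_eq_square)

lemma obs_power_mean_sq: "obs_power p n (\<lambda>k. obs k \<omega>) = real p / (real n)^2 * (\<Sum>k<n. (mean_sq k \<omega>)^2)"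
  by (simp add: obs_power_def entry_prod_outer_obs sum_distrib_left sum_divide_distrib)

definition mean_sq_coord :: "(nat \<Rightarrow> real) \<Rightarrow> real" where
  "mean_sq_coord v = (\<Sum>i<p. (coord i v)^2) / real p"

lemma mean_sq_coord_measurable: "mean_sq_coord \<in> borel_measurable R"
  unfolding mean_sq_coord_def
  by (intro borel_measurable_divide borel_measurable_sum borel_measurable_power coord_measurable) auto

lemma mean_sq_eq: "mean_sq k \<omega> = mean_sq_coord (col_rv X p k \<omega>)"
  by (simp add: mean_sq_def mean_sq_coord_def obs_coord)

lemma expectation_mean_sq_power:
  assumes "k < n" shows "expectation (\<lambda>\<omega>. (mean_sq k \<omega>) ^ q) = expectation (\<lambda>\<omega>. (mean_sq 0 \<omega>) ^ q)"
  unfolding mean_sq_eq using mean_sq_coord_measurable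
  by (intro expectation_col[OF assms, of "\<lambda>v. (mean_sq_coord v) ^ q"]) measurable

text \<open>The bound of a quadratic form by Frobenius norms.  With the Frobenius norm in place of the
  operator norm of the covariance, \<open>N\<close> orthonormal directions cost a factor \<open>\<surd>N\<close> only.\<close>
lemma expectation_sum_inner_sq_le:
  fixes V :: "'a \<Rightarrow> nat \<times> nat \<Rightarrow> real" and A :: "nat \<Rightarrow> nat \<times> nat \<Rightarrow> real"
  assumes V: "\<And>a. a \<in> grid \<Longrightarrow> Lp_fun M 2 (\<lambda>\<omega>. V \<omega> a)"
    and D: "\<And>a b. a \<in> grid \<Longrightarrow> b \<in> grid \<Longrightarrow> expectation (\<lambda>\<omega>. V \<omega> a * V \<omega> b) = D a b"
  shows "expectation (\<lambda>\<omega>. \<Sum>j<m. (entry_prod p (V \<omega>) (A j))^2)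
    \<le> sqrt (\<Sum>a\<in>grid. \<Sum>b\<in>grid. (D a b)^2) / real p
      * sqrt (\<Sum>j<m. \<Sum>l<m. (entry_prod p (A j) (A l))^2)"
proof -
  define P where "P a b = (\<Sum>j<m. A j a * A j b)" for a b
  have "(\<Sum>j<m. (entry_prod p (V \<omega>) (A j))^2)
      = (\<Sum>j<m. \<Sum>a\<in>grid. \<Sum>b\<in>grid. (A j a * A j b) * (V \<omega> a * V \<omega> b)) / (real p)^2" for \<omega>
    unfolding entry_prod_def power_divide power2_eq_square sum_product sum_divide_distrib
    by (intro sum.cong) (auto simp: mult_ac)
  then have "expectation (\<lambda>\<omega>. \<Sum>j<m. (entry_prod p (V \<omega>) (A j))^2)
      = expectation (\<lambda>\<omega>. \<Sum>j<m. \<Sum>a\<in>grid. \<Sum>b\<in>grid. (A j a * A j b) * (V \<omega> a * V \<omega> b)) / (real p)^2"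
    by simp
  also have "expectation (\<lambda>\<omega>. \<Sum>j<m. \<Sum>a\<in>grid. \<Sum>b\<in>grid. (A j a * A j b) * (V \<omega> a * V \<omega> b))
      = (\<Sum>j<m. \<Sum>a\<in>grid. \<Sum>b\<in>grid. (A j a * A j b) * D a b)"
  proof -
    have int: "integrable M (\<lambda>\<omega>. V \<omega> a * V \<omega> b)" if "a \<in> grid" "b \<in> grid" for a b
      using V that by (intro Lp_fun_mult_2)
    show ?thesis
      using int D by (simp add: Bochner_Integration.integral_sum Bochner_Integration.integrable_sum)
  qed
  also have "\<dots> = (\<Sum>j<m. \<Sum>r\<in>grid \<times> grid. (A j (fst r) * A j (snd r)) * D (fst r) (snd r))"
    by (simp add: sum.cartesian_product case_prod_beta)
  also have "\<dots> = (\<Sum>r\<in>grid \<times> grid. D (fst r) (snd r) * P (fst r) (snd r))"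
    by (subst sum.swap) (simp add: P_def sum_distrib_left mult_ac)
  also have "\<dots> \<le> sqrt (\<Sum>r\<in>grid \<times> grid. (D (fst r) (snd r))^2) * sqrt (\<Sum>r\<in>grid \<times> grid. (P (fst r) (snd r))^2)"
    unfolding real_sqrt_mult[symmetric] using Cauchy_Schwarz_ineq_sum by (intro real_le_rsqrt)
  also have "(\<Sum>r\<in>grid \<times> grid. (P (fst r) (snd r))^2)
      = (real p)^2 * (\<Sum>j<m. \<Sum>l<m. (entry_prod p (A j) (A l))^2)"
  proof -
    have "(\<Sum>r\<in>grid \<times> grid. (P (fst r) (snd r))^2)
        = (\<Sum>a\<in>grid. \<Sum>b\<in>grid. \<Sum>j<m. \<Sum>l<m. (A j a * A j b) * (A l a * A l b))"
      unfolding P_def power2_eq_square sum_product by (simp only: sum.cartesian_product' fst_conv snd_conv)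
    also have "\<dots> = (\<Sum>j<m. \<Sum>l<m. \<Sum>a\<in>grid. \<Sum>b\<in>grid. (A j a * A j b) * (A l a * A l b))"
    proof -
      have "(\<Sum>a\<in>grid. \<Sum>b\<in>grid. \<Sum>j<m. \<Sum>l<m. (A j a * A j b) * (A l a * A l b))
          = (\<Sum>r\<in>grid \<times> grid. \<Sum>q\<in>{..<m} \<times> {..<m}. (A (fst q) (fst r) * A (fst q) (snd r)) * (A (snd q) (fst r) * A (snd q) (snd r)))"
        by (simp add: sum.cartesian_product')
      also have "\<dots> = (\<Sum>q\<in>{..<m} \<times> {..<m}. \<Sum>r\<in>grid \<times> grid. (A (fst q) (fst r) * A (fst q) (snd r)) * (A (snd q) (fst r) * A (snd q) (snd r)))"
        by (rule sum.swap)
      finally show ?thesis by (simp add: sum.cartesian_product')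
    qed
    also have "\<dots> = (\<Sum>j<m. \<Sum>l<m. (\<Sum>a\<in>grid. A j a * A l a)^2)"
      unfolding power2_eq_square sum_product by (simp add: mult_ac)
    also have "\<dots> = (real p)^2 * (\<Sum>j<m. \<Sum>l<m. (entry_prod p (A j) (A l))^2)"
      using p_pos by (simp add: entry_prod_def power_divide sum_distrib_left)
    finally show ?thesis .
  qed
  also have "(\<Sum>r\<in>grid \<times> grid. (D (fst r) (snd r))^2) = (\<Sum>a\<in>grid. \<Sum>b\<in>grid. (D a b)^2)"
    by (simp add: sum.cartesian_product case_prod_beta)
  finally have "expectation (\<lambda>\<omega>. \<Sum>j<m. (entry_prod p (V \<omega>) (A j))^2)
    \<le> (sqrt (\<Sum>a\<in>grid. \<Sum>b\<in>grid. (D a b)^2) * (real p * sqrt (\<Sum>j<m. \<Sum>l<m. (entry_prod p (A j) (A l))^2))) / (real p)^2"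
    by (simp add: real_sqrt_mult divide_right_mono)
  then show ?thesis using p_pos by (simp add: power2_eq_square)
qed

lemma mean_dev_L4: assumes "a \<in> grid" shows "Lp_fun M 4 (\<lambda>\<omega>. mean_dev \<omega> a)"
proof -
  have "(\<lambda>\<omega>. mean_dev \<omega> a) = (\<lambda>\<omega>. (1 / real n) * (\<Sum>k<n. dev k \<omega> a))" by (simp add: mean_dev_def)
  then show ?thesis using assms by (simp only:) (intro Lp_fun_cmult Lp_fun_sum dev_L4, auto)
qed

lemma mean_dev_cov:
  assumes "a \<in> grid" "b \<in> grid"
  shows "expectation (\<lambda>\<omega>. mean_dev \<omega> a * mean_dev \<omega> b) = dev_cov a b / real n"
proof -
  have "expectation (\<lambda>\<omega>. (\<Sum>k<n. dev_coord a (col_rv X p k \<omega>)) * (\<Sum>k<n. dev_coord b (col_rv X p k \<omega>)))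
      = (\<Sum>k<n. expectation (\<lambda>\<omega>. dev_coord a (col_rv X p k \<omega>) * dev_coord b (col_rv X p k \<omega>)))"
    using assms dev_L4 dev_centred
    by (intro expectation_mult_sums[OF indep_cols] dev_coord_measurable)
       (auto simp: dev_eq[symmetric] intro: Lp_fun_4_2)
  also have "\<dots> = real n * dev_cov a b"
    using assms by (simp add: dev_eq[symmetric] dev_cov_col)
  finally show ?thesis
    using assms n_pos by (simp add: mean_dev_def dev_eq[symmetric])
qed

lemma expectation_mean_dev_inner_sq_le:
  fixes A :: "nat \<Rightarrow> nat \<times> nat \<Rightarrow> real"
  shows "expectation (\<lambda>\<omega>. \<Sum>j<m. (entry_prod p (mean_dev \<omega>) (A j))^2)
   \<le> sqrt dev_power / real n * sqrt (\<Sum>j<m. \<Sum>l<m. (entry_prod p (A j) (A l))^2)"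
proof -
  have "expectation (\<lambda>\<omega>. \<Sum>j<m. (entry_prod p (mean_dev \<omega>) (A j))^2)
    \<le> sqrt (\<Sum>a\<in>grid. \<Sum>b\<in>grid. (dev_cov a b / real n)^2) / real p
      * sqrt (\<Sum>j<m. \<Sum>l<m. (entry_prod p (A j) (A l))^2)"
    by (rule expectation_sum_inner_sq_le[where V = mean_dev and D = "\<lambda>a b. dev_cov a b / real n"])
       (intro mean_dev_cov Lp_fun_4_2 mean_dev_L4; assumption)+
  also have "sqrt (\<Sum>a\<in>grid. \<Sum>b\<in>grid. (dev_cov a b / real n)^2) / real p = sqrt dev_power / real n"
    by (simp add: dev_power_def power_divide real_sqrt_divide flip: sum_divide_distrib)
  finally show ?thesis .
qed

lemma expectation_dev_inner_sq_le:
  fixes A :: "nat \<Rightarrow> nat \<times> nat \<Rightarrow> real"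
  assumes "k < n"
  shows "expectation (\<lambda>\<omega>. \<Sum>j<m. (entry_prod p (dev k \<omega>) (A j))^2)
   \<le> sqrt dev_power * sqrt (\<Sum>j<m. \<Sum>l<m. (entry_prod p (A j) (A l))^2)"
proof -
  have "expectation (\<lambda>\<omega>. \<Sum>j<m. (entry_prod p (dev k \<omega>) (A j))^2)
    \<le> sqrt (\<Sum>a\<in>grid. \<Sum>b\<in>grid. (dev_cov a b)^2) / real p
      * sqrt (\<Sum>j<m. \<Sum>l<m. (entry_prod p (A j) (A l))^2)"
    by (rule expectation_sum_inner_sq_le[where V = "dev k" and D = dev_cov])
       (intro dev_cov_col Lp_fun_4_2 dev_L4 assms; assumption)+
  also have "sqrt (\<Sum>a\<in>grid. \<Sum>b\<in>grid. (dev_cov a b)^2) / real p = sqrt dev_power"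
    by (simp add: dev_power_def real_sqrt_divide)
  finally show ?thesis .
qed

definition cross_dev :: "'a \<Rightarrow> real" where
  "cross_dev \<omega> = (\<Sum>k<n. \<Sum>l\<in>{..<n} - {k}. entry_prod p (dev k \<omega>) (dev l \<omega>))"

definition cross_obs :: "'a \<Rightarrow> real" where
  "cross_obs \<omega> = (\<Sum>k<n. \<Sum>l\<in>{..<n} - {k}. \<Sum>i<p. obs k \<omega> i * obs l \<omega> i)"

lemma expectation_cross_dev_sq_le: "expectation (\<lambda>\<omega>. (cross_dev \<omega>)^2) \<le> 2 * (real n)^2 * dev_power"
proof -
  have "cross_dev \<omega> = (\<Sum>k<n. \<Sum>l\<in>{..<n} - {k}. \<Sum>a\<in>grid.
      dev_coord a (col_rv X p k \<omega>) * dev_coord a (col_rv X p l \<omega>)) / real p" for \<omega>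
    unfolding cross_dev_def entry_prod_def sum_divide_distrib[symmetric]
    by (intro arg_cong2[where f = "(/)"] sum.cong refl) (auto simp: dev_eq)
  then have "expectation (\<lambda>\<omega>. (cross_dev \<omega>)^2) = expectation (\<lambda>\<omega>. (\<Sum>k<n. \<Sum>l\<in>{..<n} - {k}. \<Sum>a\<in>grid.
      dev_coord a (col_rv X p k \<omega>) * dev_coord a (col_rv X p l \<omega>))^2) / (real p)^2"
    by (simp add: power_divide)
  also have "\<dots> \<le> (2 * (real n)^2 * (\<Sum>a\<in>grid. \<Sum>b\<in>grid. (dev_cov a b)^2)) / (real p)^2"
    using dev_L4 dev_centred dev_cov_col
    by (intro divide_right_mono degenerate_double_sum_second_moment[OF indep_cols] dev_coord_measurable)
       (auto simp: dev_eq[symmetric])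
  finally show ?thesis by (simp add: dev_power_def)
qed

lemma expectation_cross_obs_sq_le:
  "expectation (\<lambda>\<omega>. (cross_obs \<omega>)^2) \<le> 2 * (real n)^2 * (real p * entry_prod p sigma sigma)"
proof -
  have cov: "expectation (\<lambda>\<omega>. coord i (col_rv X p k \<omega>) * coord j (col_rv X p k \<omega>)) = sigma (i, j)"
    if "i < p" "j < p" "k < n" for i j k
  proof -
    have "(\<lambda>v. coord i v * coord j v) \<in> borel_measurable R"
      using that by (intro borel_measurable_times coord_measurable)
    from expectation_col[OF that(3) this] show ?thesis
      using that by (simp add: sigma_def outer_def obs_coord)
  qed
  have "cross_obs \<omega> = (\<Sum>k<n. \<Sum>l\<in>{..<n} - {k}. \<Sum>i<p.
      coord i (col_rv X p k \<omega>) * coord i (col_rv X p l \<omega>))" for \<omega>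
    unfolding cross_obs_def by (intro sum.cong refl) (simp add: obs_coord)
  then have "expectation (\<lambda>\<omega>. (cross_obs \<omega>)^2) = expectation (\<lambda>\<omega>. (\<Sum>k<n. \<Sum>l\<in>{..<n} - {k}. \<Sum>i<p.
      coord i (col_rv X p k \<omega>) * coord i (col_rv X p l \<omega>))^2)" by simp
  also have "\<dots> \<le> 2 * (real n)^2 * (\<Sum>i<p. \<Sum>j<p. (sigma (i, j))^2)"
    using obs_L8 obs_centred cov
    by (intro degenerate_double_sum_second_moment[OF indep_cols] coord_measurable)
       (auto simp: obs_coord[symmetric] intro: Lp_fun_8_4)
  also have "(\<Sum>i<p. \<Sum>j<p. (sigma (i, j))^2) = real p * entry_prod p sigma sigma"
    using p_pos by (simp add: entry_prod_def sum.cartesian_product power2_eq_square)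
  finally show ?thesis .
qed

text \<open>The variance of a sum of independent terms is the sum of the variances, and a variance is at most the
  second moment.\<close>
lemma expectation_mean_sq_fluctuation_le:
  "expectation (\<lambda>\<omega>. ((\<Sum>k<n. (mean_sq k \<omega>)^2) - real n * expectation (\<lambda>\<omega>. (mean_sq 0 \<omega>)^2))^2)
   \<le> real n * expectation (\<lambda>\<omega>. (mean_sq 0 \<omega>) ^ 4)"
proof -
  define m where "m = expectation (\<lambda>\<omega>. (mean_sq 0 \<omega>)^2)"
  define g where "g v = (mean_sq_coord v)^2 - m" for v
  have g: "g \<in> borel_measurable R" unfolding g_def using mean_sq_coord_measurable by measurable
  have geq: "g (col_rv X p k \<omega>) = (mean_sq k \<omega>)^2 - m" for k \<omega> by (simp add: g_def mean_sq_eq)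
  have gL2: "Lp_fun M 2 (\<lambda>\<omega>. g (col_rv X p k \<omega>))" if "k < n" for k
    unfolding geq using that by (intro Lp_fun_diff mean_sq_sq_L2 Lp_fun_const)
  have int: "integrable M (\<lambda>\<omega>. (mean_sq k \<omega>)^2)" if "k < n" for k
    using mean_sq_sq_L2[OF that] by (rule Lp_fun_2_1)
  have int4: "integrable M (\<lambda>\<omega>. (mean_sq k \<omega>)^4)" if "k < n" for k
    using Lp_fun_mult_2[OF mean_sq_sq_L2 mean_sq_sq_L2, OF that that] by (simp flip: power_add)
  have g0: "expectation (\<lambda>\<omega>. g (col_rv X p k \<omega>)) = 0" if "k < n" for k
    unfolding geq using int[OF that] expectation_mean_sq_power[OF that] by (simp add: m_def prob_space)
  have "(\<Sum>k<n. (mean_sq k \<omega>)^2) - real n * m = (\<Sum>k<n. g (col_rv X p k \<omega>))" for \<omega>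
    by (simp add: geq sum_subtractf)
  then have "expectation (\<lambda>\<omega>. ((\<Sum>k<n. (mean_sq k \<omega>)^2) - real n * m)^2)
      = expectation (\<lambda>\<omega>. (\<Sum>k<n. g (col_rv X p k \<omega>)) * (\<Sum>k<n. g (col_rv X p k \<omega>)))"
    by (simp add: power2_eq_square)
  also have "\<dots> = (\<Sum>k<n. expectation (\<lambda>\<omega>. g (col_rv X p k \<omega>) * g (col_rv X p k \<omega>)))"
    using gL2 g0 by (intro expectation_mult_sums[OF indep_cols g g])
  also have "\<dots> \<le> (\<Sum>k<n. expectation (\<lambda>\<omega>. (mean_sq 0 \<omega>) ^ 4))"
  proof (rule sum_mono)
    fix k assume "k \<in> {..<n}"
    then have k: "k < n" by simp
    have "expectation (\<lambda>\<omega>. g (col_rv X p k \<omega>) * g (col_rv X p k \<omega>))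
        = expectation (\<lambda>\<omega>. (mean_sq k \<omega>)^4 - 2 * m * (mean_sq k \<omega>)^2 + m^2)"
      by (simp add: geq power2_eq_square algebra_simps power4_eq_xxxx)
    also have "\<dots> = expectation (\<lambda>\<omega>. (mean_sq k \<omega>)^4) - 2 * m * m + m^2"
      using int[OF k] int4[OF k] expectation_mean_sq_power[OF k] by (simp add: prob_space m_def)
    also have "\<dots> \<le> expectation (\<lambda>\<omega>. (mean_sq k \<omega>)^4)" by (simp add: power2_eq_square)
    finally show "expectation (\<lambda>\<omega>. g (col_rv X p k \<omega>) * g (col_rv X p k \<omega>)) \<le> expectation (\<lambda>\<omega>. (mean_sq 0 \<omega>) ^ 4)"
      using expectation_mean_sq_power[OF k] by simp
  qed
  finally show ?thesis by (simp add: m_def)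
qed

lemma sum_outer_obs:
  "(\<Sum>k<n. outer (obs k \<omega>) a) = real n * (sigma a + mean_dev \<omega> a)"
  using n_pos by (simp add: mean_dev_def dev_def sum_subtractf field_simps)

text \<open>Expansion of the squared norm into its diagonal part, which concentrates because it is an
  average, and its off-diagonal part, which is a degenerate double sum.\<close>
lemma mean_dev_norm_sq:
  "entry_prod p (mean_dev \<omega>) (mean_dev \<omega>)
   = obs_power p n (\<lambda>k. obs k \<omega>)
     - (2 * entry_prod p (mean_dev \<omega>) sigma + entry_prod p sigma sigma) / real n
     + cross_dev \<omega> / (real n)^2"
proof -
  have "entry_prod p (mean_dev \<omega>) (mean_dev \<omega>)
      = entry_prod p (\<lambda>a. (1 / real n) * (\<Sum>k<n. dev k \<omega> a)) (\<lambda>a. (1 / real n) * (\<Sum>k<n. dev k \<omega> a))"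
    by (simp add: mean_dev_def[abs_def])
  also have "\<dots> = (\<Sum>k<n. \<Sum>l<n. entry_prod p (dev k \<omega>) (dev l \<omega>)) / (real n)^2"
    unfolding entry_prod_scale_left entry_prod_scale_right entry_prod_sum_left entry_prod_sum_right
    by (simp add: power2_eq_square)
  also have "(\<Sum>k<n. \<Sum>l<n. entry_prod p (dev k \<omega>) (dev l \<omega>))
      = (\<Sum>k<n. entry_prod p (dev k \<omega>) (dev k \<omega>)) + cross_dev \<omega>"
    unfolding cross_dev_def sum.distrib[symmetric]
    by (intro sum.cong refl) (simp add: sum.remove[symmetric] sum.remove)
  also have "(\<Sum>k<n. entry_prod p (dev k \<omega>) (dev k \<omega>))
      = (real n)^2 * obs_power p n (\<lambda>k. obs k \<omega>)
        - real n * (2 * entry_prod p (mean_dev \<omega>) sigma + entry_prod p sigma sigma)"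
  proof -
    have "(\<Sum>k<n. entry_prod p (outer (obs k \<omega>)) sigma) = entry_prod p (\<lambda>a. \<Sum>k<n. outer (obs k \<omega>) a) sigma"
      by (simp add: entry_prod_sum_left)
    also have "\<dots> = real n * (entry_prod p sigma sigma + entry_prod p (mean_dev \<omega>) sigma)"
      unfolding sum_outer_obs entry_prod_scale_left entry_prod_add_left ..
    finally have 1: "(\<Sum>k<n. entry_prod p (outer (obs k \<omega>)) sigma)
        = real n * (entry_prod p sigma sigma + entry_prod p (mean_dev \<omega>) sigma)" .
    have "entry_prod p (dev k \<omega>) (dev k \<omega>) = entry_prod p (outer (obs k \<omega>)) (outer (obs k \<omega>))
        - 2 * entry_prod p (outer (obs k \<omega>)) sigma + entry_prod p sigma sigma" for k
      by (simp add: dev_def[abs_def] entry_prod_diff_left[of p "outer (obs k \<omega>)" sigma]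
          entry_prod_diff_right[of p _ "outer (obs k \<omega>)" sigma] entry_prod_commute[of p sigma "outer _"])
    then have "(\<Sum>k<n. entry_prod p (dev k \<omega>) (dev k \<omega>))
        = (\<Sum>k<n. entry_prod p (outer (obs k \<omega>)) (outer (obs k \<omega>)))
          - 2 * (\<Sum>k<n. entry_prod p (outer (obs k \<omega>)) sigma) + real n * entry_prod p sigma sigma"
      by (simp add: sum.distrib sum_subtractf sum_distrib_left)
    then show ?thesis unfolding 1 using n_pos by (simp add: obs_power_def algebra_simps)
  qed
  finally show ?thesis using n_pos by (simp add: add_divide_distrib diff_divide_distrib power2_eq_square)
qed

lemma mean_obs_norm_sq:
  "(\<Sum>i<p. (mean_obs \<omega> i)^2) = (real p * (\<Sum>k<n. mean_sq k \<omega>) + cross_obs \<omega>) / (real n)^2"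
proof -
  have "(\<Sum>i<p. (mean_obs \<omega> i)^2) = (\<Sum>i<p. \<Sum>k<n. \<Sum>l<n. obs k \<omega> i * obs l \<omega> i) / (real n)^2"
    by (simp add: mean_obs_def power_divide power2_eq_square sum_product flip: sum_divide_distrib)
  also have "(\<Sum>i<p. \<Sum>k<n. \<Sum>l<n. obs k \<omega> i * obs l \<omega> i) = (\<Sum>k<n. \<Sum>l<n. \<Sum>i<p. obs k \<omega> i * obs l \<omega> i)"
    by (subst sum.swap) (intro sum.cong refl sum.swap)
  also have "\<dots> = (\<Sum>k<n. \<Sum>i<p. obs k \<omega> i * obs k \<omega> i) + cross_obs \<omega>"
    unfolding cross_obs_def sum.distrib[symmetric]
    by (intro sum.cong refl) (simp add: sum.remove[symmetric] sum.remove)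
  also have "(\<Sum>k<n. \<Sum>i<p. obs k \<omega> i * obs k \<omega> i) = real p * (\<Sum>k<n. mean_sq k \<omega>)"
  proof -
    have "(\<Sum>i<p. obs k \<omega> i * obs k \<omega> i) = real p * mean_sq k \<omega>" for k
      using p_pos by (simp add: mean_sq_def power2_eq_square)
    then show ?thesis by (simp add: sum_distrib_left)
  qed
  finally show ?thesis .
qed

lemma cross_obs_L4: "Lp_fun M 4 cross_obs"
  unfolding cross_obs_def[abs_def] by (intro Lp_fun_sum Lp_fun_mult_8 obs_L8) auto

text \<open>The crude estimate of \<open>\<bar>m\<bar>\<^sup>2\<close> by the average of the \<open>\<bar>z\<^sub>k\<bar>\<^sup>2\<close> would lose a factor \<open>n\<close>.  Here the diagonal
  of the double sum \<open>\<bar>m\<bar>\<^sup>2\<close> has only \<open>n\<close> terms, and the rest is degenerate.\<close>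
lemma expectation_mean_obs_power_le:
  "expectation (\<lambda>\<omega>. (\<Sum>i<p. (mean_obs \<omega> i)^2)^2)
   \<le> (2 * (real p)^2 * expectation (\<lambda>\<omega>. (mean_sq 0 \<omega>)^2) + 4 * (real p * entry_prod p sigma sigma)) / (real n)^2"
proof -
  define m where "m = expectation (\<lambda>\<omega>. (mean_sq 0 \<omega>)^2)"
  have int: "integrable M (\<lambda>\<omega>. (mean_sq k \<omega>)^2)" if "k < n" for k
    using mean_sq_sq_L2[OF that] by (rule Lp_fun_2_1)
  have intc: "integrable M (\<lambda>\<omega>. (cross_obs \<omega>)^2)"
    unfolding power2_eq_square by (intro Lp_fun_mult_2 Lp_fun_4_2 cross_obs_L4)
  have pt: "(\<Sum>i<p. (mean_obs \<omega> i)^2)^2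
      \<le> (2 * (real p)^2 * real n * (\<Sum>k<n. (mean_sq k \<omega>)^2) + 2 * (cross_obs \<omega>)^2) / (real n)^4" for \<omega>
  proof -
    have "(real p * (\<Sum>k<n. mean_sq k \<omega>) + cross_obs \<omega>)^2
        \<le> 2 * (real p * (\<Sum>k<n. mean_sq k \<omega>))^2 + 2 * (cross_obs \<omega>)^2"
      using zero_le_power2[of "real p * (\<Sum>k<n. mean_sq k \<omega>) - cross_obs \<omega>"]
      by (simp add: power2_eq_square algebra_simps)
    also have "(real p * (\<Sum>k<n. mean_sq k \<omega>))^2 \<le> (real p)^2 * (real n * (\<Sum>k<n. (mean_sq k \<omega>)^2))"
    proof -
      have "(\<Sum>k<n. mean_sq k \<omega>)^2 \<le> real n * (\<Sum>k<n. (mean_sq k \<omega>)^2)"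
        using Cauchy_Schwarz_ineq_sum[of "\<lambda>_. 1" "\<lambda>k. mean_sq k \<omega>" "{..<n}"] by simp
      then show ?thesis by (simp add: power_mult_distrib mult_left_mono)
    qed
    finally have "(real p * (\<Sum>k<n. mean_sq k \<omega>) + cross_obs \<omega>)^2
        \<le> 2 * (real p)^2 * real n * (\<Sum>k<n. (mean_sq k \<omega>)^2) + 2 * (cross_obs \<omega>)^2" by (simp add: mult.assoc)
    then show ?thesis
      unfolding mean_obs_norm_sq power_divide by (simp add: divide_right_mono flip: power_mult)
  qed
  have "expectation (\<lambda>\<omega>. (\<Sum>i<p. (mean_obs \<omega> i)^2)^2)
      \<le> expectation (\<lambda>\<omega>. (2 * (real p)^2 * real n * (\<Sum>k<n. (mean_sq k \<omega>)^2) + 2 * (cross_obs \<omega>)^2) / (real n)^4)"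
  proof (rule integral_mono')
    show "integrable M (\<lambda>\<omega>. (2 * (real p)^2 * real n * (\<Sum>k<n. (mean_sq k \<omega>)^2) + 2 * (cross_obs \<omega>)^2) / (real n)^4)"
      using int intc
      by (intro integrable_divide Bochner_Integration.integrable_add integrable_mult_right
          Bochner_Integration.integrable_sum) auto
  qed (auto simp: pt sum_nonneg)
  also have "\<dots> = (2 * (real p)^2 * real n * (real n * m) + 2 * expectation (\<lambda>\<omega>. (cross_obs \<omega>)^2)) / (real n)^4"
  proof -
    have "expectation (\<lambda>\<omega>. \<Sum>k<n. (mean_sq k \<omega>)^2) = real n * m"
    proof -
      have "expectation (\<lambda>\<omega>. \<Sum>k<n. (mean_sq k \<omega>)^2) = (\<Sum>k<n. expectation (\<lambda>\<omega>. (mean_sq k \<omega>)^2))"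
        using int by (intro Bochner_Integration.integral_sum) auto
      also have "\<dots> = (\<Sum>k<n. m)"
        unfolding m_def by (intro sum.cong refl expectation_mean_sq_power) auto
      finally show ?thesis by simp
    qed
    moreover have "integrable M (\<lambda>\<omega>. \<Sum>k<n. (mean_sq k \<omega>)^2)"
      using int by (intro Bochner_Integration.integrable_sum) auto
    ultimately show ?thesis using intc by simp
  qed
  also have "\<dots> \<le> (2 * (real p)^2 * real n * (real n * m) + 2 * (2 * (real n)^2 * (real p * entry_prod p sigma sigma))) / (real n)^4"
    using expectation_cross_obs_sq_le by (intro divide_right_mono add_left_mono mult_left_mono) auto
  also have "\<dots> = (2 * (real p)^2 * m + 4 * (real p * entry_prod p sigma sigma)) / (real n)^2"
    using n_pos by (simp add: field_simps power2_eq_square power4_eq_xxxx)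
  finally show ?thesis by (simp add: m_def)
qed

end

section \<open>Measurability of the estimators\<close>

text \<open>Measurability of a random matrix is that of its entries; the estimators are then measurable by closure
  under the operations that build them.\<close>
definition mat_measurable :: "'a measure \<Rightarrow> nat \<Rightarrow> nat \<Rightarrow> ('a \<Rightarrow> real mat) \<Rightarrow> bool" where
  "mat_measurable M p q B \<longleftrightarrow> (\<forall>\<omega>\<in>space M. B \<omega> \<in> carrier_mat p q) \<and>
     (\<forall>i<p. \<forall>j<q. (\<lambda>\<omega>. B \<omega> $$ (i, j)) \<in> borel_measurable M)"

lemma mat_measurableI:
  assumes "\<And>\<omega>. \<omega> \<in> space M \<Longrightarrow> B \<omega> \<in> carrier_mat p q"
    and "\<And>i j \<omega>. i < p \<Longrightarrow> j < q \<Longrightarrow> \<omega> \<in> space M \<Longrightarrow> B \<omega> $$ (i, j) = f i j \<omega>"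
    and "\<And>i j. i < p \<Longrightarrow> j < q \<Longrightarrow> f i j \<in> borel_measurable M"
  shows "mat_measurable M p q B"
  unfolding mat_measurable_def
proof (intro conjI ballI allI impI)
  fix i j assume ij: "i < p" "j < q"
  have "(\<lambda>\<omega>. B \<omega> $$ (i, j)) \<in> borel_measurable M \<longleftrightarrow> f i j \<in> borel_measurable M"
    using assms(2) ij by (intro measurable_cong)
  then show "(\<lambda>\<omega>. B \<omega> $$ (i, j)) \<in> borel_measurable M" using assms(3) ij by simp
qed (rule assms(1))

lemma mat_measurable_carrier: "mat_measurable M p q B \<Longrightarrow> \<omega> \<in> space M \<Longrightarrow> B \<omega> \<in> carrier_mat p q"
  by (simp add: mat_measurable_def)

lemma mat_measurable_entry:
  "mat_measurable M p q B \<Longrightarrow> i < p \<Longrightarrow> j < q \<Longrightarrow> (\<lambda>\<omega>. B \<omega> $$ (i, j)) \<in> borel_measurable M"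
  by (simp add: mat_measurable_def)

lemma mat_measurable_const: "B \<in> carrier_mat p q \<Longrightarrow> mat_measurable M p q (\<lambda>\<omega>. B)"
  by (simp add: mat_measurable_def)

lemma mat_measurable_transpose:
  assumes "mat_measurable M p q B" shows "mat_measurable M q p (\<lambda>\<omega>. transpose_mat (B \<omega>))"
  using mat_measurable_carrier[OF assms] mat_measurable_entry[OF assms]
  by (intro mat_measurableI[where f = "\<lambda>i j \<omega>. B \<omega> $$ (j, i)"]) fastforce+

lemma mat_measurable_mult:
  assumes A: "mat_measurable M p q A" and B: "mat_measurable M q r B"
  shows "mat_measurable M p r (\<lambda>\<omega>. A \<omega> * B \<omega>)"
proof (rule mat_measurableI[where f = "\<lambda>i j \<omega>. \<Sum>l<q. A \<omega> $$ (i, l) * B \<omega> $$ (l, j)"])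
  fix \<omega> assume w: "\<omega> \<in> space M"
  show "A \<omega> * B \<omega> \<in> carrier_mat p r"
    using mat_measurable_carrier[OF A w] mat_measurable_carrier[OF B w] by simp
  show "(A \<omega> * B \<omega>) $$ (i, j) = (\<Sum>l<q. A \<omega> $$ (i, l) * B \<omega> $$ (l, j))" if "i < p" "j < r" for i j
    using mat_measurable_carrier[OF A w] mat_measurable_carrier[OF B w] that
    by (auto simp: scalar_prod_def lessThan_atLeast0)
qed (intro borel_measurable_sum borel_measurable_times mat_measurable_entry[OF A] mat_measurable_entry[OF B], auto)

lemma mat_measurable_add:
  assumes A: "mat_measurable M p q A" and B: "mat_measurable M p q B"
  shows "mat_measurable M p q (\<lambda>\<omega>. A \<omega> + B \<omega>)"
proof (rule mat_measurableI[where f = "\<lambda>i j \<omega>. A \<omega> $$ (i, j) + B \<omega> $$ (i, j)"])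
  fix \<omega> assume w: "\<omega> \<in> space M"
  show "A \<omega> + B \<omega> \<in> carrier_mat p q"
    using mat_measurable_carrier[OF A w] mat_measurable_carrier[OF B w] by simp
  show "(A \<omega> + B \<omega>) $$ (i, j) = A \<omega> $$ (i, j) + B \<omega> $$ (i, j)" if "i < p" "j < q" for i j
    using mat_measurable_carrier[OF A w] mat_measurable_carrier[OF B w] that by auto
qed (intro borel_measurable_add mat_measurable_entry[OF A] mat_measurable_entry[OF B], auto)

lemma mat_measurable_minus:
  assumes A: "mat_measurable M p q A" and B: "mat_measurable M p q B"
  shows "mat_measurable M p q (\<lambda>\<omega>. A \<omega> - B \<omega>)"
proof (rule mat_measurableI[where f = "\<lambda>i j \<omega>. A \<omega> $$ (i, j) - B \<omega> $$ (i, j)"])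
  fix \<omega> assume w: "\<omega> \<in> space M"
  show "A \<omega> - B \<omega> \<in> carrier_mat p q"
    using mat_measurable_carrier[OF B w] by (rule minus_carrier_mat)
  show "(A \<omega> - B \<omega>) $$ (i, j) = A \<omega> $$ (i, j) - B \<omega> $$ (i, j)" if "i < p" "j < q" for i j
    using mat_measurable_carrier[OF A w] mat_measurable_carrier[OF B w] that by auto
qed (intro borel_measurable_diff mat_measurable_entry[OF A] mat_measurable_entry[OF B], auto)

lemma mat_measurable_smult:
  assumes c: "c \<in> borel_measurable M" and B: "mat_measurable M p q B"
  shows "mat_measurable M p q (\<lambda>\<omega>. c \<omega> \<cdot>\<^sub>m B \<omega>)"
proof (rule mat_measurableI[where f = "\<lambda>i j \<omega>. c \<omega> * B \<omega> $$ (i, j)"])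
  fix \<omega> assume w: "\<omega> \<in> space M"
  show "c \<omega> \<cdot>\<^sub>m B \<omega> \<in> carrier_mat p q" using mat_measurable_carrier[OF B w] by simp
  show "(c \<omega> \<cdot>\<^sub>m B \<omega>) $$ (i, j) = c \<omega> * B \<omega> $$ (i, j)" if "i < p" "j < q" for i j
    using mat_measurable_carrier[OF B w] that by auto
qed (intro borel_measurable_times c mat_measurable_entry[OF B], auto)

lemma mat_measurable_outer_col:
  assumes B: "mat_measurable M p q B" and k: "k < q"
  shows "mat_measurable M p p (\<lambda>\<omega>. outer_col (B \<omega>) k)"
proof (rule mat_measurableI[where f = "\<lambda>i j \<omega>. B \<omega> $$ (i, k) * B \<omega> $$ (j, k)"])
  fix \<omega> assume w: "\<omega> \<in> space M"
  show "outer_col (B \<omega>) k \<in> carrier_mat p p" using mat_measurable_carrier[OF B w] by (rule outer_col_carrier)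
  show "outer_col (B \<omega>) k $$ (i, j) = B \<omega> $$ (i, k) * B \<omega> $$ (j, k)" if "i < p" "j < p" for i j
    using outer_col_entry[OF mat_measurable_carrier[OF B w] that] by (simp add: outer_def)
qed (intro borel_measurable_times mat_measurable_entry[OF B] k, auto)

lemma mat_measurable_lin_comb:
  assumes c: "\<And>k. k < N \<Longrightarrow> (\<lambda>\<omega>. c \<omega> k) \<in> borel_measurable M"
  shows "mat_measurable M p p (\<lambda>\<omega>. lin_comb p N (c \<omega>) T)"
  by (rule mat_measurableI[where f = "\<lambda>i j \<omega>. \<Sum>k<N. c \<omega> k * T k $$ (i, j)"])
     (auto simp: lin_comb_def intro!: borel_measurable_sum borel_measurable_times c)

lemma mat_measurable_psd_proj:
  assumes A: "mat_measurable M p p A" shows "mat_measurable M p p (\<lambda>\<omega>. psd_proj p (A \<omega>))"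
proof (rule mat_measurableI[where f = "\<lambda>i j \<omega>. psd_proj p (A \<omega>) $$ (i, j)"])
  fix \<omega> assume "\<omega> \<in> space M"
  then show "psd_proj p (A \<omega>) \<in> carrier_mat p p"
    by (intro psd_proj_nearest(1) mat_measurable_carrier[OF A])
qed (auto intro!: measurable_psd_proj mat_measurable_carrier[OF A] mat_measurable_entry[OF A])

lemma entry_prod_measurable:
  assumes "\<And>i j. i < p \<Longrightarrow> j < p \<Longrightarrow> (\<lambda>\<omega>. f \<omega> (i, j)) \<in> borel_measurable M"
    and "\<And>i j. i < p \<Longrightarrow> j < p \<Longrightarrow> (\<lambda>\<omega>. g \<omega> (i, j)) \<in> borel_measurable M"
  shows "(\<lambda>\<omega>. entry_prod p (f \<omega>) (g \<omega>)) \<in> borel_measurable M"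
  unfolding entry_prod_def using assms
  by (intro borel_measurable_divide borel_measurable_sum borel_measurable_times borel_measurable_const) auto

lemma inner_mat_measurable:
  assumes A: "mat_measurable M p p A" and B: "mat_measurable M p p B"
  shows "(\<lambda>\<omega>. inner_mat p (A \<omega>) (B \<omega>)) \<in> borel_measurable M"
proof -
  have "(\<lambda>\<omega>. inner_mat p (A \<omega>) (B \<omega>)) \<in> borel_measurable M
      \<longleftrightarrow> (\<lambda>\<omega>. entry_prod p (($$) (A \<omega>)) (($$) (B \<omega>))) \<in> borel_measurable M"
    by (intro measurable_cong inner_mat_entry_prod mat_measurable_carrier[OF A] mat_measurable_carrier[OF B])
  also have "\<dots>"
    by (intro entry_prod_measurable mat_measurable_entry[OF A] mat_measurable_entry[OF B])
  finally show ?thesis .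
qed

lemma norm_mat_measurable:
  assumes A: "mat_measurable M p p A" shows "(\<lambda>\<omega>. norm_mat p (A \<omega>)) \<in> borel_measurable M"
  unfolding norm_mat_def by (rule measurable_compose[OF inner_mat_measurable[OF A A] borel_measurable_sqrt])

context
  fixes M :: "'a measure" and p n N :: nat and Z :: "'a \<Rightarrow> real mat" and s :: mean_setting
    and T :: "nat \<Rightarrow> real mat"
  assumes Z: "mat_measurable M p n Z" and T: "targets p N T"
begin

lemma sample_cov_measurable: "mat_measurable M p p (\<lambda>\<omega>. sample_cov s n (Z \<omega>))"
  by (cases s) (auto intro!: mat_measurable_smult mat_measurable_mult[OF Z] mat_measurable_transpose Z)

lemma var_est_measurable: "(\<lambda>\<omega>. var_est s p n (Z \<omega>)) \<in> borel_measurable M"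
proof -
  have S: "mat_measurable M p p (\<lambda>\<omega>. sample_cov s' n (Z \<omega>))" for s'
    by (cases s') (auto intro!: mat_measurable_smult mat_measurable_mult[OF Z] mat_measurable_transpose Z)
  have dev: "(\<lambda>\<omega>. (norm_mat p (outer_col (Z \<omega>) k - sample_cov s' n (Z \<omega>)))\<^sup>2) \<in> borel_measurable M"
    if "k < n" for k s'
    using that
    by (intro borel_measurable_power norm_mat_measurable mat_measurable_minus S mat_measurable_outer_col[OF Z])
  have dev': "(\<lambda>\<omega>. (norm_mat p ((real n / (real n - 1)) \<cdot>\<^sub>m outer_col (Z \<omega>) k - sample_cov s' n (Z \<omega>)))\<^sup>2) \<in> borel_measurable M"
    if "k < n" for k s'
    using that
    by (intro borel_measurable_power norm_mat_measurable mat_measurable_minus S mat_measurable_smult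
        mat_measurable_outer_col[OF Z] borel_measurable_const)
  show ?thesis
  proof (cases s)
    case Known_Mean
    show ?thesis unfolding Known_Mean var_est.simps(1)
      by (intro borel_measurable_times borel_measurable_const borel_measurable_sum dev) auto
  next
    case Unknown_Mean
    show ?thesis unfolding Unknown_Mean var_est.simps(2) Let_def b_bar_sq_def
      by (intro borel_measurable_times borel_measurable_const borel_measurable_diff borel_measurable_sum dev'
          borel_measurable_power norm_mat_measurable inner_mat_measurable S mat_measurable_const) auto
  qed
qed

lemma var_est_target_measurable:
  assumes k: "k < N" shows "(\<lambda>\<omega>. var_est_target s p n (Z \<omega>) (T k)) \<in> borel_measurable M"
proof -
  have S: "mat_measurable M p p (\<lambda>\<omega>. sample_cov s' n (Z \<omega>))" for s'
    by (cases s') (auto intro!: mat_measurable_smult mat_measurable_mult[OF Z] mat_measurable_transpose Z)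
  have Tk: "mat_measurable M p p (\<lambda>\<omega>. T k)" using targets_carrier[OF T k] by (rule mat_measurable_const)
  show ?thesis
  proof (cases s)
    case Known_Mean
    show ?thesis unfolding Known_Mean var_est_target.simps(1)
      by (intro borel_measurable_times borel_measurable_const borel_measurable_sum
          borel_measurable_power inner_mat_measurable mat_measurable_minus S
          mat_measurable_outer_col[OF Z] Tk) auto
  next
    case Unknown_Mean
    have ST: "mat_measurable M p p (\<lambda>\<omega>. sample_cov s' n (Z \<omega>) * T k)"
      "mat_measurable M p p (\<lambda>\<omega>. T k * sample_cov s' n (Z \<omega>))" for s'
      by (rule mat_measurable_mult[OF S Tk] mat_measurable_mult[OF Tk S])+
    show ?thesis unfolding Unknown_Mean var_est_target.simps(2) Let_def b_bar_target_sq_def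
      by (intro borel_measurable_times borel_measurable_const borel_measurable_diff borel_measurable_add
          borel_measurable_sum borel_measurable_power inner_mat_measurable ST S
          mat_measurable_outer_col[OF Z] Tk; simp)
  qed
qed

lemma bona_fide_measurable: "mat_measurable M p p (\<lambda>\<omega>. bona_fide_est s p n N T (Z \<omega>))"
proof -
  have Tk: "mat_measurable M p p (\<lambda>\<omega>. T k)" if "k < N" for k
    using targets_carrier[OF T that] by (rule mat_measurable_const)
  note S = sample_cov_measurable
  have ST: "(\<lambda>\<omega>. inner_mat p (sample_cov s n (Z \<omega>)) (T k)) \<in> borel_measurable M" if "k < N" for k
    using that by (intro inner_mat_measurable S Tk)
  have "(\<lambda>\<omega>. c0_hat s p n N T (Z \<omega>)) \<in> borel_measurable M"
    unfolding c0_hat_def Let_def d_sq_def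
    by (intro borel_measurable_times borel_measurable_divide borel_measurable_const borel_measurable_diff
        borel_measurable_sum borel_measurable_power norm_mat_measurable S ST
        var_est_measurable var_est_target_measurable) auto
  then have c: "(\<lambda>\<omega>. bona_fide_c0 s p n N T (Z \<omega>)) \<in> borel_measurable M"
    unfolding bona_fide_c0_def by (intro borel_measurable_min borel_measurable_max borel_measurable_const)
  show ?thesis
    unfolding bona_fide_est_def Let_def
    by (intro mat_measurable_psd_proj mat_measurable_add mat_measurable_smult S c ST
        mat_measurable_lin_comb borel_measurable_diff borel_measurable_const)
qed

lemma oracle_measurable:
  assumes "\<Sigma> \<in> carrier_mat p p"
  shows "mat_measurable M p p (\<lambda>\<omega>. oracle_est p N T \<Sigma> (sample_cov s n (Z \<omega>)))"
proof -
  have Sig: "mat_measurable M p p (\<lambda>\<omega>. \<Sigma>)" using assms by (rule mat_measurable_const)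
  have Tk: "mat_measurable M p p (\<lambda>\<omega>. T k)" if "k < N" for k
    using targets_carrier[OF T that] by (rule mat_measurable_const)
  note S = sample_cov_measurable
  have ST: "(\<lambda>\<omega>. inner_mat p (sample_cov s n (Z \<omega>)) (T k)) \<in> borel_measurable M" if "k < N" for k
    using that by (intro inner_mat_measurable S Tk)
  have c0: "(\<lambda>\<omega>. oracle_c0 p N T \<Sigma> (sample_cov s n (Z \<omega>))) \<in> borel_measurable M"
    unfolding oracle_c0_def d_sq_def
    by (intro borel_measurable_times borel_measurable_divide borel_measurable_const borel_measurable_diff
        borel_measurable_sum borel_measurable_power norm_mat_measurable inner_mat_measurable S ST Sig) auto
  have "(\<lambda>\<omega>. oracle_c p N T \<Sigma> (sample_cov s n (Z \<omega>)) k) \<in> borel_measurable M" if "k < N" for k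
    unfolding oracle_c_def using that
    by (intro borel_measurable_times borel_measurable_const borel_measurable_diff c0 ST)
  then show ?thesis
    unfolding oracle_est_def
    by (intro mat_measurable_psd_proj mat_measurable_add mat_measurable_smult S c0 mat_measurable_lin_comb)
qed

end

section \<open>Convergence under moment bounds\<close>

lemma L1_null_of_sq:
  assumes f: "L1_null n0 M (\<lambda>n \<omega>. (f n \<omega>)^2)" and prob: "\<And>n. n \<ge> n0 \<Longrightarrow> prob_space (M n)"
    and meas: "\<And>n. n \<ge> n0 \<Longrightarrow> f n \<in> borel_measurable (M n)"
  shows "L1_null n0 M f"
  by (rule L1_null_dominated[OF L1_null_sqrt[OF f prob]]) (auto simp: meas)

text \<open>What the convergence proof uses of the assumptions, with a single constant \<open>K\<close>: the fourth moment of
  \<open>\<bar>z\<bar>\<^sup>2 / p\<close>, the norm of the covariance matrix, \<open>\<Psi> = O(n)\<close>, \<open>p = O(n)\<close> and \<open>N = o(n)\<close>.\<close>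
locale sample_sequence =
  fixes M :: "nat \<Rightarrow> 'a measure" and X :: "nat \<Rightarrow> 'a \<Rightarrow> real mat" and p N :: "nat \<Rightarrow> nat"
    and T :: "nat \<Rightarrow> nat \<Rightarrow> real mat" and s :: mean_setting and K :: real
  assumes samp: "\<And>n. n \<ge> min_size s \<Longrightarrow> iid_sample (M n) (X n) (p n) n"
    and X_dim: "\<And>n \<omega>. n \<ge> min_size s \<Longrightarrow> \<omega> \<in> space (M n) \<Longrightarrow> X n \<omega> \<in> carrier_mat (p n) n"
    and targets: "\<And>n. n \<ge> min_size s \<Longrightarrow> targets (p n) (N n) (T n)"
    and K_ge_1: "1 \<le> K"
    and mean_sq_le: "\<And>n. n \<ge> min_size s \<Longrightarrow> integral\<^sup>L (M n) (\<lambda>\<omega>. (iid_sample.mean_sq (M n) (X n) (p n) 0 \<omega>)^4) \<le> K"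
    and sigma_le: "\<And>n. n \<ge> min_size s \<Longrightarrow>
      entry_prod (p n) (iid_sample.sigma (M n) (X n)) (iid_sample.sigma (M n) (X n)) \<le> K"
    and dev_power_le: "\<And>n. n \<ge> min_size s \<Longrightarrow> iid_sample.dev_power (M n) (X n) (p n) \<le> K * real n"
    and p_le: "\<And>n. n \<ge> min_size s \<Longrightarrow> real (p n) \<le> K * real n"
    and N_le: "(\<lambda>n. real (N n) / real n) \<longlonglongrightarrow> 0"
begin

text \<open>Notation: \<open>sg\<close> is the covariance matrix and \<open>rS\<close> its residual, \<open>z\<close> the observations centred at the true
  mean and \<open>mz\<close> their average, \<open>w0\<close> the error of the known-mean sample covariance, \<open>t\<close> the targets, 
  \<open>zh\<close> the columns that the estimators see, and \<open>msq\<close> is \<open>\<bar>z\<bar>\<^sup>2 / p\<close>.  The suffixes \<open>obs\<close> and \<open>cen\<close> tell the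
  true centring from the one of the estimators.\<close>
abbreviation "n0 \<equiv> min_size s"
abbreviation "sg n \<equiv> iid_sample.sigma (M n) (X n)"
abbreviation "w0 n \<equiv> iid_sample.mean_dev (M n) (X n) n"
abbreviation "z n k \<equiv> iid_sample.obs (M n) (X n) k"
abbreviation "mz n \<equiv> iid_sample.mean_obs (M n) (X n) n"
abbreviation "msq n \<equiv> iid_sample.mean_sq (M n) (X n) (p n)"
abbreviation "t n k \<equiv> (($$) (T n k))"
abbreviation "sq n f \<equiv> entry_prod (p n) f f"
abbreviation "rS n \<equiv> residual (p n) (N n) (t n) (sg n)"
abbreviation "Z n \<equiv> centred_obs s (M n) (p n) n (X n)"
abbreviation "S n \<omega> \<equiv> sample_cov s n (Z n \<omega>)"
abbreviation "zh n \<omega> k i \<equiv> Z n \<omega> $$ (i, k)"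
abbreviation "pow_obs n \<omega> \<equiv> obs_power (p n) n (\<lambda>k. z n k \<omega>)"
abbreviation "pow_cen n \<omega> \<equiv> obs_power (p n) n (zh n \<omega>)"
abbreviation "tpow_obs n \<omega> \<equiv> target_power (p n) n (N n) (t n) (\<lambda>k. z n k \<omega>)"
abbreviation "tpow_cen n \<omega> \<equiv> target_power (p n) n (N n) (t n) (zh n \<omega>)"
abbreviation "mean_pow n \<omega> \<equiv> (\<Sum>i<p n. (mz n \<omega> i)^2)^2"

lemma prob: "n \<ge> n0 \<Longrightarrow> prob_space (M n)"
  using samp unfolding iid_sample_def by blast

lemma n_ge_2: "n \<ge> n0 \<Longrightarrow> 2 \<le> n"
  by (cases s) auto

lemma p_ge_1: "n \<ge> n0 \<Longrightarrow> 1 \<le> p n"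
  using iid_sample.p_pos[OF samp] .

lemma on_t: "n \<ge> n0 \<Longrightarrow> orthonormal (p n) (N n) (t n)"
  using targets_orthonormal[OF targets] .

lemma obs_measurable:
  assumes "n \<ge> n0" "i < p n" "k < n" shows "(\<lambda>\<omega>. z n k \<omega> i) \<in> borel_measurable (M n)"
  using iid_sample.obs_L8[OF samp[OF assms(1)] assms(2,3)] by (rule Lp_fun_measurable)

lemma mean_dev_measurable:
  assumes "n \<ge> n0" "i < p n" "j < p n" shows "(\<lambda>\<omega>. w0 n \<omega> (i, j)) \<in> borel_measurable (M n)"
  using iid_sample.mean_dev_L4[OF samp[OF assms(1)], of "(i, j)"] assms by (auto intro: Lp_fun_measurable)

lemma w0_inner_measurable:
  assumes "n \<ge> n0" shows "(\<lambda>\<omega>. entry_prod (p n) (w0 n \<omega>) A) \<in> borel_measurable (M n)"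
  using mean_dev_measurable[OF assms] by (intro entry_prod_measurable) auto

lemma w0_sq_measurable:
  assumes "n \<ge> n0" shows "(\<lambda>\<omega>. sq n (w0 n \<omega>)) \<in> borel_measurable (M n)"
  using mean_dev_measurable[OF assms] by (intro entry_prod_measurable) auto

lemma mean_sq_sq_le:
  assumes n: "n \<ge> n0" and k: "k < n"
  shows "integrable (M n) (\<lambda>\<omega>. (msq n k \<omega>)^2)" "integral\<^sup>L (M n) (\<lambda>\<omega>. (msq n k \<omega>)^2) \<le> K"
proof -
  interpret iid_sample "M n" "X n" "p n" n using samp[OF n] .
  show int: "integrable (M n) (\<lambda>\<omega>. (mean_sq k \<omega>)^2)" using mean_sq_sq_L2[OF k] by (rule Lp_fun_2_1)
  have int4: "integrable (M n) (\<lambda>\<omega>. (mean_sq k \<omega>)^4)"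
    using Lp_fun_mult_2[OF mean_sq_sq_L2 mean_sq_sq_L2, OF k k] by (simp flip: power_add)
  have "expectation (\<lambda>\<omega>. (mean_sq k \<omega>)^2) \<le> expectation (\<lambda>\<omega>. (1 + (mean_sq k \<omega>)^4) / 2)"
  proof (rule integral_mono[OF int])
    show "integrable (M n) (\<lambda>\<omega>. (1 + (mean_sq k \<omega>)^4) / 2)" using int4 by simp
    show "(mean_sq k \<omega>)^2 \<le> (1 + (mean_sq k \<omega>)^4) / 2" for \<omega>
    proof -
      have "0 \<le> ((mean_sq k \<omega>)^2 - 1)^2" by simp
      also have "\<dots> = (mean_sq k \<omega>)^4 - 2 * (mean_sq k \<omega>)^2 + 1"
        by (simp add: power2_eq_square power4_eq_xxxx algebra_simps)
      finally show ?thesis by simp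
    qed
  qed
  also have "\<dots> = (1 + expectation (\<lambda>\<omega>. (mean_sq k \<omega>)^4)) / 2" using int4 by (simp add: prob_space)
  also have "\<dots> \<le> K"
    using mean_sq_le[OF n] K_ge_1 expectation_mean_sq_power[OF k, of 4] by simp
  finally show "expectation (\<lambda>\<omega>. (mean_sq k \<omega>)^2) \<le> K" .
qed

text \<open>The deterministic value around which both \<open>\<parallel>S - \<Sigma>\<parallel>\<^sup>2\<close> and its estimator concentrate.\<close>
definition v :: "nat \<Rightarrow> real" where
  "v n = real (p n) / real n * integral\<^sup>L (M n) (\<lambda>\<omega>. (msq n 0 \<omega>)^2)"

lemma v_bounds: assumes "n \<ge> n0" shows "0 \<le> v n" "v n \<le> K * K"
proof -
  have n: "2 \<le> n" using n_ge_2[OF assms] .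
  have E: "0 \<le> integral\<^sup>L (M n) (\<lambda>\<omega>. (msq n 0 \<omega>)^2)" by (intro Bochner_Integration.integral_nonneg) auto
  then show "0 \<le> v n" by (simp add: v_def)
  have "real (p n) / real n \<le> K" using p_le[OF assms] n by (simp add: divide_le_eq)
  then show "v n \<le> K * K"
    unfolding v_def using mean_sq_sq_le(2)[OF assms, of 0] n E K_ge_1 by (intro mult_mono) auto
qed

lemma inverse_n_null: "(\<lambda>n. c / real n) \<longlonglongrightarrow> 0"
  by (rule lim_const_over_n)

lemma inverse_sqrt_n_null: "(\<lambda>n. c / sqrt (real n)) \<longlonglongrightarrow> 0"
proof -
  have "(\<lambda>n. sqrt (1 / real n)) \<longlonglongrightarrow> sqrt 0" by (intro tendsto_real_sqrt inverse_n_null)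
  then have "(\<lambda>n. c * sqrt (1 / real n)) \<longlonglongrightarrow> c * 0" by (intro tendsto_mult_left) simp
  then show ?thesis by (simp add: real_sqrt_divide)
qed

text \<open>The factor \<open>\<surd>N\<close> of the quadratic-form bound meets \<open>\<Psi> = O(n)\<close>: the mean is \<open>O(\<surd>(N / n))\<close>.\<close>
lemma w0_targets_null: "L1_null n0 M (\<lambda>n \<omega>. \<Sum>k<N n. (entry_prod (p n) (w0 n \<omega>) (t n k))^2)"
proof (rule L1_nullI)
  fix n assume n: "n \<ge> n0"
  interpret iid_sample "M n" "X n" "p n" n using samp[OF n] .
  show "integrable (M n) (\<lambda>\<omega>. \<Sum>k<N n. (entry_prod (p n) (w0 n \<omega>) (t n k))^2)"
  proof (intro Bochner_Integration.integrable_sum)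
    fix k
    have "Lp_fun (M n) 2 (\<lambda>\<omega>. (1 / real (p n)) * (\<Sum>a\<in>grid. t n k a * mean_dev \<omega> a))"
      by (intro Lp_fun_cmult Lp_fun_sum Lp_fun_4_2 mean_dev_L4)
    then have "Lp_fun (M n) 2 (\<lambda>\<omega>. entry_prod (p n) (mean_dev \<omega>) (t n k))"
      by (simp add: entry_prod_def mult.commute)
    from Lp_fun_mult_2[OF this this] show "integrable (M n) (\<lambda>\<omega>. (entry_prod (p n) (mean_dev \<omega>) (t n k))^2)"
      by (simp add: power2_eq_square)
  qed
  have "(\<Sum>j<N n. \<Sum>l<N n. (entry_prod (p n) (t n j) (t n l))^2) = (\<Sum>j<N n. \<Sum>l<N n. if j = l then 1 else 0)"
    using on_t[OF n] by (intro sum.cong refl) (simp add: orthonormal_def)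
  also have "\<dots> = real (N n)" by simp
  finally have gram: "(\<Sum>j<N n. \<Sum>l<N n. (entry_prod (p n) (t n j) (t n l))^2) = real (N n)" .
  have "expectation (\<lambda>\<omega>. \<bar>\<Sum>k<N n. (entry_prod (p n) (mean_dev \<omega>) (t n k))^2\<bar>)
      = expectation (\<lambda>\<omega>. \<Sum>k<N n. (entry_prod (p n) (mean_dev \<omega>) (t n k))^2)"
    by (simp add: sum_nonneg)
  also have "\<dots> \<le> sqrt dev_power / real n * sqrt (real (N n))"
    using expectation_mean_dev_inner_sq_le[where m = "N n" and A = "t n"] unfolding gram .
  also have "\<dots> \<le> sqrt (K * real n) / real n * sqrt (real (N n))"
    using dev_power_le[OF n] by (intro mult_right_mono divide_right_mono real_sqrt_le_mono) auto
  also have "\<dots> = sqrt (K * (real (N n) / real n))"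
  proof -
    have "sqrt (K * real n) / real n = sqrt K / sqrt (real n)"
      using n_ge_2[OF n] by (simp add: real_sqrt_mult real_div_sqrt field_simps)
    then show ?thesis by (simp add: real_sqrt_mult real_sqrt_divide)
  qed
  finally show "expectation (\<lambda>\<omega>. \<bar>\<Sum>k<N n. (entry_prod (p n) (mean_dev \<omega>) (t n k))^2\<bar>)
      \<le> sqrt (K * (real (N n) / real n))" .
next
  have "(\<lambda>n. sqrt (K * (real (N n) / real n))) \<longlonglongrightarrow> sqrt (K * 0)"
    by (intro tendsto_real_sqrt tendsto_mult_left N_le)
  then show "(\<lambda>n. sqrt (K * (real (N n) / real n))) \<longlonglongrightarrow> 0" by simp
qed

lemma w0_inner_null:
  assumes A: "\<And>n. n \<ge> n0 \<Longrightarrow> entry_prod (p n) (A n) (A n) \<le> K"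
  shows "L1_null n0 M (\<lambda>n \<omega>. entry_prod (p n) (w0 n \<omega>) (A n))"
proof (rule L1_null_of_sq[OF _ prob w0_inner_measurable])
  show "L1_null n0 M (\<lambda>n \<omega>. (entry_prod (p n) (w0 n \<omega>) (A n))^2)"
  proof (rule L1_nullI)
    fix n assume n: "n \<ge> n0"
    interpret iid_sample "M n" "X n" "p n" n using samp[OF n] .
    have "Lp_fun (M n) 2 (\<lambda>\<omega>. (1 / real (p n)) * (\<Sum>a\<in>grid. A n a * mean_dev \<omega> a))"
      by (intro Lp_fun_cmult Lp_fun_sum Lp_fun_4_2 mean_dev_L4)
    then have "Lp_fun (M n) 2 (\<lambda>\<omega>. entry_prod (p n) (mean_dev \<omega>) (A n))"
      by (simp add: entry_prod_def mult.commute)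
    from Lp_fun_mult_2[OF this this] show "integrable (M n) (\<lambda>\<omega>. (entry_prod (p n) (mean_dev \<omega>) (A n))^2)"
      by (simp add: power2_eq_square)
    have "expectation (\<lambda>\<omega>. \<bar>(entry_prod (p n) (mean_dev \<omega>) (A n))^2\<bar>)
        \<le> sqrt dev_power / real n * entry_prod (p n) (A n) (A n)"
      using expectation_mean_dev_inner_sq_le[where m = 1 and A = "\<lambda>_. A n"] entry_prod_nonneg[of "p n" "A n"]
      by (simp add: real_sqrt_abs)
    also have "\<dots> \<le> sqrt (K * real n) / real n * K"
      using dev_power_le[OF n] A[OF n] K_ge_1
      by (intro mult_mono divide_right_mono real_sqrt_le_mono entry_prod_nonneg) auto
    also have "\<dots> = K * sqrt K / sqrt (real n)"
      using n_ge_2[OF n] by (simp add: real_sqrt_mult field_simps)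
    finally show "expectation (\<lambda>\<omega>. \<bar>(entry_prod (p n) (mean_dev \<omega>) (A n))^2\<bar>) \<le> K * sqrt K / sqrt (real n)" .
  qed (rule inverse_sqrt_n_null)
qed

text \<open>An average over the sample with variance \<open>O(p\<^sup>2 / n\<^sup>3)\<close>.\<close>
lemma obs_power_null: "L1_null n0 M (\<lambda>n \<omega>. pow_obs n \<omega> - v n)"
proof (rule L1_null_of_sq[OF _ prob])
  have eq: "pow_obs n \<omega> - v n
      = real (p n) / (real n)^2 * ((\<Sum>k<n. (msq n k \<omega>)^2) - real n * integral\<^sup>L (M n) (\<lambda>\<omega>. (msq n 0 \<omega>)^2))"
    if n: "n \<ge> n0" for n \<omega>
    using n_ge_2[OF n] iid_sample.obs_power_mean_sq[OF samp[OF n]]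
    by (simp add: v_def right_diff_distrib power2_eq_square)
  have L2: "Lp_fun (M n) 2 (\<lambda>\<omega>. (\<Sum>k<n. (msq n k \<omega>)^2) - real n * integral\<^sup>L (M n) (\<lambda>\<omega>. (msq n 0 \<omega>)^2))"
    if n: "n \<ge> n0" for n
  proof -
    interpret iid_sample "M n" "X n" "p n" n using samp[OF n] .
    show ?thesis by (intro Lp_fun_diff Lp_fun_sum mean_sq_sq_L2 Lp_fun_const) simp
  qed
  show "(\<lambda>\<omega>. pow_obs n \<omega> - v n) \<in> borel_measurable (M n)" if n: "n \<ge> n0" for n
    unfolding eq[OF n] by (rule Lp_fun_measurable[OF Lp_fun_cmult[OF L2[OF n]]])
  show "L1_null n0 M (\<lambda>n \<omega>. (pow_obs n \<omega> - v n)^2)"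
  proof (rule L1_nullI)
    fix n assume n: "n \<ge> n0"
    interpret iid_sample "M n" "X n" "p n" n using samp[OF n] .
    note sqi = Lp_fun_mult_2[OF Lp_fun_cmult[OF L2[OF n]] Lp_fun_cmult[OF L2[OF n]]]
    show "integrable (M n) (\<lambda>\<omega>. (pow_obs n \<omega> - v n)^2)"
      unfolding eq[OF n] power2_eq_square[of "_ * _"] by (rule sqi)
    have "expectation (\<lambda>\<omega>. \<bar>(pow_obs n \<omega> - v n)^2\<bar>)
        = (real (p n) / (real n)^2)^2
          * expectation (\<lambda>\<omega>. ((\<Sum>k<n. (mean_sq k \<omega>)^2) - real n * expectation (\<lambda>\<omega>. (mean_sq 0 \<omega>)^2))^2)"
      unfolding eq[OF n] power_mult_distrib by simp
    also have "\<dots> \<le> (real (p n) / (real n)^2)^2 * (real n * expectation (\<lambda>\<omega>. (mean_sq 0 \<omega>) ^ 4))"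
      by (intro mult_left_mono expectation_mean_sq_fluctuation_le) auto
    also have "\<dots> \<le> (K * real n / (real n)^2)^2 * (real n * K)"
      using mean_sq_le[OF n] p_le[OF n] K_ge_1
      by (intro mult_mono power_mono divide_right_mono Bochner_Integration.integral_nonneg) auto
    also have "\<dots> = K^3 / real n"
      using n_ge_2[OF n] by (simp add: field_simps power2_eq_square power3_eq_cube)
    finally show "expectation (\<lambda>\<omega>. \<bar>(pow_obs n \<omega> - v n)^2\<bar>) \<le> K^3 / real n" .
  qed (rule inverse_n_null)
qed

text \<open>The second moment is \<open>O(\<Psi> / n\<^sup>2) = O(1 / n)\<close>.\<close>
lemma cross_dev_null:
  "L1_null n0 M (\<lambda>n \<omega>. iid_sample.cross_dev (M n) (X n) (p n) n \<omega> / (real n)^2)"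
proof (rule L1_null_of_sq[OF _ prob])
  have meas: "iid_sample.cross_dev (M n) (X n) (p n) n \<in> borel_measurable (M n)" 
    and L2: "integrable (M n) (\<lambda>\<omega>. (iid_sample.cross_dev (M n) (X n) (p n) n \<omega>)^2)" if n: "n \<ge> n0" for n
  proof -
    interpret iid_sample "M n" "X n" "p n" n using samp[OF n] .
    have "Lp_fun (M n) 2 (\<lambda>\<omega>. (1 / real (p n)) * (\<Sum>k<n. \<Sum>l\<in>{..<n} - {k}. \<Sum>a\<in>grid. dev k \<omega> a * dev l \<omega> a))"
      by (intro Lp_fun_cmult Lp_fun_sum Lp_fun_mult_4 dev_L4) auto
    then have L: "Lp_fun (M n) 2 cross_dev"
      by (simp add: cross_dev_def[abs_def] entry_prod_def sum_divide_distrib)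
    then show "cross_dev \<in> borel_measurable (M n)" by (rule Lp_fun_measurable)
    show "integrable (M n) (\<lambda>\<omega>. (cross_dev \<omega>)^2)"
      using Lp_fun_mult_2[OF L L] by (simp add: power2_eq_square)
  qed
  show "(\<lambda>\<omega>. iid_sample.cross_dev (M n) (X n) (p n) n \<omega> / (real n)^2) \<in> borel_measurable (M n)"
    if n: "n \<ge> n0" for n using meas[OF n] by measurable
  show "L1_null n0 M (\<lambda>n \<omega>. (iid_sample.cross_dev (M n) (X n) (p n) n \<omega> / (real n)^2)^2)"
  proof (rule L1_nullI)
    fix n assume n: "n \<ge> n0"
    interpret iid_sample "M n" "X n" "p n" n using samp[OF n] .
    show "integrable (M n) (\<lambda>\<omega>. (cross_dev \<omega> / (real n)^2)^2)"
      using L2[OF n] by (simp add: power_divide)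
    have "expectation (\<lambda>\<omega>. \<bar>(cross_dev \<omega> / (real n)^2)^2\<bar>) = expectation (\<lambda>\<omega>. (cross_dev \<omega>)^2) / (real n)^4"
      by (simp add: power_divide flip: power_mult)
    also have "\<dots> \<le> (2 * (real n)^2 * (K * real n)) / (real n)^4"
      using dev_power_le[OF n]
      by (intro divide_right_mono order_trans[OF expectation_cross_dev_sq_le] mult_left_mono) auto
    also have "\<dots> = 2 * K / real n"
      using n_ge_2[OF n] by (simp add: field_simps power2_eq_square power4_eq_xxxx)
    finally show "expectation (\<lambda>\<omega>. \<bar>(cross_dev \<omega> / (real n)^2)^2\<bar>) \<le> 2 * K / real n" .
  qed (rule inverse_n_null)
qed

lemma sigma_bounded: "L1_bounded n0 M (\<lambda>n \<omega>. sq n (sg n))"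
  using sigma_le entry_prod_nonneg by (intro L1_bounded_const[where B = K] prob) auto

lemma w0_norm_null: "L1_null n0 M (\<lambda>n \<omega>. sq n (w0 n \<omega>) - v n)"
proof -
  have 1: "L1_null n0 M (\<lambda>n \<omega>. (- 1 / real n) * (2 * entry_prod (p n) (w0 n \<omega>) (sg n) + sq n (sg n)))"
    using L1_null_imp_bounded[OF w0_inner_null[of sg]] sigma_le
    by (intro L1_null_scale_bounded L1_bounded_add L1_bounded_cmult sigma_bounded inverse_n_null) auto
  have "L1_null n0 M (\<lambda>n \<omega>. pow_obs n \<omega> - v n
      + (- 1 / real n) * (2 * entry_prod (p n) (w0 n \<omega>) (sg n) + sq n (sg n))
      + iid_sample.cross_dev (M n) (X n) (p n) n \<omega> / (real n)^2)"
    by (intro L1_null_add obs_power_null 1 cross_dev_null)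
  from L1_null_abs[OF this] show ?thesis
  proof (rule L1_null_dominated)
    show "(\<lambda>\<omega>. sq n (w0 n \<omega>) - v n) \<in> borel_measurable (M n)" if "n \<ge> n0" for n
      using w0_sq_measurable[OF that] by measurable
  next
    fix n \<omega> assume n: "n \<ge> n0"
    show "\<bar>sq n (w0 n \<omega>) - v n\<bar> \<le> \<bar>pow_obs n \<omega> - v n
      + (- 1 / real n) * (2 * entry_prod (p n) (w0 n \<omega>) (sg n) + sq n (sg n))
      + iid_sample.cross_dev (M n) (X n) (p n) n \<omega> / (real n)^2\<bar>"
      unfolding iid_sample.mean_dev_norm_sq[OF samp[OF n]] by (simp add: algebra_simps add_divide_distrib)
  qed
qed

lemma v_bounded: "L1_bounded n0 M (\<lambda>n \<omega>. v n)"
  using v_bounds by (intro L1_bounded_const[where B = "K * K"] prob) auto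

lemma w0_norm_bounded: "L1_bounded n0 M (\<lambda>n \<omega>. sq n (w0 n \<omega>))"
  using L1_bounded_add[OF L1_null_imp_bounded[OF w0_norm_null] v_bounded] by simp

lemma obs_power_bounded: "L1_bounded n0 M (\<lambda>n \<omega>. pow_obs n \<omega>)"
  using L1_bounded_add[OF L1_null_imp_bounded[OF obs_power_null] v_bounded] by simp

text \<open>Up to a constant, the mean is \<open>1 / n\<close> times the sum over the targets of the mean of \<open>\<langle>u, T\<^sub>k\<rangle>\<^sup>2\<close>, which is at
  most \<open>\<surd>(N \<Psi>)\<close>, and of \<open>\<langle>\<Sigma>, T\<^sub>k\<rangle>\<^sup>2\<close>, which is at most \<open>\<parallel>\<Sigma>\<parallel>\<^sup>2\<close> by Bessel.\<close>
lemma target_power_null: "L1_null n0 M (\<lambda>n \<omega>. tpow_obs n \<omega>)"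
proof (rule L1_nullI)
  fix n assume n: "n \<ge> n0"
  interpret iid_sample "M n" "X n" "p n" n using samp[OF n] .
  have n2: "2 \<le> n" using n_ge_2[OF n] .
  define B where "B \<omega> = (2 / (real n)^2) * (\<Sum>l<n. (\<Sum>k<N n. (entry_prod (p n) (dev l \<omega>) (t n k))^2) + K)" for \<omega>
  have devL: "integrable (M n) (\<lambda>\<omega>. \<Sum>k<N n. (entry_prod (p n) (dev l \<omega>) (t n k))^2)" if l: "l < n" for l
  proof (intro Bochner_Integration.integrable_sum)
    fix k
    have "Lp_fun (M n) 2 (\<lambda>\<omega>. (1 / real (p n)) * (\<Sum>a\<in>grid. t n k a * dev l \<omega> a))"
      using l by (intro Lp_fun_cmult Lp_fun_sum Lp_fun_4_2 dev_L4)
    then have "Lp_fun (M n) 2 (\<lambda>\<omega>. entry_prod (p n) (dev l \<omega>) (t n k))"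
      by (simp add: entry_prod_def mult.commute)
    from Lp_fun_mult_2[OF this this] show "integrable (M n) (\<lambda>\<omega>. (entry_prod (p n) (dev l \<omega>) (t n k))^2)"
      by (simp add: power2_eq_square)
  qed
  have intB: "integrable (M n) B"
    unfolding B_def[abs_def]
    by (intro integrable_mult_right Bochner_Integration.integrable_sum Bochner_Integration.integrable_add devL)
       auto
  have le: "tpow_obs n \<omega> \<le> B \<omega>" for \<omega>
  proof -
    have "(\<Sum>k<N n. (entry_prod (p n) (outer (z n l \<omega>)) (t n k))^2)
        \<le> 2 * ((\<Sum>k<N n. (entry_prod (p n) (dev l \<omega>) (t n k))^2) + K)" for l
    proof -
      have "outer (z n l \<omega>) = (\<lambda>a. dev l \<omega> a + sg n a)" by (auto simp: dev_def)
      then have "entry_prod (p n) (outer (z n l \<omega>)) (t n k)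
          = entry_prod (p n) (dev l \<omega>) (t n k) + entry_prod (p n) (sg n) (t n k)" for k
        by (simp only: entry_prod_add_left)
      moreover have "(x + y)^2 \<le> 2 * x^2 + 2 * y^2" for x y :: real
        using zero_le_power2[of "x - y"] by (simp add: power2_eq_square algebra_simps)
      ultimately have "(\<Sum>k<N n. (entry_prod (p n) (outer (z n l \<omega>)) (t n k))^2)
          \<le> (\<Sum>k<N n. 2 * (entry_prod (p n) (dev l \<omega>) (t n k))^2 + 2 * (entry_prod (p n) (sg n) (t n k))^2)"
        by (intro sum_mono) simp
      also have "\<dots> = 2 * (\<Sum>k<N n. (entry_prod (p n) (dev l \<omega>) (t n k))^2)
          + 2 * (\<Sum>k<N n. (entry_prod (p n) (sg n) (t n k))^2)"
        by (simp add: sum.distrib sum_distrib_left)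
      also have "(\<Sum>k<N n. (entry_prod (p n) (sg n) (t n k))^2) \<le> K"
        using bessel[OF on_t[OF n]] sigma_le[OF n] by (rule order_trans)
      finally show ?thesis by simp
    qed
    then have "(\<Sum>l<n. \<Sum>k<N n. (entry_prod (p n) (outer (z n l \<omega>)) (t n k))^2)
        \<le> 2 * (\<Sum>l<n. (\<Sum>k<N n. (entry_prod (p n) (dev l \<omega>) (t n k))^2) + K)"
      unfolding sum_distrib_left by (intro sum_mono)
    from divide_right_mono[OF this, of "(real n)^2"] show ?thesis
      by (simp only: target_power_def B_def times_divide_eq_left zero_le_power2 simp_thms)
  qed
  have meas: "(\<lambda>\<omega>. tpow_obs n \<omega>) \<in> borel_measurable (M n)"
    unfolding target_power_def
    by (intro borel_measurable_divide borel_measurable_sum borel_measurable_power entry_prod_measurable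
        borel_measurable_const) (auto simp: outer_def intro!: borel_measurable_times obs_measurable[OF n])
  show int: "integrable (M n) (\<lambda>\<omega>. tpow_obs n \<omega>)"
    using order_trans[OF le abs_ge_self] target_power_nonneg
    by (intro Bochner_Integration.integrable_bound[OF intB meas] AE_I2) simp
  have gram: "(\<Sum>j<N n. \<Sum>l<N n. (entry_prod (p n) (t n j) (t n l))^2) = real (N n)"
  proof -
    have "(\<Sum>j<N n. \<Sum>l<N n. (entry_prod (p n) (t n j) (t n l))^2) = (\<Sum>j<N n. \<Sum>l<N n. if j = l then 1 else 0)"
      using on_t[OF n] by (intro sum.cong refl) (simp add: orthonormal_def)
    then show ?thesis by simp
  qed
  have "expectation (\<lambda>\<omega>. \<bar>tpow_obs n \<omega>\<bar>) \<le> expectation B"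
    using target_power_nonneg le int intB by (intro integral_mono) auto
  also have "\<dots> = (2 / (real n)^2) * (\<Sum>l<n. expectation (\<lambda>\<omega>. \<Sum>k<N n. (entry_prod (p n) (dev l \<omega>) (t n k))^2) + K)"
  proof -
    have "expectation (\<lambda>\<omega>. \<Sum>l<n. (\<Sum>k<N n. (entry_prod (p n) (dev l \<omega>) (t n k))^2) + K)
        = (\<Sum>l<n. expectation (\<lambda>\<omega>. (\<Sum>k<N n. (entry_prod (p n) (dev l \<omega>) (t n k))^2) + K))"
      using devL by (intro Bochner_Integration.integral_sum Bochner_Integration.integrable_add) auto
    also have "\<dots> = (\<Sum>l<n. expectation (\<lambda>\<omega>. \<Sum>k<N n. (entry_prod (p n) (dev l \<omega>) (t n k))^2) + K)"
    proof (intro sum.cong refl)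
      fix l assume "l \<in> {..<n}"
      then have "integrable (M n) (\<lambda>\<omega>. \<Sum>k<N n. (entry_prod (p n) (dev l \<omega>) (t n k))^2)"
        by (intro devL) simp
      from Bochner_Integration.integral_add[OF this integrable_const[of K]]
      show "expectation (\<lambda>\<omega>. (\<Sum>k<N n. (entry_prod (p n) (dev l \<omega>) (t n k))^2) + K)
          = expectation (\<lambda>\<omega>. \<Sum>k<N n. (entry_prod (p n) (dev l \<omega>) (t n k))^2) + K"
        by (simp add: prob_space)
    qed
    finally show ?thesis unfolding B_def[abs_def] by simp
  qed
  also have "\<dots> \<le> (2 / (real n)^2) * (\<Sum>l<n. sqrt (K * real n) * sqrt (real (N n)) + K)"
  proof (intro mult_left_mono sum_mono add_right_mono)
    fix l assume "l \<in> {..<n}"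
    then have "expectation (\<lambda>\<omega>. \<Sum>k<N n. (entry_prod (p n) (dev l \<omega>) (t n k))^2) \<le> sqrt dev_power * sqrt (real (N n))"
      using expectation_dev_inner_sq_le[where k = l and m = "N n" and A = "t n"] unfolding gram by simp
    also have "\<dots> \<le> sqrt (K * real n) * sqrt (real (N n))"
      using dev_power_le[OF n] by (intro mult_right_mono real_sqrt_le_mono) auto
    finally show "expectation (\<lambda>\<omega>. \<Sum>k<N n. (entry_prod (p n) (dev l \<omega>) (t n k))^2) \<le> sqrt (K * real n) * sqrt (real (N n))" .
  qed simp
  also have "\<dots> = 2 * sqrt (K * (real (N n) / real n)) + 2 * K / real n"
  proof -
    have "sqrt (K * real n) * sqrt (real (N n)) = real n * sqrt (K * (real (N n) / real n))"
      using n2 by (simp add: real_sqrt_mult real_sqrt_divide field_simps)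
    then show ?thesis using n2 by (simp add: field_simps power2_eq_square)
  qed
  finally show "expectation (\<lambda>\<omega>. \<bar>tpow_obs n \<omega>\<bar>)
      \<le> 2 * sqrt (K * (real (N n) / real n)) + 2 * K / real n" .
next
  have "(\<lambda>n. 2 * sqrt (K * (real (N n) / real n)) + 2 * K / real n) \<longlonglongrightarrow> 2 * sqrt (K * 0) + 0"
    by (intro tendsto_add tendsto_mult_left tendsto_real_sqrt N_le inverse_n_null)
  then show "(\<lambda>n. 2 * sqrt (K * (real (N n) / real n)) + 2 * K / real n) \<longlonglongrightarrow> 0" by simp
qed

lemma mean_obs_measurable:
  assumes "n \<ge> n0" "i < p n" shows "(\<lambda>\<omega>. mz n \<omega> i) \<in> borel_measurable (M n)"
  unfolding iid_sample.mean_obs_def[OF samp[OF assms(1)]]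
  by (intro borel_measurable_divide borel_measurable_sum obs_measurable assms borel_measurable_const) auto

lemma mean_obs_power_integrable:
  assumes n: "n \<ge> n0" shows "integrable (M n) (\<lambda>\<omega>. mean_pow n \<omega>)"
proof -
  interpret iid_sample "M n" "X n" "p n" n using samp[OF n] .
  have "Lp_fun (M n) 8 (\<lambda>\<omega>. (1 / real n) * (\<Sum>k<n. obs k \<omega> i))" if "i < p n" for i
    using that by (intro Lp_fun_cmult Lp_fun_sum obs_L8) auto
  then have "Lp_fun (M n) 8 (\<lambda>\<omega>. mean_obs \<omega> i)" if "i < p n" for i
    using that by (simp add: mean_obs_def)
  then have "Lp_fun (M n) 2 (\<lambda>\<omega>. \<Sum>i<p n. mean_obs \<omega> i * mean_obs \<omega> i)"
    by (intro Lp_fun_sum Lp_fun_4_2 Lp_fun_mult_8) auto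
  from Lp_fun_mult_2[OF this this] show ?thesis by (simp add: power2_eq_square)
qed

lemma mean_obs_power_le:
  assumes n: "n \<ge> n0"
  shows "integral\<^sup>L (M n) (\<lambda>\<omega>. mean_pow n \<omega>) \<le> 6 * K * (real (p n))^2 / (real n)^2"
proof -
  interpret iid_sample "M n" "X n" "p n" n using samp[OF n] .
  have "expectation (\<lambda>\<omega>. (\<Sum>i<p n. (mean_obs \<omega> i)^2)^2)
      \<le> (2 * (real (p n))^2 * expectation (\<lambda>\<omega>. (mean_sq 0 \<omega>)^2) + 4 * (real (p n) * entry_prod (p n) sigma sigma)) / (real n)^2"
    by (rule expectation_mean_obs_power_le)
  also have "\<dots> \<le> (2 * (real (p n))^2 * K + 4 * ((real (p n))^2 * K)) / (real n)^2"
  proof (intro divide_right_mono add_mono mult_left_mono mult_mono)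
    show "expectation (\<lambda>\<omega>. (mean_sq 0 \<omega>)^2) \<le> K" using mean_sq_sq_le(2)[OF n, of 0] n_ge_2[OF n] by simp
    show "real (p n) \<le> (real (p n))^2" using p_pos by (simp add: power2_eq_square mult_left_mono)
  qed (use sigma_le[OF n] entry_prod_nonneg in auto)
  finally show ?thesis by (simp add: algebra_simps)
qed

lemma mean_obs_power_bounded: "L1_bounded n0 M (\<lambda>n \<omega>. mean_pow n \<omega>)"
proof (rule L1_boundedI[OF mean_obs_power_integrable])
  fix n assume n: "n \<ge> n0"
  have "integral\<^sup>L (M n) (\<lambda>\<omega>. \<bar>mean_pow n \<omega>\<bar>) \<le> 6 * K * (real (p n))^2 / (real n)^2"
    using mean_obs_power_le[OF n] by simp
  also have "\<dots> \<le> 6 * K * (K * real n)^2 / (real n)^2"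
    using p_le[OF n] K_ge_1 by (intro divide_right_mono mult_left_mono power_mono) auto
  also have "\<dots> = 6 * K^3" using n_ge_2[OF n] by (simp add: power2_eq_square power3_eq_cube)
  finally show "integral\<^sup>L (M n) (\<lambda>\<omega>. \<bar>mean_pow n \<omega>\<bar>) \<le> 6 * K^3" .
qed

text \<open>The normalised norm of \<open>m m\<^sup>T\<close> has mean square \<open>O(p / n\<^sup>2)\<close>.\<close>
lemma mean_obs_power_null: "L1_null n0 M (\<lambda>n \<omega>. mean_pow n \<omega> / real (p n))"
proof (rule L1_nullI)
  fix n assume n: "n \<ge> n0"
  show "integrable (M n) (\<lambda>\<omega>. mean_pow n \<omega> / real (p n))"
    using mean_obs_power_integrable[OF n] by simp
  have "integral\<^sup>L (M n) (\<lambda>\<omega>. \<bar>mean_pow n \<omega> / real (p n)\<bar>)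
      = integral\<^sup>L (M n) (\<lambda>\<omega>. mean_pow n \<omega>) / real (p n)"
    by simp
  also have "\<dots> \<le> (6 * K * (real (p n))^2 / (real n)^2) / real (p n)"
    using mean_obs_power_le[OF n] by (intro divide_right_mono) auto
  also have "\<dots> = 6 * K * real (p n) / (real n)^2" by (simp add: power2_eq_square)
  also have "\<dots> \<le> 6 * K * (K * real n) / (real n)^2"
    using p_le[OF n] K_ge_1 by (intro divide_right_mono mult_left_mono) auto
  also have "\<dots> = 6 * K^2 / real n" using n_ge_2[OF n] by (simp add: power2_eq_square)
  finally show "integral\<^sup>L (M n) (\<lambda>\<omega>. \<bar>mean_pow n \<omega> / real (p n)\<bar>) \<le> 6 * K^2 / real n" .
qed (rule inverse_n_null)

end

lemma sq_add_le: "((x::real) + y)^2 \<le> 2 * x^2 + 2 * y^2"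
  using zero_le_power2[of "x - y"] by (simp add: power2_eq_square algebra_simps)

context sample_sequence
begin

text \<open>What the centring step subtracts in addition to the true mean.\<close>
definition shift :: "nat \<Rightarrow> 'a \<Rightarrow> nat \<Rightarrow> real" where
  "shift n \<omega> i = (case s of Known_Mean \<Rightarrow> 0 | Unknown_Mean \<Rightarrow> mz n \<omega> i)"

lemma shift_known: "s = Known_Mean \<Longrightarrow> shift n \<omega> i = 0"
  and shift_unknown: "s = Unknown_Mean \<Longrightarrow> shift n \<omega> i = mz n \<omega> i"
  unfolding shift_def by simp_all

lemma centred_obs_entry:
  assumes n: "n \<ge> n0" and w: "\<omega> \<in> space (M n)" and ik: "i < p n" "k < n"
  shows "zh n \<omega> k i = z n k \<omega> i - shift n \<omega> i"
proof -
  interpret iid_sample "M n" "X n" "p n" n using samp[OF n] .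
  have X: "X n \<omega> \<in> carrier_mat (p n) n" using X_dim[OF n w] .
  show ?thesis
  proof (cases s)
    case Known_Mean
    have "mean_mat (M n) (p n) n (X n) \<in> carrier_mat (p n) n" by (simp add: mean_mat_def)
    then show ?thesis unfolding shift_known[OF Known_Mean]
      using X ik Known_Mean by (simp add: obs_def mean_mat_entry)
  next
    case Unknown_Mean
    have "mean_obs \<omega> i = (\<Sum>k<n. X n \<omega> $$ (i, k)) / real n - mean_coord i"
      using n_pos by (simp add: mean_obs_def obs_def sum_subtractf diff_divide_distrib)
    then show ?thesis unfolding shift_unknown[OF Unknown_Mean]
      using ik Unknown_Mean by (simp add: obs_def centre_cols_def)
  qed
qed

lemma Z_carrier:
  assumes n: "n \<ge> n0" and w: "\<omega> \<in> space (M n)" shows "Z n \<omega> \<in> carrier_mat (p n) n"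
  using X_dim[OF n w] by (cases s) (auto simp: mean_mat_def centre_cols_def)

lemma shift_measurable:
  assumes "n \<ge> n0" "i < p n" shows "(\<lambda>\<omega>. shift n \<omega> i) \<in> borel_measurable (M n)"
proof (cases s)
  case Known_Mean
  show ?thesis unfolding shift_known[OF Known_Mean] by simp
next
  case Unknown_Mean
  show ?thesis unfolding shift_unknown[OF Unknown_Mean] by (rule mean_obs_measurable[OF assms])
qed

lemma Z_measurable: assumes n: "n \<ge> n0" shows "mat_measurable (M n) (p n) n (Z n)"
proof (rule mat_measurableI[where f = "\<lambda>i k \<omega>. z n k \<omega> i - shift n \<omega> i"])
  show "(\<lambda>\<omega>. z n k \<omega> i - shift n \<omega> i) \<in> borel_measurable (M n)" if "i < p n" "k < n" for i k
    using n that by (intro borel_measurable_diff obs_measurable shift_measurable)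
qed (use n in \<open>auto intro: Z_carrier centred_obs_entry\<close>)

lemma S_measurable: "n \<ge> n0 \<Longrightarrow> mat_measurable (M n) (p n) (p n) (S n)"
  using sample_cov_measurable[OF Z_measurable targets] by blast

lemma S_carrier: "n \<ge> n0 \<Longrightarrow> \<omega> \<in> space (M n) \<Longrightarrow> S n \<omega> \<in> carrier_mat (p n) (p n)"
  by (intro sample_cov_carrier Z_carrier)

text \<open>Effect of estimating the mean on the covariance.\<close>
definition err :: "nat \<Rightarrow> 'a \<Rightarrow> nat \<times> nat \<Rightarrow> real" where
  "err n \<omega> a = S n \<omega> $$ a - sg n a - w0 n \<omega> a"

text \<open>With an estimated mean, \<open>S = n (S\<^sub>0 - m m\<^sup>T) / (n - 1)\<close>, where \<open>S\<^sub>0\<close> is the known-mean sample covariance, so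
  \<open>S - S\<^sub>0 = S\<^sub>0 / (n - 1) - n m m\<^sup>T / (n - 1)\<close>.\<close>
lemma err_sq_le:
  assumes n: "n \<ge> n0" and w: "\<omega> \<in> space (M n)"
  shows "sq n (err n \<omega>) \<le> 16 / (real n)^2 * (sq n (sg n) + sq n (w0 n \<omega>))
      + 8 * (mean_pow n \<omega> / real (p n))" (is "_ \<le> ?rhs")
proof -
  interpret iid_sample "M n" "X n" "p n" n using samp[OF n] .
  have n2: "2 \<le> n" using n_ge_2[OF n] .
  have S: "S n \<omega> $$ (i, j) = (\<Sum>k<n. (obs k \<omega> i - shift n \<omega> i) * (obs k \<omega> j - shift n \<omega> j)) / dof s n"
    if "i < p n" "j < p n" for i j
    unfolding sample_cov_entry[OF Z_carrier[OF n w] that] using that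
    by (intro arg_cong2[where f = "(/)"] sum.cong refl) (simp add: outer_def centred_obs_entry[OF n w])
  show ?thesis
  proof (cases s)
    case Known_Mean
    have "err n \<omega> (i, j) = 0" if "i < p n" "j < p n" for i j
    proof -
      have "S n \<omega> $$ (i, j) = (\<Sum>k<n. outer (obs k \<omega>) (i, j)) / real n"
        unfolding S[OF that] shift_known[OF Known_Mean] using Known_Mean by (simp add: dof_def outer_def)
      then show ?thesis unfolding sum_outer_obs using n_pos by (simp add: err_def)
    qed
    then have "sq n (err n \<omega>) = entry_prod (p n) (\<lambda>_. 0) (\<lambda>_. 0)" by (intro entry_prod_cong)
    also have "\<dots> = 0" by (simp add: entry_prod_def)
    also have "\<dots> \<le> ?rhs" by (intro add_nonneg_nonneg mult_nonneg_nonneg entry_prod_nonneg) auto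
    finally show ?thesis .
  next
    case Unknown_Mean
    let ?f = "\<lambda>a. 1 / (real n - 1) * (sigma a + mean_dev \<omega> a)"
    let ?g = "\<lambda>a. - (real n / (real n - 1)) * outer (mean_obs \<omega>) a"
    have "err n \<omega> (i, j) = ?f (i, j) + ?g (i, j)" if "i < p n" "j < p n" for i j
    proof -
      have m: "(\<Sum>k<n. obs k \<omega> l) = real n * mean_obs \<omega> l" for l using n_pos by (simp add: mean_obs_def)
      have "(\<Sum>k<n. (obs k \<omega> i - mean_obs \<omega> i) * (obs k \<omega> j - mean_obs \<omega> j))
          = (\<Sum>k<n. outer (obs k \<omega>) (i, j) - obs k \<omega> i * mean_obs \<omega> j - mean_obs \<omega> i * obs k \<omega> j
              + mean_obs \<omega> i * mean_obs \<omega> j)"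
        by (intro sum.cong refl) (simp add: outer_def algebra_simps)
      also have "\<dots> = real n * (sigma (i, j) + mean_dev \<omega> (i, j)) - real n * outer (mean_obs \<omega>) (i, j)"
        unfolding sum.distrib sum_subtractf sum_outer_obs sum_distrib_left[symmetric] sum_distrib_right[symmetric] m
        by (simp add: outer_def)
      finally have "S n \<omega> $$ (i, j)
          = (real n * (sigma (i, j) + mean_dev \<omega> (i, j)) - real n * outer (mean_obs \<omega>) (i, j)) / (real n - 1)"
        unfolding S[OF that] shift_unknown[OF Unknown_Mean] using Unknown_Mean by (simp add: dof_def)
      moreover have "(x * b - x * c) / (x - 1) - b = 1 / (x - 1) * b + - (x / (x - 1)) * c"
        if "2 \<le> x" for x b c :: real
      proof -
        have "(x * b - x * c) / (x - 1) - b = (x * b - x * c - (x - 1) * b) / (x - 1)"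
          using that by (simp add: diff_divide_distrib)
        also have "x * b - x * c - (x - 1) * b = b - x * c" by (simp add: algebra_simps)
        finally show ?thesis by (simp add: diff_divide_distrib)
      qed
      ultimately show ?thesis using n2 by (simp add: err_def diff_diff_eq)
    qed
    then have "sq n (err n \<omega>) = entry_prod (p n) (\<lambda>a. ?f a + ?g a) (\<lambda>a. ?f a + ?g a)"
      by (intro entry_prod_cong)
    also have "\<dots> \<le> 2 * entry_prod (p n) ?f ?f + 2 * entry_prod (p n) ?g ?g" by (rule entry_prod_add_sq_le)
    also have "entry_prod (p n) ?f ?f
        = (1 / (real n - 1))^2 * sq n (\<lambda>a. sigma a + mean_dev \<omega> a)"
      by (simp only: entry_prod_scale_left entry_prod_scale_right power2_eq_square mult.assoc)
    also have "entry_prod (p n) ?g ?g = (real n / (real n - 1))^2 * ((\<Sum>i<p n. (mean_obs \<omega> i)^2)^2 / real (p n))"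
      unfolding entry_prod_scale_left entry_prod_scale_right entry_prod_outer
      by (simp only: power2_eq_square mult.assoc[symmetric] minus_mult_minus)
    also have "2 * ((1 / (real n - 1))^2 * sq n (\<lambda>a. sigma a + mean_dev \<omega> a))
          + 2 * ((real n / (real n - 1))^2 * ((\<Sum>i<p n. (mean_obs \<omega> i)^2)^2 / real (p n)))
        \<le> 2 * ((2 / real n)^2 * (2 * sq n sigma + 2 * sq n (mean_dev \<omega>)))
          + 2 * (2^2 * ((\<Sum>i<p n. (mean_obs \<omega> i)^2)^2 / real (p n)))"
      using n2
      by (intro add_mono mult_left_mono mult_mono power_mono entry_prod_add_sq_le entry_prod_nonneg)
         (auto simp: divide_simps)
    also have "\<dots> = ?rhs" by (simp add: power_divide algebra_simps)
    finally show ?thesis .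
  qed
qed

lemma err_entry_measurable:
  assumes n: "n \<ge> n0" and ij: "i < p n" "j < p n" shows "(\<lambda>\<omega>. err n \<omega> (i, j)) \<in> borel_measurable (M n)"
  unfolding err_def using assms
  by (intro borel_measurable_diff mat_measurable_entry[OF S_measurable] mean_dev_measurable borel_measurable_const)

lemma err_null: "L1_null n0 M (\<lambda>n \<omega>. sq n (err n \<omega>))"
proof (rule L1_null_dominated)
  have c: "(\<lambda>n. 16 / (real n)^2) \<longlonglongrightarrow> 0"
  proof -
    have "(\<lambda>n. 16 / real n * (1 / real n)) \<longlonglongrightarrow> 0 * 0" by (intro tendsto_mult inverse_n_null)
    then show ?thesis by (simp add: power2_eq_square)
  qed
  show "L1_null n0 M (\<lambda>n \<omega>. 16 / (real n)^2 * (sq n (sg n) + sq n (w0 n \<omega>))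
      + 8 * (mean_pow n \<omega> / real (p n)))"
    by (intro L1_null_add L1_null_cmult mean_obs_power_null L1_null_scale_bounded c L1_bounded_add
        sigma_bounded w0_norm_bounded)
  show "(\<lambda>\<omega>. sq n (err n \<omega>)) \<in> borel_measurable (M n)" if "n \<ge> n0" for n
    using that by (intro entry_prod_measurable err_entry_measurable)
  show "\<bar>sq n (err n \<omega>)\<bar> \<le> 16 / (real n)^2 * (sq n (sg n) + sq n (w0 n \<omega>))
      + 8 * (mean_pow n \<omega> / real (p n))" if "n \<ge> n0" "\<omega> \<in> space (M n)" for n \<omega>
    using err_sq_le[OF that] entry_prod_nonneg[of "p n" "err n \<omega>"] by simp
qed

text \<open>Effect of estimating the mean on the outer product of a single observation.\<close>
definition fluct :: "nat \<Rightarrow> 'a \<Rightarrow> nat \<Rightarrow> nat \<times> nat \<Rightarrow> real" where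
  "fluct n \<omega> l a = outer (zh n \<omega> l) a - outer (z n l \<omega>) a"

definition fluct_power :: "nat \<Rightarrow> 'a \<Rightarrow> real" where
  "fluct_power n \<omega> = (\<Sum>l<n. sq n (fluct n \<omega> l)) / (real n)^2"

lemma fluct_power_nonneg: "0 \<le> fluct_power n \<omega>"
  by (simp add: fluct_power_def sum_nonneg entry_prod_nonneg)

text \<open>The difference is \<open>m m\<^sup>T - z m\<^sup>T - m z\<^sup>T\<close>; its mixed terms are split so that only the fourth moments of
  \<open>z\<close> and \<open>m\<close> remain.\<close>
lemma fluct_sq_le:
  assumes n: "n \<ge> n0" and w: "\<omega> \<in> space (M n)" and l: "l < n"
  shows "sq n (fluct n \<omega> l) \<le> 3 * ((msq n l \<omega>)^2 + 2 * mean_pow n \<omega>)"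
proof -
  interpret iid_sample "M n" "X n" "p n" n using samp[OF n] .
  define b where "b = (\<Sum>i<p n. (shift n \<omega> i)^2)"
  define m where "m = (\<Sum>i<p n. (mean_obs \<omega> i)^2)"
  define q where "q = (\<Sum>i<p n. (obs l \<omega> i)^2)"
  have q: "q = real (p n) * mean_sq l \<omega>" using p_pos by (simp add: q_def mean_sq_def)
  have b0: "0 \<le> b" by (simp add: b_def sum_nonneg)
  have bm: "b \<le> m"
  proof (cases s)
    case Known_Mean
    then show ?thesis unfolding b_def m_def shift_known[OF Known_Mean] by (simp add: sum_nonneg)
  next
    case Unknown_Mean
    then show ?thesis unfolding b_def m_def shift_unknown[OF Unknown_Mean] by simp
  qed
  have term_le: "(fluct n \<omega> l (i, j))^2 \<le> 3 * ((obs l \<omega> i)^2 * (shift n \<omega> j)^2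
      + (shift n \<omega> i)^2 * (obs l \<omega> j)^2 + (shift n \<omega> i)^2 * (shift n \<omega> j)^2)"
    if ij: "i < p n" "j < p n" for i j
  proof -
    define x y u where "x = obs l \<omega> i * shift n \<omega> j" "y = shift n \<omega> i * obs l \<omega> j" "u = shift n \<omega> i * shift n \<omega> j"
    have "fluct n \<omega> l (i, j) = u - x - y"
      using ij l by (simp add: fluct_def outer_def centred_obs_entry[OF n w] x_y_u_def algebra_simps)
    moreover have "(u - x - y)^2 \<le> 3 * (x^2 + y^2 + u^2)"
    proof -
      have "0 \<le> (x - y)^2 + (u + x)^2 + (u + y)^2" by simp
      then show ?thesis by (simp add: power2_eq_square algebra_simps)
    qed
    ultimately show ?thesis by (simp add: x_y_u_def power_mult_distrib)
  qed
  have "real (p n) * sq n (fluct n \<omega> l) = (\<Sum>i<p n. \<Sum>j<p n. (fluct n \<omega> l (i, j))^2)"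
    using p_pos by (simp add: entry_prod_def sum.cartesian_product' power2_eq_square)
  also have "\<dots> \<le> (\<Sum>i<p n. \<Sum>j<p n. 3 * ((obs l \<omega> i)^2 * (shift n \<omega> j)^2
      + (shift n \<omega> i)^2 * (obs l \<omega> j)^2 + (shift n \<omega> i)^2 * (shift n \<omega> j)^2))"
    by (intro sum_mono term_le) auto
  also have "\<dots> = 3 * (q * b + b * q + b * b)"
    by (simp add: q_def b_def sum_product sum.distrib flip: sum_distrib_left)
  also have "\<dots> = 3 * (real (p n) * (2 * (mean_sq l \<omega> * b)) + b * b)" by (simp add: q)
  also have "\<dots> \<le> 3 * (real (p n) * ((mean_sq l \<omega>)^2 + b * b) + real (p n) * (b * b))"
  proof (intro mult_left_mono add_mono)
    show "2 * (mean_sq l \<omega> * b) \<le> (mean_sq l \<omega>)^2 + b * b"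
      using zero_le_power2[of "mean_sq l \<omega> - b"] by (simp add: power2_eq_square algebra_simps)
    show "b * b \<le> real (p n) * (b * b)" using p_pos b0 by (simp add: mult_le_cancel_right1)
  qed auto
  also have "\<dots> = real (p n) * (3 * ((mean_sq l \<omega>)^2 + 2 * (b * b)))" by (simp add: algebra_simps)
  finally have "sq n (fluct n \<omega> l) \<le> 3 * ((mean_sq l \<omega>)^2 + 2 * (b * b))"
    using p_pos by simp
  also have "\<dots> \<le> 3 * ((mean_sq l \<omega>)^2 + 2 * (m * m))"
    using b0 bm by (intro mult_left_mono add_left_mono mult_mono) auto
  finally show ?thesis by (simp add: m_def power2_eq_square)
qed

lemma centred_outer_measurable:
  assumes "n \<ge> n0" "l < n" "i < p n" "j < p n"
  shows "(\<lambda>\<omega>. outer (zh n \<omega> l) (i, j)) \<in> borel_measurable (M n)"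
  unfolding outer_def using assms
  by (simp, intro borel_measurable_times mat_measurable_entry[OF Z_measurable], auto)

lemma outer_measurable:
  assumes "n \<ge> n0" "l < n" "i < p n" "j < p n"
  shows "(\<lambda>\<omega>. outer (z n l \<omega>) (i, j)) \<in> borel_measurable (M n)"
  unfolding outer_def using assms by (simp, intro borel_measurable_times obs_measurable, auto)

lemma fluct_power_null: "L1_null n0 M fluct_power"
proof (rule L1_null_dominated)
  have avg: "L1_bounded n0 M (\<lambda>n \<omega>. (\<Sum>l<n. (msq n l \<omega>)^2) / real n)"
  proof (rule L1_boundedI[where B = K])
    fix n assume n: "n \<ge> n0"
    have "integrable (M n) (\<lambda>\<omega>. \<Sum>l<n. (msq n l \<omega>)^2)"
      using mean_sq_sq_le(1)[OF n] by (intro Bochner_Integration.integrable_sum) auto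
    then show "integrable (M n) (\<lambda>\<omega>. (\<Sum>l<n. (msq n l \<omega>)^2) / real n)" by simp
    have "integral\<^sup>L (M n) (\<lambda>\<omega>. \<bar>(\<Sum>l<n. (msq n l \<omega>)^2) / real n\<bar>)
        = integral\<^sup>L (M n) (\<lambda>\<omega>. \<Sum>l<n. (msq n l \<omega>)^2) / real n"
      by (simp add: sum_nonneg)
    also have "\<dots> = (\<Sum>l<n. integral\<^sup>L (M n) (\<lambda>\<omega>. (msq n l \<omega>)^2)) / real n"
      using mean_sq_sq_le(1)[OF n] by (subst Bochner_Integration.integral_sum) auto
    also have "\<dots> \<le> (\<Sum>l<n. K) / real n"
      using mean_sq_sq_le(2)[OF n] by (intro divide_right_mono sum_mono) auto
    also have "\<dots> = K" using n_ge_2[OF n] by simp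
    finally show "integral\<^sup>L (M n) (\<lambda>\<omega>. \<bar>(\<Sum>l<n. (msq n l \<omega>)^2) / real n\<bar>) \<le> K" .
  qed
  show "L1_null n0 M (\<lambda>n \<omega>. 3 / real n * ((\<Sum>l<n. (msq n l \<omega>)^2) / real n + 2 * mean_pow n \<omega>))"
    by (intro L1_null_scale_bounded L1_bounded_add L1_bounded_cmult avg mean_obs_power_bounded inverse_n_null)
  show "fluct_power n \<in> borel_measurable (M n)" if "n \<ge> n0" for n
    unfolding fluct_power_def fluct_def using that
    by (intro borel_measurable_divide borel_measurable_sum entry_prod_measurable borel_measurable_diff
        centred_outer_measurable outer_measurable borel_measurable_const) auto
  fix n \<omega> assume n: "n \<ge> n0" and w: "\<omega> \<in> space (M n)"
  have "fluct_power n \<omega> \<le> (\<Sum>l<n. 3 * ((msq n l \<omega>)^2 + 2 * mean_pow n \<omega>)) / (real n)^2"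
    unfolding fluct_power_def using fluct_sq_le[OF n w] by (intro divide_right_mono sum_mono) auto
  also have "\<dots> = 3 / real n * ((\<Sum>l<n. (msq n l \<omega>)^2) / real n + 2 * mean_pow n \<omega>)"
    using n_ge_2[OF n]
    by (simp add: sum.distrib flip: sum_distrib_left) (simp add: field_simps power2_eq_square)
  finally show "\<bar>fluct_power n \<omega>\<bar> \<le> 3 / real n * ((\<Sum>l<n. (msq n l \<omega>)^2) / real n + 2 * mean_pow n \<omega>)"
    using fluct_power_nonneg by simp
qed

lemma centred_outer_eq: "outer (zh n \<omega> l) = (\<lambda>a. outer (z n l \<omega>) a + fluct n \<omega> l a)"
  by (auto simp: fluct_def)

text \<open>The inequality \<open>\<bar>\<parallel>f + g\<parallel>\<^sup>2 - \<parallel>f\<parallel>\<^sup>2\<bar> \<le> \<parallel>g\<parallel>\<^sup>2 + 2 \<parallel>f\<parallel> \<parallel>g\<parallel>\<close> in the direct sum over the sample.\<close>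
lemma obs_power_centred_diff:
  "\<bar>pow_cen n \<omega> - pow_obs n \<omega>\<bar>
   \<le> fluct_power n \<omega> + 2 * (sqrt (fluct_power n \<omega>) * sqrt (pow_obs n \<omega>))"
proof -
  let ?o = "\<lambda>l. sq n (outer (z n l \<omega>))" and ?f = "\<lambda>l. sq n (fluct n \<omega> l)"
  have "\<bar>(\<Sum>l<n. sq n (outer (zh n \<omega> l))) - (\<Sum>l<n. ?o l)\<bar>
      = \<bar>\<Sum>l<n. sq n (\<lambda>a. outer (z n l \<omega>) a + fluct n \<omega> l a) - ?o l\<bar>"
    by (simp only: centred_outer_eq sum_subtractf)
  moreover have "\<bar>\<Sum>l<n. sq n (\<lambda>a. outer (z n l \<omega>) a + fluct n \<omega> l a) - ?o l\<bar>
      \<le> (\<Sum>l<n. ?f l + 2 * (sqrt (?o l) * sqrt (?f l)))"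
    using entry_prod_add_sq_diff[of "p n" "outer (z n l \<omega>)" "fluct n \<omega> l" for l]
    by (intro order_trans[OF sum_abs sum_mono])
  moreover have "(\<Sum>l<n. ?f l + 2 * (sqrt (?o l) * sqrt (?f l)))
      = (\<Sum>l<n. ?f l) + 2 * (\<Sum>l<n. sqrt (?o l) * sqrt (?f l))"
    by (simp only: sum.distrib sum_distrib_left)
  moreover have "(\<Sum>l<n. sqrt (?o l) * sqrt (?f l)) \<le> sqrt ((\<Sum>l<n. ?o l) * (\<Sum>l<n. ?f l))"
    using Cauchy_Schwarz_ineq_sum[of "\<lambda>l. sqrt (?o l)" "\<lambda>l. sqrt (?f l)" "{..<n}"]
    by (intro real_le_rsqrt) (simp only: real_sqrt_pow2 entry_prod_nonneg)
  ultimately have *: "\<bar>(\<Sum>l<n. sq n (outer (zh n \<omega> l))) - (\<Sum>l<n. ?o l)\<bar>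
      \<le> (\<Sum>l<n. ?f l) + 2 * sqrt ((\<Sum>l<n. ?o l) * (\<Sum>l<n. ?f l))" by linarith
  have "\<bar>pow_cen n \<omega> - pow_obs n \<omega>\<bar>
      = \<bar>(\<Sum>l<n. sq n (outer (zh n \<omega> l))) - (\<Sum>l<n. ?o l)\<bar> / (real n)^2"
    by (simp add: obs_power_def abs_divide flip: diff_divide_distrib)
  also have "\<dots> \<le> ((\<Sum>l<n. ?f l) + 2 * sqrt ((\<Sum>l<n. ?o l) * (\<Sum>l<n. ?f l))) / (real n)^2"
    using * by (rule divide_right_mono) simp
  also have "\<dots> = fluct_power n \<omega> + 2 * (sqrt (fluct_power n \<omega>) * sqrt (pow_obs n \<omega>))"
    by (simp add: fluct_power_def obs_power_def add_divide_distrib real_sqrt_mult real_sqrt_divide power2_eq_square)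
  finally show ?thesis .
qed

lemma target_power_centred_le:
  assumes n: "n \<ge> n0"
  shows "tpow_cen n \<omega>
    \<le> 2 * tpow_obs n \<omega> + 2 * fluct_power n \<omega>"
proof -
  have "(\<Sum>k<N n. (entry_prod (p n) (outer (zh n \<omega> l)) (t n k))^2)
      \<le> 2 * (\<Sum>k<N n. (entry_prod (p n) (outer (z n l \<omega>)) (t n k))^2) + 2 * sq n (fluct n \<omega> l)" for l
  proof -
    have "(\<Sum>k<N n. (entry_prod (p n) (outer (zh n \<omega> l)) (t n k))^2)
        \<le> (\<Sum>k<N n. 2 * (entry_prod (p n) (outer (z n l \<omega>)) (t n k))^2
            + 2 * (entry_prod (p n) (fluct n \<omega> l) (t n k))^2)"
      unfolding centred_outer_eq entry_prod_add_left by (intro sum_mono sq_add_le)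
    also have "\<dots> = 2 * (\<Sum>k<N n. (entry_prod (p n) (outer (z n l \<omega>)) (t n k))^2)
        + 2 * (\<Sum>k<N n. (entry_prod (p n) (fluct n \<omega> l) (t n k))^2)"
      by (simp add: sum.distrib sum_distrib_left)
    also have "(\<Sum>k<N n. (entry_prod (p n) (fluct n \<omega> l) (t n k))^2) \<le> sq n (fluct n \<omega> l)"
      by (rule bessel[OF on_t[OF n]])
    finally show ?thesis by simp
  qed
  then have "(\<Sum>l<n. \<Sum>k<N n. (entry_prod (p n) (outer (zh n \<omega> l)) (t n k))^2)
      \<le> (\<Sum>l<n. 2 * (\<Sum>k<N n. (entry_prod (p n) (outer (z n l \<omega>)) (t n k))^2) + 2 * sq n (fluct n \<omega> l))"
    by (intro sum_mono)
  also have "\<dots> = 2 * (\<Sum>l<n. \<Sum>k<N n. (entry_prod (p n) (outer (z n l \<omega>)) (t n k))^2)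
      + 2 * (\<Sum>l<n. sq n (fluct n \<omega> l))"
    by (simp add: sum.distrib sum_distrib_left)
  finally have "(\<Sum>l<n. \<Sum>k<N n. (entry_prod (p n) (outer (zh n \<omega> l)) (t n k))^2) / (real n)^2
      \<le> (2 * (\<Sum>l<n. \<Sum>k<N n. (entry_prod (p n) (outer (z n l \<omega>)) (t n k))^2)
      + 2 * (\<Sum>l<n. sq n (fluct n \<omega> l))) / (real n)^2"
    by (rule divide_right_mono) simp
  then show ?thesis by (simp only: target_power_def fluct_power_def add_divide_distrib times_divide_eq_right)
qed

abbreviation "w n \<omega> \<equiv> (\<lambda>a. w0 n \<omega> a + err n \<omega> a)"

lemma w_entry_measurable:
  assumes "n \<ge> n0" "i < p n" "j < p n" shows "(\<lambda>\<omega>. w n \<omega> (i, j)) \<in> borel_measurable (M n)"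
  using assms by (intro borel_measurable_add mean_dev_measurable err_entry_measurable)

lemma w_norm_null: "L1_null n0 M (\<lambda>n \<omega>. sq n (w n \<omega>) - v n)"
proof (rule L1_null_dominated)
  show "L1_null n0 M (\<lambda>n \<omega>. sq n (err n \<omega>) + 2 * (sqrt (sq n (err n \<omega>)) * sqrt (sq n (w0 n \<omega>)))
      + \<bar>sq n (w0 n \<omega>) - v n\<bar>)"
    by (intro L1_null_add L1_null_cmult L1_null_geometric_mean L1_null_abs err_null w0_norm_bounded
        w0_norm_null conjI entry_prod_nonneg)
  show "(\<lambda>\<omega>. sq n (w n \<omega>) - v n) \<in> borel_measurable (M n)" if "n \<ge> n0" for n
    using that by (intro borel_measurable_diff borel_measurable_const entry_prod_measurable w_entry_measurable)
  show "\<bar>sq n (w n \<omega>) - v n\<bar> \<le> sq n (err n \<omega>) + 2 * (sqrt (sq n (err n \<omega>)) * sqrt (sq n (w0 n \<omega>)))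
      + \<bar>sq n (w0 n \<omega>) - v n\<bar>" for n \<omega>
    using entry_prod_add_sq_diff[of "p n" "w0 n \<omega>" "err n \<omega>"] by (simp add: mult.commute)
qed

lemma residual_sigma_le: "n \<ge> n0 \<Longrightarrow> sq n (rS n) \<le> K"
  using residual_le[OF on_t] sigma_le by (rule order_trans)

lemma w_residual_null: "L1_null n0 M (\<lambda>n \<omega>. entry_prod (p n) (w n \<omega>) (rS n))"
proof (rule L1_null_dominated)
  have rb: "L1_bounded n0 M (\<lambda>n \<omega>. sq n (rS n))"
    using residual_sigma_le entry_prod_nonneg by (intro L1_bounded_const[where B = K] prob) auto
  show "L1_null n0 M (\<lambda>n \<omega>. \<bar>entry_prod (p n) (w0 n \<omega>) (rS n)\<bar> + sqrt (sq n (err n \<omega>)) * sqrt (sq n (rS n)))"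
    by (intro L1_null_add L1_null_geometric_mean L1_null_abs err_null rb w0_inner_null residual_sigma_le
        conjI entry_prod_nonneg)
  show "(\<lambda>\<omega>. entry_prod (p n) (w n \<omega>) (rS n)) \<in> borel_measurable (M n)" if "n \<ge> n0" for n
    using that by (intro entry_prod_measurable w_entry_measurable borel_measurable_const)
  fix n \<omega>
  have "\<bar>entry_prod (p n) (err n \<omega>) (rS n)\<bar> \<le> sqrt (sq n (err n \<omega>)) * sqrt (sq n (rS n))"
    using real_sqrt_le_mono[OF entry_prod_Cauchy_Schwarz[of "p n" "err n \<omega>" "rS n"]] by (simp add: real_sqrt_mult)
  then show "\<bar>entry_prod (p n) (w n \<omega>) (rS n)\<bar>
      \<le> \<bar>entry_prod (p n) (w0 n \<omega>) (rS n)\<bar> + sqrt (sq n (err n \<omega>)) * sqrt (sq n (rS n))"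
    unfolding entry_prod_add_left by linarith
qed

lemma w_targets_null: "L1_null n0 M (\<lambda>n \<omega>. \<Sum>k<N n. (entry_prod (p n) (w n \<omega>) (t n k))^2)"
proof (rule L1_null_dominated)
  show "L1_null n0 M (\<lambda>n \<omega>. 2 * (\<Sum>k<N n. (entry_prod (p n) (w0 n \<omega>) (t n k))^2) + 2 * sq n (err n \<omega>))"
    by (intro L1_null_add L1_null_cmult w0_targets_null err_null)
  show "(\<lambda>\<omega>. \<Sum>k<N n. (entry_prod (p n) (w n \<omega>) (t n k))^2) \<in> borel_measurable (M n)" if "n \<ge> n0" for n
    using that by (intro borel_measurable_sum borel_measurable_power entry_prod_measurable w_entry_measurable borel_measurable_const)
  fix n \<omega> assume n: "n \<ge> n0"
  have "(\<Sum>k<N n. (entry_prod (p n) (w n \<omega>) (t n k))^2)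
      \<le> (\<Sum>k<N n. 2 * (entry_prod (p n) (w0 n \<omega>) (t n k))^2 + 2 * (entry_prod (p n) (err n \<omega>) (t n k))^2)"
    unfolding entry_prod_add_left by (intro sum_mono sq_add_le)
  also have "\<dots> = 2 * (\<Sum>k<N n. (entry_prod (p n) (w0 n \<omega>) (t n k))^2)
      + 2 * (\<Sum>k<N n. (entry_prod (p n) (err n \<omega>) (t n k))^2)"
    by (simp add: sum.distrib sum_distrib_left)
  also have "(\<Sum>k<N n. (entry_prod (p n) (err n \<omega>) (t n k))^2) \<le> sq n (err n \<omega>)"
    by (rule bessel[OF on_t[OF n]])
  finally show "\<bar>\<Sum>k<N n. (entry_prod (p n) (w n \<omega>) (t n k))^2\<bar>
      \<le> 2 * (\<Sum>k<N n. (entry_prod (p n) (w0 n \<omega>) (t n k))^2) + 2 * sq n (err n \<omega>)"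
    by (simp add: sum_nonneg)
qed

lemma S_norm_bounded: "L1_bounded n0 M (\<lambda>n \<omega>. sq n (($$) (S n \<omega>)))"
proof (rule L1_bounded_dominated)
  show "L1_bounded n0 M (\<lambda>n \<omega>. 2 * sq n (sg n) + 2 * ((sq n (w n \<omega>) - v n) + v n))"
    by (intro L1_bounded_add L1_bounded_cmult sigma_bounded L1_null_imp_bounded w_norm_null v_bounded)
  show "(\<lambda>\<omega>. sq n (($$) (S n \<omega>))) \<in> borel_measurable (M n)" if "n \<ge> n0" for n
    using that by (intro entry_prod_measurable mat_measurable_entry[OF S_measurable])
  fix n \<omega>
  have "($$) (S n \<omega>) = (\<lambda>a. sg n a + w n \<omega> a)" by (auto simp: err_def)
  then show "\<bar>sq n (($$) (S n \<omega>))\<bar> \<le> 2 * sq n (sg n) + 2 * ((sq n (w n \<omega>) - v n) + v n)"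
    using entry_prod_add_sq_le[of "p n" "sg n" "w n \<omega>"] by (simp add: entry_prod_nonneg)
qed

lemma obs_power_centred_measurable:
  "n \<ge> n0 \<Longrightarrow> (\<lambda>\<omega>. pow_cen n \<omega>) \<in> borel_measurable (M n)"
  unfolding obs_power_def
  by (intro borel_measurable_divide borel_measurable_sum entry_prod_measurable centred_outer_measurable
      borel_measurable_const) auto

lemma obs_power_obs_measurable:
  "n \<ge> n0 \<Longrightarrow> (\<lambda>\<omega>. pow_obs n \<omega>) \<in> borel_measurable (M n)"
  unfolding obs_power_def
  by (intro borel_measurable_divide borel_measurable_sum entry_prod_measurable outer_measurable
      borel_measurable_const) auto

lemma obs_power_centred_null:
  "L1_null n0 M (\<lambda>n \<omega>. pow_cen n \<omega> - pow_obs n \<omega>)"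
proof (rule L1_null_dominated)
  show "L1_null n0 M (\<lambda>n \<omega>. fluct_power n \<omega>
      + 2 * (sqrt (fluct_power n \<omega>) * sqrt (pow_obs n \<omega>)))"
    by (intro L1_null_add L1_null_cmult L1_null_geometric_mean fluct_power_null obs_power_bounded conjI
        fluct_power_nonneg obs_power_nonneg)
  show "(\<lambda>\<omega>. pow_cen n \<omega> - pow_obs n \<omega>) \<in> borel_measurable (M n)"
    if "n \<ge> n0" for n
    using that by (intro borel_measurable_diff obs_power_centred_measurable obs_power_obs_measurable)
qed (rule obs_power_centred_diff)

lemma var_est_null: "L1_null n0 M (\<lambda>n \<omega>. var_est s (p n) n (Z n \<omega>) - v n)"
proof (rule L1_null_dominated)
  have "L1_bounded n0 M (\<lambda>n \<omega>. (pow_cen n \<omega> - pow_obs n \<omega>)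
      + pow_obs n \<omega>)"
    by (intro L1_bounded_add L1_null_imp_bounded obs_power_centred_null obs_power_bounded)
  then have b: "L1_bounded n0 M (\<lambda>n \<omega>. pow_cen n \<omega>)" by simp
  show "L1_null n0 M (\<lambda>n \<omega>. 40 / real n * (pow_cen n \<omega> + (1 + K) * sq n (($$) (S n \<omega>)))
      + \<bar>pow_cen n \<omega> - pow_obs n \<omega>\<bar>
      + \<bar>pow_obs n \<omega> - v n\<bar>)"
    by (intro L1_null_add L1_null_abs obs_power_centred_null obs_power_null L1_null_scale_bounded
        L1_bounded_add L1_bounded_cmult b S_norm_bounded inverse_n_null)
  show "(\<lambda>\<omega>. var_est s (p n) n (Z n \<omega>) - v n) \<in> borel_measurable (M n)" if "n \<ge> n0" for n
    using that by (intro borel_measurable_diff borel_measurable_const var_est_measurable[OF Z_measurable targets])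
  fix n \<omega> assume n: "n \<ge> n0" and w: "\<omega> \<in> space (M n)"
  have pn: "real (p n) / real n \<le> K" using p_le[OF n] n_ge_2[OF n] by (simp add: divide_le_eq)
  have "\<bar>var_est s (p n) n (Z n \<omega>) - pow_cen n \<omega>\<bar>
      \<le> 40 / real n * (pow_cen n \<omega> + (1 + real (p n) / real n) * sq n (($$) (S n \<omega>)))"
    by (rule var_est_bound[OF Z_carrier[OF n w] p_ge_1[OF n] n])
  also have "\<dots> \<le> 40 / real n * (pow_cen n \<omega> + (1 + K) * sq n (($$) (S n \<omega>)))"
    using pn by (intro mult_left_mono add_left_mono mult_right_mono entry_prod_nonneg) auto
  finally show "\<bar>var_est s (p n) n (Z n \<omega>) - v n\<bar>
      \<le> 40 / real n * (pow_cen n \<omega> + (1 + K) * sq n (($$) (S n \<omega>)))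
      + \<bar>pow_cen n \<omega> - pow_obs n \<omega>\<bar>
      + \<bar>pow_obs n \<omega> - v n\<bar>" by linarith
qed

lemma var_est_target_null: "L1_null n0 M (\<lambda>n \<omega>. \<Sum>k<N n. var_est_target s (p n) n (Z n \<omega>) (T n k))"
proof (rule L1_null_dominated)
  have c: "(\<lambda>n. 12 / real n * (1 + real (N n) / real n)) \<longlonglongrightarrow> 0"
  proof -
    have "(\<lambda>n. 12 / real n * (1 + real (N n) / real n)) \<longlonglongrightarrow> 0 * (1 + 0)"
      by (intro tendsto_mult tendsto_add tendsto_const N_le inverse_n_null)
    then show ?thesis by simp
  qed
  show "L1_null n0 M (\<lambda>n \<omega>. 8 * (2 * tpow_obs n \<omega> + 2 * fluct_power n \<omega>)
      + 12 / real n * (1 + real (N n) / real n) * sq n (($$) (S n \<omega>)))"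
    by (intro L1_null_add L1_null_cmult target_power_null fluct_power_null L1_null_scale_bounded S_norm_bounded c)
  show "(\<lambda>\<omega>. \<Sum>k<N n. var_est_target s (p n) n (Z n \<omega>) (T n k)) \<in> borel_measurable (M n)" if "n \<ge> n0" for n
    using that by (intro borel_measurable_sum var_est_target_measurable[OF Z_measurable targets]) auto
  fix n \<omega> assume n: "n \<ge> n0" and w: "\<omega> \<in> space (M n)"
  show "\<bar>\<Sum>k<N n. var_est_target s (p n) n (Z n \<omega>) (T n k)\<bar>
      \<le> 8 * (2 * tpow_obs n \<omega> + 2 * fluct_power n \<omega>)
      + 12 / real n * (1 + real (N n) / real n) * sq n (($$) (S n \<omega>))"
    by (rule order_trans[OF var_est_target_bound[OF Z_carrier[OF n w] p_ge_1[OF n] n targets[OF n]]])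
       (intro add_right_mono mult_left_mono target_power_centred_le[OF n], simp)
qed

abbreviation "Sig n \<equiv> cov_mat (M n) (p n) (X n)"
abbreviation "S_star n \<omega> \<equiv> bona_fide_est s (p n) n (N n) (T n) (Z n \<omega>)"
abbreviation "Sigma_star n \<omega> \<equiv> oracle_est (p n) (N n) (T n) (Sig n) (S n \<omega>)"

lemma Sigma_carrier: "Sig n \<in> carrier_mat (p n) (p n)"
  by (simp add: cov_mat_def)

lemma Sigma_entry: "n \<ge> n0 \<Longrightarrow> i < p n \<Longrightarrow> j < p n \<Longrightarrow> Sig n $$ (i, j) = sg n (i, j)"
  by (rule iid_sample.cov_mat_entry[OF samp])

lemma S_star_measurable: "n \<ge> n0 \<Longrightarrow> mat_measurable (M n) (p n) (p n) (S_star n)"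
  by (rule bona_fide_measurable[OF Z_measurable targets])

lemma Sigma_star_measurable: "n \<ge> n0 \<Longrightarrow> mat_measurable (M n) (p n) (p n) (Sigma_star n)"
  by (rule oracle_measurable[OF Z_measurable targets Sigma_carrier])

lemma norm_mat_sq_diff:
  assumes "A \<in> carrier_mat q q" "B \<in> carrier_mat q q"
  shows "(norm_mat q (A - B))^2 = entry_prod q (\<lambda>a. A $$ a - B $$ a) (\<lambda>a. A $$ a - B $$ a)"
proof -
  have "(norm_mat q (A - B))^2 = entry_prod q (($$) (A - B)) (($$) (A - B))"
    using assms by (intro norm_mat_sq minus_carrier_mat)
  also have "\<dots> = entry_prod q (\<lambda>a. A $$ a - B $$ a) (\<lambda>a. A $$ a - B $$ a)"
    using assms by (intro entry_prod_cong) auto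
  finally show ?thesis .
qed

text \<open>The five terms of the deterministic bound vanish in mean.\<close>
theorem estimator_distance_null:
  "L1_null n0 M (\<lambda>n \<omega>. (norm_mat (p n) (S_star n \<omega> - Sigma_star n \<omega>))^2)"
proof (rule L1_null_dominated)
  show "L1_null n0 M (\<lambda>n \<omega>. 3 * \<bar>var_est s (p n) n (Z n \<omega>) - v n\<bar>
      + 3 * \<bar>\<Sum>k<N n. var_est_target s (p n) n (Z n \<omega>) (T n k)\<bar>
      + 9 * \<bar>sq n (w n \<omega>) - v n\<bar> + 21 * \<bar>entry_prod (p n) (w n \<omega>) (rS n)\<bar>
      + 10 * (\<Sum>k<N n. (entry_prod (p n) (w n \<omega>) (t n k))^2))"
    by (intro L1_null_add L1_null_cmult L1_null_abs var_est_null var_est_target_null w_norm_null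
        w_residual_null w_targets_null)
  show "(\<lambda>\<omega>. (norm_mat (p n) (S_star n \<omega> - Sigma_star n \<omega>))^2) \<in> borel_measurable (M n)" if "n \<ge> n0" for n
    using that
    by (intro borel_measurable_power norm_mat_measurable mat_measurable_minus S_star_measurable Sigma_star_measurable)
  fix n \<omega> assume n: "n \<ge> n0" and om: "\<omega> \<in> space (M n)"
  have w_eq: "S n \<omega> $$ (i, j) - Sig n $$ (i, j) = w n \<omega> (i, j)" if "i < p n" "j < p n" for i j
    using Sigma_entry[OF n that] by (simp add: err_def)
  have inner_eq: "entry_prod (p n) (\<lambda>a. S n \<omega> $$ a - Sig n $$ a) f = entry_prod (p n) (w n \<omega>) f" for f
    by (intro entry_prod_cong w_eq refl)
  have norm_eq: "sq n (\<lambda>a. S n \<omega> $$ a - Sig n $$ a) = sq n (w n \<omega>)"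
    by (intro entry_prod_cong w_eq)
  have "entry_prod (p n) (($$) (Sig n)) (t n k) = entry_prod (p n) (sg n) (t n k)" for k
    by (intro entry_prod_cong Sigma_entry[OF n] refl)
  then have res_eq: "entry_prod (p n) (w n \<omega>) (residual (p n) (N n) (t n) (($$) (Sig n)))
      = entry_prod (p n) (w n \<omega>) (rS n)"
    by (intro entry_prod_cong) (simp_all add: residual_def Sigma_entry[OF n])
  have "(norm_mat (p n) (S_star n \<omega> - Sigma_star n \<omega>))^2
      = entry_prod (p n) (\<lambda>a. S_star n \<omega> $$ a - Sigma_star n \<omega> $$ a) (\<lambda>a. S_star n \<omega> $$ a - Sigma_star n \<omega> $$ a)"
    by (intro norm_mat_sq_diff mat_measurable_carrier[OF S_star_measurable[OF n] om]
        mat_measurable_carrier[OF Sigma_star_measurable[OF n] om])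
  also have "\<dots> \<le> 3 * \<bar>var_est s (p n) n (Z n \<omega>) - v n\<bar>
      + 3 * \<bar>\<Sum>k<N n. var_est_target s (p n) n (Z n \<omega>) (T n k)\<bar>
      + 9 * \<bar>sq n (w n \<omega>) - v n\<bar> + 21 * \<bar>entry_prod (p n) (w n \<omega>) (rS n)\<bar>
      + 10 * (\<Sum>k<N n. (entry_prod (p n) (w n \<omega>) (t n k))^2)"
    using estimator_distance_le[OF targets[OF n] Sigma_carrier S_carrier[OF n om] refl v_bounds(1)[OF n]]
    unfolding norm_eq unfolding inner_eq res_eq .
  finally show "\<bar>(norm_mat (p n) (S_star n \<omega> - Sigma_star n \<omega>))^2\<bar> \<le> 3 * \<bar>var_est s (p n) n (Z n \<omega>) - v n\<bar>
      + 3 * \<bar>\<Sum>k<N n. var_est_target s (p n) n (Z n \<omega>) (T n k)\<bar>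
      + 9 * \<bar>sq n (w n \<omega>) - v n\<bar> + 21 * \<bar>entry_prod (p n) (w n \<omega>) (rS n)\<bar>
      + 10 * (\<Sum>k<N n. (entry_prod (p n) (w n \<omega>) (t n k))^2)" by simp
qed

text \<open>The oracle is bounded, so convergence in quadratic mean gives convergence of the losses.\<close>
theorem loss_difference_null:
  "L1_null n0 M (\<lambda>n \<omega>. \<bar>(norm_mat (p n) (S_star n \<omega> - Sig n))^2 - (norm_mat (p n) (Sigma_star n \<omega> - Sig n))^2\<bar>)"
proof (rule L1_null_dominated)
  let ?d = "\<lambda>n \<omega>. (norm_mat (p n) (S_star n \<omega> - Sigma_star n \<omega>))^2"
  have Kb: "L1_bounded n0 M (\<lambda>n \<omega>. 4 * K)" by (rule L1_bounded_const[OF prob order_refl])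
  show "L1_null n0 M (\<lambda>n \<omega>. ?d n \<omega> + 2 * (sqrt (?d n \<omega>) * sqrt (4 * K)))"
    using K_ge_1
    by (intro L1_null_add L1_null_cmult L1_null_geometric_mean[OF _ Kb] estimator_distance_null) auto
  show "(\<lambda>\<omega>. \<bar>(norm_mat (p n) (S_star n \<omega> - Sig n))^2 - (norm_mat (p n) (Sigma_star n \<omega> - Sig n))^2\<bar>)
      \<in> borel_measurable (M n)" if "n \<ge> n0" for n
    using that
    by (intro borel_measurable_abs borel_measurable_diff borel_measurable_power norm_mat_measurable
        mat_measurable_minus S_star_measurable Sigma_star_measurable mat_measurable_const Sigma_carrier)
  fix n \<omega> assume n: "n \<ge> n0" and om: "\<omega> \<in> space (M n)"
  note A = mat_measurable_carrier[OF S_star_measurable[OF n] om]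
    and B = mat_measurable_carrier[OF Sigma_star_measurable[OF n] om]
  let ?f = "\<lambda>a. Sigma_star n \<omega> $$ a - Sig n $$ a" and ?g = "\<lambda>a. S_star n \<omega> $$ a - Sigma_star n \<omega> $$ a"
  have g: "?d n \<omega> = sq n ?g" by (rule norm_mat_sq_diff[OF A B])
  have Sigma_sq: "sq n (($$) (Sig n)) \<le> K"
  proof -
    have "sq n (($$) (Sig n)) = sq n (sg n)" by (intro entry_prod_cong Sigma_entry[OF n])
    then show ?thesis using sigma_le[OF n] by simp
  qed
  have f: "sq n ?f \<le> 4 * K"
  proof -
    have "sq n (($$) (Sigma_star n \<omega>)) \<le> K"
      using oracle_norm_le[OF targets[OF n] Sigma_carrier S_carrier[OF n om]] Sigma_sq by (rule order_trans)
    moreover have "sq n ?f \<le> 2 * sq n (($$) (Sigma_star n \<omega>)) + 2 * sq n (($$) (Sig n))"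
      using entry_prod_add_sq_le[of "p n" "($$) (Sigma_star n \<omega>)" "\<lambda>a. - 1 * Sig n $$ a"]
      by (simp only: entry_prod_scale_left entry_prod_scale_right) simp
    ultimately show ?thesis using Sigma_sq by linarith
  qed
  have "(norm_mat (p n) (S_star n \<omega> - Sig n))^2 = sq n (\<lambda>a. ?f a + ?g a)"
    unfolding norm_mat_sq_diff[OF A Sigma_carrier] by (intro entry_prod_cong) auto
  then have "\<bar>(norm_mat (p n) (S_star n \<omega> - Sig n))^2 - (norm_mat (p n) (Sigma_star n \<omega> - Sig n))^2\<bar>
      \<le> sq n ?g + 2 * (sqrt (sq n ?f) * sqrt (sq n ?g))"
    unfolding norm_mat_sq_diff[OF B Sigma_carrier] using entry_prod_add_sq_diff[of "p n" ?f ?g] by simp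
  also have "\<dots> \<le> sq n ?g + 2 * (sqrt (4 * K) * sqrt (sq n ?g))"
    using f by (intro add_left_mono mult_left_mono mult_right_mono real_sqrt_le_mono) (auto simp: entry_prod_nonneg)
  finally show "\<bar>\<bar>(norm_mat (p n) (S_star n \<omega> - Sig n))^2 - (norm_mat (p n) (Sigma_star n \<omega> - Sig n))^2\<bar>\<bar>
      \<le> ?d n \<omega> + 2 * (sqrt (?d n \<omega>) * sqrt (4 * K))"
    unfolding g by (simp only: abs_abs mult.commute[of "sqrt (sq n ?g)"])
qed

end

section \<open>Moment bounds from the coordinates in an orthonormal basis\<close>

lemma (in prob_space) expectation_Cauchy_Schwarz:
  assumes f: "Lp_fun M 2 f" and g: "Lp_fun M 2 g"
  shows "(expectation (\<lambda>\<omega>. f \<omega> * g \<omega>))^2 \<le> expectation (\<lambda>\<omega>. (f \<omega>)^2) * expectation (\<lambda>\<omega>. (g \<omega>)^2)"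
proof -
  define A B C where "A = expectation (\<lambda>\<omega>. (f \<omega>)^2)" "B = expectation (\<lambda>\<omega>. (g \<omega>)^2)"
    "C = expectation (\<lambda>\<omega>. f \<omega> * g \<omega>)"
  have i: "integrable M (\<lambda>\<omega>. (f \<omega>)^2)" "integrable M (\<lambda>\<omega>. (g \<omega>)^2)" "integrable M (\<lambda>\<omega>. f \<omega> * g \<omega>)"
    using Lp_fun_mult_2[OF f f] Lp_fun_mult_2[OF g g] Lp_fun_mult_2[OF f g] by (simp_all add: power2_eq_square)
  have q: "0 \<le> A - 2 * t * C + t^2 * B" for t
  proof -
    have "0 \<le> expectation (\<lambda>\<omega>. (f \<omega> - t * g \<omega>)^2)" by (intro Bochner_Integration.integral_nonneg) auto
    also have "\<dots> = expectation (\<lambda>\<omega>. (f \<omega>)^2 - 2 * t * (f \<omega> * g \<omega>) + t^2 * (g \<omega>)^2)"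
      by (intro Bochner_Integration.integral_cong) (auto simp: power2_eq_square algebra_simps)
    also have "\<dots> = A - 2 * t * C + t^2 * B" using i by (simp add: A_B_C_def)
    finally show ?thesis .
  qed
  have B0: "0 \<le> B" by (auto simp: A_B_C_def intro: Bochner_Integration.integral_nonneg)
  have "C^2 \<le> A * B"
  proof (cases "B = 0")
    case True
    have "C = 0"
    proof (rule ccontr)
      assume "C \<noteq> 0"
      then show False using q[of "(A + 1) / (2 * C)"] True by simp
    qed
    then show ?thesis using True by simp
  next
    case False
    then have "0 < B" using B0 by simp
    then show ?thesis using q[of "C / B"] by (simp add: field_simps power2_eq_square)
  qed
  then show ?thesis by (simp add: A_B_C_def)
qed

lemma (in prob_space) square_expectation_le:
  assumes f: "Lp_fun M 2 f" shows "(expectation f)^2 \<le> expectation (\<lambda>\<omega>. (f \<omega>)^2)"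
  using expectation_Cauchy_Schwarz[OF f Lp_fun_const[of 2 1]] by (simp add: prob_space)

lemma orthogonal_sum_sq:
  fixes H :: "'b \<Rightarrow> 'b \<Rightarrow> real"
  assumes I: "finite I" and H: "\<And>b c. b \<in> I \<Longrightarrow> c \<in> I \<Longrightarrow> (\<Sum>a\<in>I. H a b * H a c) = (if b = c then 1 else 0)"
  shows "(\<Sum>a\<in>I. (\<Sum>b\<in>I. H a b * f b)^2) = (\<Sum>b\<in>I. (f b)^2)"
proof -
  have "(\<Sum>a\<in>I. (\<Sum>b\<in>I. H a b * f b)^2) = (\<Sum>a\<in>I. \<Sum>b\<in>I. \<Sum>c\<in>I. (f b * f c) * (H a b * H a c))"
    unfolding power2_eq_square sum_product by (intro sum.cong refl) (simp add: mult_ac)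
  also have "\<dots> = (\<Sum>b\<in>I. \<Sum>a\<in>I. \<Sum>c\<in>I. (f b * f c) * (H a b * H a c))" by (rule sum.swap)
  also have "\<dots> = (\<Sum>b\<in>I. \<Sum>c\<in>I. (f b * f c) * (\<Sum>a\<in>I. H a b * H a c))"
    unfolding sum_distrib_left by (intro sum.cong refl sum.swap)
  also have "\<dots> = (\<Sum>b\<in>I. \<Sum>c\<in>I. if b = c then f b * f c else 0)"
    using H by (intro sum.cong refl) auto
  also have "\<dots> = (\<Sum>b\<in>I. (f b)^2)" using I by (simp add: power2_eq_square)
  finally show ?thesis .
qed

lemma rotation_entries:
  assumes "rotation_mat p G" "j < p" "l < p"
  shows "(\<Sum>i<p. G $$ (j, i) * G $$ (l, i)) = (if j = l then 1 else 0)"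
proof -
  have G: "G \<in> carrier_mat p p" "transpose_mat G * G = 1\<^sub>m p" using assms by (auto simp: rotation_mat_def)
  have "G * transpose_mat G = 1\<^sub>m p"
    using mat_mult_left_right_inverse[OF transpose_carrier_mat[THEN iffD2, OF G(1)] G(1) G(2)] .
  then have "(G * transpose_mat G) $$ (j, l) = (if j = l then 1 else 0)" using assms by simp
  moreover have "(G * transpose_mat G) $$ (j, l) = (\<Sum>i<p. G $$ (j, i) * G $$ (l, i))"
    using G(1) assms by (auto simp: scalar_prod_def lessThan_atLeast0)
  ultimately show ?thesis by simp
qed

lemma y_coord_sum:
  assumes "G \<in> carrier_mat p p" "X \<omega> \<in> carrier_mat p n" "1 \<le> n" "i < p"
  shows "y_coord G X i \<omega> = (\<Sum>j<p. G $$ (j, i) * X \<omega> $$ (j, 0))"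
  using assms by (auto simp: y_coord_def scalar_prod_def lessThan_atLeast0)

text \<open>Integrability of eighth powers alone does not make the coordinates measurable; that comes from the
  measurability of the columns, and the original coordinates are linear combinations of the rotated ones.\<close>
lemma rotated_coordinates_L8:
  assumes "prob_space M" and iid: "iid_columns M X p n" and n: "1 \<le> n"
    and X: "\<And>\<omega>. \<omega> \<in> space M \<Longrightarrow> X \<omega> \<in> carrier_mat p n"
    and G: "rotation_mat p G"
    and y8: "\<And>i. i < p \<Longrightarrow> integrable M (\<lambda>\<omega>. (y_coord G X i \<omega>)^8)"
  shows "\<And>i. i < p \<Longrightarrow> Lp_fun M 8 (y_coord G X i)" "\<And>j. j < p \<Longrightarrow> Lp_fun M 8 (\<lambda>\<omega>. X \<omega> $$ (j, 0))"
proof -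
  interpret prob_space M by fact
  have Gc: "G \<in> carrier_mat p p" using G by (simp add: rotation_mat_def)
  have colm: "col_rv X p 0 \<in> measurable M (PiM {..<p} (\<lambda>_. borel))"
    using iid n unfolding iid_columns_def indep_vars_def by auto
  have "(\<lambda>\<omega>. col_rv X p 0 \<omega> j) \<in> borel_measurable M" if "j < p" for j
    by (rule measurable_compose[OF colm measurable_component_singleton]) (use that in simp)
  then have Xm: "(\<lambda>\<omega>. X \<omega> $$ (j, 0)) \<in> borel_measurable M" if "j < p" for j
    using that by (simp add: col_rv_def)
  show L: "Lp_fun M 8 (y_coord G X i)" if i: "i < p" for i
  proof -
    have "y_coord G X i \<in> borel_measurable M \<longleftrightarrow> (\<lambda>\<omega>. \<Sum>j<p. G $$ (j, i) * X \<omega> $$ (j, 0)) \<in> borel_measurable M"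
      using y_coord_sum[where X = X, OF Gc X n i] by (intro measurable_cong)
    also have "\<dots>" by (intro borel_measurable_sum borel_measurable_times Xm borel_measurable_const) simp
    finally show ?thesis using y8[OF i] by (simp add: Lp_fun_def)
  qed
  show "Lp_fun M 8 (\<lambda>\<omega>. X \<omega> $$ (j, 0))" if j: "j < p" for j
  proof -
    have "Lp_fun M 8 (\<lambda>\<omega>. \<Sum>i<p. G $$ (j, i) * y_coord G X i \<omega>)"
      by (intro Lp_fun_sum Lp_fun_cmult L) simp
    moreover have "(\<Sum>i<p. G $$ (j, i) * y_coord G X i \<omega>) = X \<omega> $$ (j, 0)" if w: "\<omega> \<in> space M" for \<omega>
    proof -
      have "(\<Sum>i<p. G $$ (j, i) * y_coord G X i \<omega>) = (\<Sum>i<p. \<Sum>l<p. X \<omega> $$ (l, 0) * (G $$ (j, i) * G $$ (l, i)))"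
        using y_coord_sum[where X = X, OF Gc X[OF w] n] by (simp add: sum_distrib_left mult_ac)
      also have "\<dots> = (\<Sum>l<p. X \<omega> $$ (l, 0) * (\<Sum>i<p. G $$ (j, i) * G $$ (l, i)))"
        unfolding sum_distrib_left by (rule sum.swap)
      also have "\<dots> = (\<Sum>l<p. if j = l then X \<omega> $$ (l, 0) else 0)"
        using rotation_entries[OF G j] by (intro sum.cong) auto
      also have "\<dots> = X \<omega> $$ (j, 0)" using j by simp
      finally show ?thesis .
    qed
    ultimately have "integrable M (\<lambda>\<omega>. \<bar>X \<omega> $$ (j, 0)\<bar> ^ 8)"
      unfolding Lp_fun_def by (simp cong: Bochner_Integration.integrable_cong)
    then show ?thesis using Xm[OF j] by (simp add: Lp_fun_def)
  qed
qed

text \<open>Quadruples with a repeated index are too few to matter, but the hypothesis on the covariances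
  does not control them; each of the six possible coincidences is bounded by fourth moments.\<close>
lemma sum_over_quadruples_bound:
  fixes D :: "nat \<Rightarrow> nat \<Rightarrow> nat \<Rightarrow> nat \<Rightarrow> real"
  assumes D0: "\<And>i j k l. i < p \<Longrightarrow> j < p \<Longrightarrow> k < p \<Longrightarrow> l < p \<Longrightarrow> 0 \<le> D i j k l \<and> D i j k l \<le> m i j * m k l"
    and m: "\<And>i j. 0 \<le> m i j" "\<And>i j. m i j = m j i"
    and diag: "(\<Sum>i<p. m i i) * (\<Sum>i<p. \<Sum>j<p. m i j) \<le> B" and rows: "(\<Sum>i<p. (\<Sum>j<p. m i j)^2) \<le> B"
  shows "(\<Sum>i<p. \<Sum>j<p. \<Sum>k<p. \<Sum>l<p. D i j k l)
    \<le> (\<Sum>(i, j, k, l)\<in>quadruples p. D i j k l) + 6 * B"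
proof -
  let ?d = "\<lambda>i j k l. if distinct [i, j, k, l] then D i j k l else 0"
  let ?e = "\<lambda>b i j k l. if b then m i j * m k l else 0"
  have split: "D i j k l \<le> ?d i j k l + (?e (i = j) i j k l + ?e (k = l) i j k l + ?e (i = k) i j k l
      + ?e (i = l) i j k l + ?e (j = k) i j k l + ?e (j = l) i j k l)"
    if "i < p" "j < p" "k < p" "l < p" for i j k l
  proof -
    have P: "0 \<le> m i j * m k l" using m(1)[of i j] m(1)[of k l] by simp
    have e0: "0 \<le> ?e b i j k l" for b using P by simp
    have d0: "0 \<le> ?d i j k l" using D0[OF that] by simp
    have sum6: "z \<le> d + (a1 + a2 + a3 + a4 + a5 + a6)"
      if "0 \<le> d" "0 \<le> a1" "0 \<le> a2" "0 \<le> a3" "0 \<le> a4" "0 \<le> a5" "0 \<le> a6"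
        "z \<le> d \<or> z \<le> a1 \<or> z \<le> a2 \<or> z \<le> a3 \<or> z \<le> a4 \<or> z \<le> a5 \<or> z \<le> a6"
      for z d a1 a2 a3 a4 a5 a6 :: real using that by linarith
    show ?thesis
    proof (rule sum6[OF d0 e0 e0 e0 e0 e0 e0])
      consider "distinct [i, j, k, l]" | "i = j" | "k = l" | "i = k" | "i = l" | "j = k" | "j = l" by auto
      then show "D i j k l \<le> ?d i j k l \<or> D i j k l \<le> ?e (i = j) i j k l \<or> D i j k l \<le> ?e (k = l) i j k l
          \<or> D i j k l \<le> ?e (i = k) i j k l \<or> D i j k l \<le> ?e (i = l) i j k l
          \<or> D i j k l \<le> ?e (j = k) i j k l \<or> D i j k l \<le> ?e (j = l) i j k l"
        by cases (use D0[OF that] in simp_all)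
    qed
  qed
  have quad: "(\<Sum>i<p. \<Sum>j<p. \<Sum>k<p. \<Sum>l<p. ?d i j k l) = (\<Sum>(i, j, k, l)\<in>quadruples p. D i j k l)"
  proof -
    have fin: "finite ({..<p} \<times> {..<p} \<times> {..<p} \<times> {..<p})" by simp
    have "quadruples p = {q \<in> {..<p} \<times> {..<p} \<times> {..<p} \<times> {..<p}. case q of (i, j, k, l) \<Rightarrow> distinct [i, j, k, l]}"
      by (auto simp: quadruples_def)
    then have "(\<Sum>(i, j, k, l)\<in>quadruples p. D i j k l)
        = (\<Sum>q\<in>{..<p} \<times> {..<p} \<times> {..<p} \<times> {..<p}. if (case q of (i, j, k, l) \<Rightarrow> distinct [i, j, k, l])
            then (case q of (i, j, k, l) \<Rightarrow> D i j k l) else 0)"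
      using sum.inter_filter[OF fin] by simp
    also have "\<dots> = (\<Sum>i<p. \<Sum>j<p. \<Sum>k<p. \<Sum>l<p. ?d i j k l)"
      by (simp only: sum.cartesian_product' prod.case)
    finally show ?thesis by simp
  qed
  have row: "(\<Sum>i<p. \<Sum>j<p. \<Sum>l<p. m i j * m i l) \<le> B"
    using rows by (simp add: power2_eq_square sum_product)
  have e1: "(\<Sum>i<p. \<Sum>j<p. \<Sum>k<p. \<Sum>l<p. ?e (i = j) i j k l) \<le> B"
  proof -
    have "(\<Sum>i<p. \<Sum>j<p. \<Sum>k<p. \<Sum>l<p. ?e (i = j) i j k l) = (\<Sum>i<p. \<Sum>j<p. if i = j then m i j * (\<Sum>k<p. \<Sum>l<p. m k l) else 0)"
      by (intro sum.cong refl) (simp add: sum_distrib_left)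
    then show ?thesis using diag by (simp add: sum_distrib_right)
  qed
  have e2: "(\<Sum>i<p. \<Sum>j<p. \<Sum>k<p. \<Sum>l<p. ?e (k = l) i j k l) \<le> B"
  proof -
    have "(\<Sum>i<p. \<Sum>j<p. \<Sum>k<p. \<Sum>l<p. ?e (k = l) i j k l) = (\<Sum>i<p. \<Sum>j<p. \<Sum>k<p. m i j * m k k)"
      by (intro sum.cong refl) simp
    also have "\<dots> = (\<Sum>i<p. \<Sum>j<p. m i j) * (\<Sum>k<p. m k k)"
      unfolding sum_distrib_right unfolding sum_distrib_left ..
    finally show ?thesis using diag by (simp add: mult.commute)
  qed
  have e3: "(\<Sum>i<p. \<Sum>j<p. \<Sum>k<p. \<Sum>l<p. ?e (i = k) i j k l) \<le> B"
  proof -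
    have "(\<Sum>k<p. \<Sum>l<p. ?e (i = k) i j k l) = (\<Sum>l<p. m i j * m i l)" if "i < p" for i j
      using that by (subst sum.swap) simp
    then show ?thesis using row by simp
  qed
  have e4: "(\<Sum>i<p. \<Sum>j<p. \<Sum>k<p. \<Sum>l<p. ?e (i = l) i j k l) \<le> B"
  proof -
    have "(\<Sum>k<p. \<Sum>l<p. ?e (i = l) i j k l) = (\<Sum>k<p. m i j * m i k)" if "i < p" for i j
      using that m(2)[of _ i] by simp
    then show ?thesis using row by simp
  qed
  have e5: "(\<Sum>i<p. \<Sum>j<p. \<Sum>k<p. \<Sum>l<p. ?e (j = k) i j k l) \<le> B"
  proof -
    have "(\<Sum>k<p. \<Sum>l<p. ?e (j = k) i j k l) = (\<Sum>l<p. m j i * m j l)" if "j < p" for i j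
      using that m(2)[of i j] by (subst sum.swap) simp
    then have "(\<Sum>i<p. \<Sum>j<p. \<Sum>k<p. \<Sum>l<p. ?e (j = k) i j k l) = (\<Sum>i<p. \<Sum>j<p. \<Sum>l<p. m j i * m j l)" by simp
    also have "\<dots> = (\<Sum>j<p. \<Sum>i<p. \<Sum>l<p. m j i * m j l)" by (rule sum.swap)
    finally show ?thesis using row by simp
  qed
  have e6: "(\<Sum>i<p. \<Sum>j<p. \<Sum>k<p. \<Sum>l<p. ?e (j = l) i j k l) \<le> B"
  proof -
    have "(\<Sum>k<p. \<Sum>l<p. ?e (j = l) i j k l) = (\<Sum>k<p. m j i * m j k)" if "j < p" for i j
      using that m(2)[of i j] m(2)[of _ j] by simp
    then have "(\<Sum>i<p. \<Sum>j<p. \<Sum>k<p. \<Sum>l<p. ?e (j = l) i j k l) = (\<Sum>i<p. \<Sum>j<p. \<Sum>k<p. m j i * m j k)" by simp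
    also have "\<dots> = (\<Sum>j<p. \<Sum>i<p. \<Sum>k<p. m j i * m j k)" by (rule sum.swap)
    finally show ?thesis using row by simp
  qed
  have "(\<Sum>i<p. \<Sum>j<p. \<Sum>k<p. \<Sum>l<p. D i j k l)
      \<le> (\<Sum>i<p. \<Sum>j<p. \<Sum>k<p. \<Sum>l<p. ?d i j k l + (?e (i = j) i j k l + ?e (k = l) i j k l + ?e (i = k) i j k l
        + ?e (i = l) i j k l + ?e (j = k) i j k l + ?e (j = l) i j k l))"
    by (intro sum_mono split) auto
  also have "\<dots> \<le> (\<Sum>(i, j, k, l)\<in>quadruples p. D i j k l) + (B + B + B + B + B + B)"
    unfolding sum.distrib quad by (intro add_mono e1 e2 e3 e4 e5 e6 order_refl)
  finally show ?thesis by simp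
qed

lemma add_power8_le: "((x::real) - y)^8 \<le> 128 * x^8 + 128 * y^8"
proof -
  have s: "(a + b)^2 \<le> 2 * a^2 + 2 * b^2" for a b :: real
    using zero_le_power2[of "a - b"] by (simp add: power2_eq_square algebra_simps)
  have "((x - y)^2)^2 \<le> (2 * x^2 + 2 * y^2)^2"
    using s[of x "- y"] by (intro power_mono) auto
  also have "\<dots> \<le> 2 * (2 * x^2)^2 + 2 * (2 * y^2)^2" by (rule s)
  finally have "(((x - y)^2)^2)^2 \<le> (2 * (2 * x^2)^2 + 2 * (2 * y^2)^2)^2"
    by (intro power_mono) auto
  also have "\<dots> \<le> 2 * (2 * (2 * x^2)^2)^2 + 2 * (2 * (2 * y^2)^2)^2" by (rule s)
  finally show ?thesis by (simp add: power_mult_distrib flip: power_mult)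
qed

lemma mean_fourth_power_le:
  fixes f :: "nat \<Rightarrow> real"
  assumes "1 \<le> p" shows "((\<Sum>i<p. f i) / real p)^4 \<le> (\<Sum>i<p. (f i)^4) / real p"
proof -
  have s: "((\<Sum>i<p. g i) / real p)^2 \<le> (\<Sum>i<p. (g i)^2) / real p" for g :: "nat \<Rightarrow> real"
  proof -
    have "(\<Sum>i<p. g i)^2 \<le> real p * (\<Sum>i<p. (g i)^2)"
      using Cauchy_Schwarz_ineq_sum[of "\<lambda>_. 1" g "{..<p}"] by simp
    then have "(\<Sum>i<p. g i)^2 / (real p)^2 \<le> real p * (\<Sum>i<p. (g i)^2) / (real p)^2"
      by (rule divide_right_mono) simp
    then show ?thesis using assms by (simp add: power_divide power2_eq_square)
  qed
  have "(((\<Sum>i<p. f i) / real p)^2)^2 \<le> ((\<Sum>i<p. (f i)^2) / real p)^2"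
    using s[of f] by (intro power_mono) auto
  also have "\<dots> \<le> (\<Sum>i<p. ((f i)^2)^2) / real p" by (rule s)
  finally show ?thesis by (simp flip: power_mult)
qed

context iid_sample
begin

context
  fixes G :: "real mat" and K :: real
  assumes G: "rotation_mat p G" and X_dim: "\<And>\<omega>. \<omega> \<in> space M \<Longrightarrow> X \<omega> \<in> carrier_mat p n"
    and K: "1 \<le> K"
    and y8: "(\<Sum>i<p. expectation (\<lambda>\<omega>. (y_centred M G X i \<omega>)^8)) \<le> real p * K"
begin

definition rot :: "nat \<Rightarrow> 'a \<Rightarrow> real" where
  "rot i \<omega> = (\<Sum>j<p. G $$ (j, i) * obs 0 \<omega> j)"

text \<open>The matrix by which \<open>\<Gamma>\<^sup>T\<close> acts on outer products.\<close>
definition rot_pair :: "nat \<times> nat \<Rightarrow> nat \<times> nat \<Rightarrow> real" where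
  "rot_pair a b = G $$ (fst b, fst a) * G $$ (snd b, snd a)"

lemma G_carrier: "G \<in> carrier_mat p p"
  using G by (simp add: rotation_mat_def)

lemma y_centred_eq:
  assumes i: "i < p" and w: "\<omega> \<in> space M" shows "y_centred M G X i \<omega> = rot i \<omega>"
proof -
  have X1: "integrable M (\<lambda>\<omega>. X \<omega> $$ (j, 0))" if "j < p" for j
    using L8[OF that] by (intro Lp_fun_2_1 Lp_fun_4_2 Lp_fun_8_4)
  have "expectation (y_coord G X i) = expectation (\<lambda>\<omega>. \<Sum>j<p. G $$ (j, i) * X \<omega> $$ (j, 0))"
    using y_coord_sum[where X = X, OF G_carrier X_dim n_pos i] by (intro Bochner_Integration.integral_cong) auto
  also have "\<dots> = (\<Sum>j<p. G $$ (j, i) * mean_coord j)"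
    using X1 by (simp add: mean_coord_def)
  finally show ?thesis
    using y_coord_sum[where X = X, OF G_carrier X_dim[OF w] n_pos i]
    by (simp add: y_centred_def rot_def obs_def right_diff_distrib sum_subtractf)
qed

lemma rot_L8: "i < p \<Longrightarrow> Lp_fun M 8 (rot i)"
  unfolding rot_def[abs_def] using n_pos by (intro Lp_fun_sum Lp_fun_cmult obs_L8) auto

lemma rot_sq_L4: "i < p \<Longrightarrow> j < p \<Longrightarrow> Lp_fun M 4 (\<lambda>\<omega>. rot i \<omega> * rot j \<omega>)"
  by (intro Lp_fun_mult_8 rot_L8)

lemma rot_pair_orthogonal:
  assumes "b \<in> grid" "c \<in> grid"
  shows "(\<Sum>a\<in>grid. rot_pair a b * rot_pair a c) = (if b = c then 1 else 0)"
proof -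
  have "(\<Sum>a\<in>grid. rot_pair a b * rot_pair a c)
      = (\<Sum>i<p. \<Sum>j<p. (G $$ (fst b, i) * G $$ (fst c, i)) * (G $$ (snd b, j) * G $$ (snd c, j)))"
    by (simp add: sum.cartesian_product' rot_pair_def mult_ac)
  also have "\<dots> = (\<Sum>i<p. G $$ (fst b, i) * G $$ (fst c, i)) * (\<Sum>j<p. G $$ (snd b, j) * G $$ (snd c, j))"
    by (simp add: sum_product)
  also have "\<dots> = (if b = c then 1 else 0)"
    using assms rotation_entries[OF G] by (auto simp: prod_eq_iff)
  finally show ?thesis .
qed

lemma sum_rot_sq: "(\<Sum>i<p. (rot i \<omega>)^2) = real p * mean_sq 0 \<omega>"
proof -
  have "(\<Sum>i<p. (rot i \<omega>)^2) = (\<Sum>j<p. (obs 0 \<omega> j)^2)"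
    unfolding rot_def by (rule orthogonal_sum_sq[where H = "\<lambda>i j. G $$ (j, i)"]) (auto simp: rotation_entries[OF G])
  then show ?thesis using p_pos by (simp add: mean_sq_def)
qed

lemma rot_product: "rot i \<omega> * rot j \<omega> = (\<Sum>b\<in>grid. rot_pair (i, j) b * outer (obs 0 \<omega>) b)"
  unfolding rot_def sum_product sum.cartesian_product'
  by (intro sum.cong refl) (simp add: rot_pair_def outer_def mult_ac)

lemma expectation_rot_product:
  "expectation (\<lambda>\<omega>. rot i \<omega> * rot j \<omega>) = (\<Sum>b\<in>grid. rot_pair (i, j) b * sigma b)"
proof -
  have "integrable M (\<lambda>\<omega>. outer (obs 0 \<omega>) b)" if "b \<in> grid" for b
    using that n_pos by (intro Lp_fun_2_1 Lp_fun_4_2 outer_obs_L4) auto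
  then show ?thesis unfolding rot_product by (simp add: sigma_def)
qed

definition rot_cov :: "nat \<times> nat \<Rightarrow> nat \<times> nat \<Rightarrow> real" where
  "rot_cov a b = covar M (\<lambda>\<omega>. rot (fst a) \<omega> * rot (snd a) \<omega>) (\<lambda>\<omega>. rot (fst b) \<omega> * rot (snd b) \<omega>)"

lemma rot_cov_eq: "rot_cov a b = (\<Sum>c\<in>grid. rot_pair a c * (\<Sum>d\<in>grid. rot_pair b d * dev_cov c d))"
proof -
  have dev: "rot (fst a) \<omega> * rot (snd a) \<omega> - expectation (\<lambda>\<omega>. rot (fst a) \<omega> * rot (snd a) \<omega>)
      = (\<Sum>c\<in>grid. rot_pair a c * dev 0 \<omega> c)" for a \<omega>
    unfolding expectation_rot_product unfolding rot_product
    by (simp add: dev_def right_diff_distrib sum_subtractf)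
  have int: "integrable M (\<lambda>\<omega>. dev 0 \<omega> c * dev 0 \<omega> d)" if "c \<in> grid" "d \<in> grid" for c d
    using that n_pos by (intro Lp_fun_mult_2 Lp_fun_4_2 dev_L4) auto
  have "rot_cov a b = expectation (\<lambda>\<omega>. (\<Sum>c\<in>grid. rot_pair a c * dev 0 \<omega> c) * (\<Sum>d\<in>grid. rot_pair b d * dev 0 \<omega> d))"
    unfolding rot_cov_def covar_def dev ..
  also have "\<dots> = expectation (\<lambda>\<omega>. \<Sum>c\<in>grid. \<Sum>d\<in>grid. (rot_pair a c * rot_pair b d) * (dev 0 \<omega> c * dev 0 \<omega> d))"
    unfolding sum_product by (simp add: mult_ac)
  also have "\<dots> = (\<Sum>c\<in>grid. \<Sum>d\<in>grid. (rot_pair a c * rot_pair b d) * dev_cov c d)"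
    using int by (simp add: dev_cov_def Bochner_Integration.integral_sum Bochner_Integration.integrable_sum)
  finally show ?thesis by (simp add: sum_distrib_left mult.assoc)
qed

text \<open>The Frobenius norm of the covariance of the observed outer product does not depend on the
  orthonormal basis, because \<open>\<Gamma> \<otimes> \<Gamma>\<close> is orthogonal as well.\<close>
lemma sum_rot_cov_sq: "(\<Sum>a\<in>grid. \<Sum>b\<in>grid. (rot_cov a b)^2) = (\<Sum>c\<in>grid. \<Sum>d\<in>grid. (dev_cov c d)^2)"
proof -
  have fin: "finite grid" by simp
  have "(\<Sum>a\<in>grid. \<Sum>b\<in>grid. (rot_cov a b)^2)
      = (\<Sum>b\<in>grid. \<Sum>a\<in>grid. (\<Sum>c\<in>grid. rot_pair a c * (\<Sum>d\<in>grid. rot_pair b d * dev_cov c d))^2)"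
    unfolding rot_cov_eq by (rule sum.swap)
  also have "\<dots> = (\<Sum>b\<in>grid. \<Sum>c\<in>grid. (\<Sum>d\<in>grid. rot_pair b d * dev_cov c d)^2)"
    by (intro sum.cong refl orthogonal_sum_sq[OF fin] rot_pair_orthogonal)
  also have "\<dots> = (\<Sum>c\<in>grid. \<Sum>b\<in>grid. (\<Sum>d\<in>grid. rot_pair b d * dev_cov c d)^2)" by (rule sum.swap)
  also have "\<dots> = (\<Sum>c\<in>grid. \<Sum>d\<in>grid. (dev_cov c d)^2)"
    by (intro sum.cong refl orthogonal_sum_sq[OF fin] rot_pair_orthogonal)
  finally show ?thesis .
qed

lemma rot8_integrable: assumes "i < p" shows "integrable M (\<lambda>\<omega>. (rot i \<omega>)^8)"
  using rot_L8[OF assms] by (simp add: Lp_fun_def)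

lemma rot4_integrable: assumes "i < p" shows "integrable M (\<lambda>\<omega>. (rot i \<omega>)^4)"
  using Lp_fun_8_4[OF rot_L8[OF assms]] by (simp add: Lp_fun_def)

lemma sum_rot8_le: "(\<Sum>i<p. expectation (\<lambda>\<omega>. (rot i \<omega>)^8)) \<le> real p * K"
proof -
  have "(\<Sum>i<p. expectation (\<lambda>\<omega>. (rot i \<omega>)^8)) = (\<Sum>i<p. expectation (\<lambda>\<omega>. (y_centred M G X i \<omega>)^8))"
    using y_centred_eq by (intro sum.cong refl Bochner_Integration.integral_cong) auto
  then show ?thesis using y8 by simp
qed

lemma sum_rot4_le: "(\<Sum>i<p. expectation (\<lambda>\<omega>. (rot i \<omega>)^4)) \<le> real p * K"
proof -
  have "expectation (\<lambda>\<omega>. (rot i \<omega>)^4) \<le> (1 + expectation (\<lambda>\<omega>. (rot i \<omega>)^8)) / 2" if i: "i < p" for i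
  proof -
    have "expectation (\<lambda>\<omega>. (rot i \<omega>)^4) \<le> expectation (\<lambda>\<omega>. (1 + (rot i \<omega>)^8) / 2)"
    proof (rule integral_mono[OF rot4_integrable[OF i]])
      show "integrable M (\<lambda>\<omega>. (1 + (rot i \<omega>)^8) / 2)" using rot8_integrable[OF i] by simp
      show "(rot i \<omega>)^4 \<le> (1 + (rot i \<omega>)^8) / 2" for \<omega>
      proof -
        have "0 \<le> ((rot i \<omega>)^4 - 1)^2" by simp
        also have "\<dots> = (rot i \<omega>)^8 - 2 * (rot i \<omega>)^4 + 1" by (simp add: power2_diff flip: power_mult)
        finally show ?thesis by simp
      qed
    qed
    also have "\<dots> = (1 + expectation (\<lambda>\<omega>. (rot i \<omega>)^8)) / 2"
      using rot8_integrable[OF i] by (simp add: prob_space)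
    finally show ?thesis .
  qed
  then have "(\<Sum>i<p. expectation (\<lambda>\<omega>. (rot i \<omega>)^4)) \<le> (\<Sum>i<p. (1 + expectation (\<lambda>\<omega>. (rot i \<omega>)^8)) / 2)"
    by (intro sum_mono) simp
  also have "\<dots> = (real p + (\<Sum>i<p. expectation (\<lambda>\<omega>. (rot i \<omega>)^8))) / 2"
    by (simp add: sum.distrib flip: sum_divide_distrib)
  also have "\<dots> \<le> (real p + real p * K) / 2" using sum_rot8_le by simp
  also have "\<dots> \<le> real p * K" using K p_pos mult_left_mono[OF K, of "real p"] by simp
  finally show ?thesis .
qed

text \<open>The length of an observation is the same in the rotated coordinates, where the power mean inequality
  applies.\<close>
lemma mean_sq_fourth_le: "expectation (\<lambda>\<omega>. (mean_sq 0 \<omega>)^4) \<le> K"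
proof -
  have int8: "integrable M (\<lambda>\<omega>. (\<Sum>i<p. (rot i \<omega>)^8) / real p)"
    using rot8_integrable by (intro integrable_divide Bochner_Integration.integrable_sum) auto
  have eq: "mean_sq 0 \<omega> = (\<Sum>i<p. (rot i \<omega>)^2) / real p" for \<omega>
    using p_pos by (simp add: sum_rot_sq)
  have "expectation (\<lambda>\<omega>. (mean_sq 0 \<omega>)^4) \<le> expectation (\<lambda>\<omega>. (\<Sum>i<p. (rot i \<omega>)^8) / real p)"
  proof (rule integral_mono'[OF int8])
    show "(mean_sq 0 \<omega>)^4 \<le> (\<Sum>i<p. (rot i \<omega>)^8) / real p" for \<omega>
      using mean_fourth_power_le[OF p_pos, of "\<lambda>i. (rot i \<omega>)^2"] unfolding eq by (simp flip: power_mult)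
  qed (simp add: sum_nonneg)
  also have "\<dots> = (\<Sum>i<p. expectation (\<lambda>\<omega>. (rot i \<omega>)^8)) / real p"
    using rot8_integrable by simp
  also have "\<dots> \<le> K" using sum_rot8_le p_pos by (simp add: divide_le_eq mult.commute)
  finally show ?thesis .
qed

lemma expectation_sum_rot_sq_sq_le: "expectation (\<lambda>\<omega>. (\<Sum>i<p. (rot i \<omega>)^2)^2) \<le> (real p)^2 * K"
proof -
  have int4: "integrable M (\<lambda>\<omega>. real p * (\<Sum>i<p. (rot i \<omega>)^4))"
    using rot4_integrable by (intro integrable_mult_right Bochner_Integration.integrable_sum) auto
  have "expectation (\<lambda>\<omega>. (\<Sum>i<p. (rot i \<omega>)^2)^2) \<le> expectation (\<lambda>\<omega>. real p * (\<Sum>i<p. (rot i \<omega>)^4))"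
  proof (rule integral_mono'[OF int4])
    show "(\<Sum>i<p. (rot i \<omega>)^2)^2 \<le> real p * (\<Sum>i<p. (rot i \<omega>)^4)" for \<omega>
      using Cauchy_Schwarz_ineq_sum[of "\<lambda>_. 1" "\<lambda>i. (rot i \<omega>)^2" "{..<p}"] by (simp flip: power_mult)
  qed (simp add: sum_nonneg)
  also have "\<dots> = real p * (\<Sum>i<p. expectation (\<lambda>\<omega>. (rot i \<omega>)^4))" using rot4_integrable by simp
  also have "\<dots> \<le> real p * (real p * K)" using sum_rot4_le by (intro mult_left_mono) auto
  finally show ?thesis by (simp add: power2_eq_square mult.assoc)
qed

text \<open>In the eigenbasis the covariance matrix is diagonal, so its squared norm is the average of the squared
  variances.  Without the diagonal form there would be \<open>p\<close> times as many terms.\<close>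
lemma sigma_norm_le:
  assumes L: "L \<in> carrier_mat p p" "diagonal_mat L" and spectral: "cov_mat M p X = G * L * transpose_mat G"
  shows "entry_prod p sigma sigma \<le> K"
proof -
  have Gt: "transpose_mat G * G = 1\<^sub>m p" using G by (simp add: rotation_mat_def)
  note Gc = G_carrier
  have GT: "transpose_mat G \<in> carrier_mat p p" using Gc by simp
  have "transpose_mat G * cov_mat M p X * G = (transpose_mat G * G) * L * (transpose_mat G * G)"
    unfolding spectral using Gc GT L(1) by (simp add: assoc_mult_mat[of _ p p _ p _ p])
  then have diag: "transpose_mat G * cov_mat M p X * G = L" using L(1) by (simp add: Gt)
  have cov_entry: "L $$ (i, j) = expectation (\<lambda>\<omega>. rot i \<omega> * rot j \<omega>)" if ij: "i < p" "j < p" for i j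
  proof -
    have C: "cov_mat M p X \<in> carrier_mat p p" by (simp add: cov_mat_def)
    have "L $$ (i, j) = (\<Sum>k<p. G $$ (k, i) * (\<Sum>l<p. cov_mat M p X $$ (k, l) * G $$ (l, j)))"
      unfolding diag[symmetric] using Gc C ij
      by (auto simp: scalar_prod_def lessThan_atLeast0 intro!: sum.cong)
    also have "\<dots> = (\<Sum>k<p. \<Sum>l<p. rot_pair (i, j) (k, l) * sigma (k, l))"
      by (simp add: cov_mat_entry sum_distrib_left rot_pair_def mult_ac)
    also have "\<dots> = expectation (\<lambda>\<omega>. rot i \<omega> * rot j \<omega>)"
      unfolding expectation_rot_product sum.cartesian_product' ..
    finally show ?thesis .
  qed
  have "real p * entry_prod p sigma sigma = (\<Sum>b\<in>grid. (sigma b)^2)"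
    using p_pos by (simp add: entry_prod_def power2_eq_square)
  also have "\<dots> = (\<Sum>a\<in>grid. (\<Sum>b\<in>grid. rot_pair a b * sigma b)^2)"
    by (rule orthogonal_sum_sq[symmetric, OF _ rot_pair_orthogonal]) auto
  also have "\<dots> = (\<Sum>i<p. \<Sum>j<p. (L $$ (i, j))^2)"
    unfolding sum.cartesian_product' by (intro sum.cong refl) (simp add: cov_entry expectation_rot_product sum.cartesian_product')
  also have "\<dots> = (\<Sum>i<p. \<Sum>j<p. if j = i then (L $$ (i, i))^2 else 0)"
    using L by (intro sum.cong refl) (auto simp: diagonal_mat_def)
  also have "\<dots> = (\<Sum>i<p. (expectation (\<lambda>\<omega>. rot i \<omega> * rot i \<omega>))^2)" by (simp add: cov_entry)
  also have "\<dots> \<le> (\<Sum>i<p. expectation (\<lambda>\<omega>. (rot i \<omega>)^4))"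
  proof (rule sum_mono)
    fix i assume "i \<in> {..<p}"
    then have "(expectation (\<lambda>\<omega>. rot i \<omega> * rot i \<omega>))^2 \<le> expectation (\<lambda>\<omega>. (rot i \<omega> * rot i \<omega>)^2)"
      by (intro square_expectation_le Lp_fun_4_2 rot_sq_L4) auto
    then show "(expectation (\<lambda>\<omega>. rot i \<omega> * rot i \<omega>))^2 \<le> expectation (\<lambda>\<omega>. (rot i \<omega>)^4)"
      by (simp add: power2_eq_square power4_eq_xxxx mult.assoc)
  qed
  also have "\<dots> \<le> real p * K" by (rule sum_rot4_le)
  finally show ?thesis using p_pos by simp
qed

text \<open>By invariance the sum can be taken over the rotated coordinates.  A covariance of products is at most the
  geometric mean of two fourth-order moments, which are summable over the quadruples with a repeated index.\<close>
lemma dev_power_bound: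
  "dev_power \<le> (\<Sum>(i, j, k, l)\<in>quadruples p.
      (covar M (\<lambda>\<omega>. y_centred M G X i \<omega> * y_centred M G X j \<omega>)
               (\<lambda>\<omega>. y_centred M G X k \<omega> * y_centred M G X l \<omega>))^2) / (real p)^2 + 6 * K^2 * real p"
proof -
  define m where "m i j = (if i < p \<and> j < p then expectation (\<lambda>\<omega>. (rot i \<omega> * rot j \<omega>)^2) else 0)" for i j
  define D where "D i j k l = (rot_cov (i, j) (k, l))^2" for i j k l
  have m0: "0 \<le> m i j" for i j by (auto simp: m_def intro: Bochner_Integration.integral_nonneg)
  have msym: "m i j = m j i" for i j by (simp add: m_def mult.commute)
  have sq_int: "integrable M (\<lambda>\<omega>. (rot i \<omega> * rot j \<omega>)^2)" if "i < p" "j < p" for i j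
    using Lp_fun_mult_2[OF Lp_fun_4_2[OF rot_sq_L4] Lp_fun_4_2[OF rot_sq_L4], OF that that]
    by (simp add: power2_eq_square)
  have cs: "D i j k l \<le> m i j * m k l" if ij: "i < p" "j < p" and kl: "k < p" "l < p" for i j k l
  proof -
    have centred: "expectation (\<lambda>\<omega>. (f \<omega> - expectation f)^2) \<le> expectation (\<lambda>\<omega>. (f \<omega>)^2)"
      if f: "Lp_fun M 2 f" for f
    proof -
      have i: "integrable M f" "integrable M (\<lambda>\<omega>. (f \<omega>)^2)"
        using Lp_fun_2_1[OF f] Lp_fun_mult_2[OF f f] by (simp_all add: power2_eq_square)
      have "expectation (\<lambda>\<omega>. (f \<omega> - expectation f)^2)
          = expectation (\<lambda>\<omega>. (f \<omega>)^2 - 2 * expectation f * f \<omega> + (expectation f)^2)"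
        by (intro Bochner_Integration.integral_cong) (auto simp: power2_eq_square algebra_simps)
      also have "\<dots> = expectation (\<lambda>\<omega>. (f \<omega>)^2) - 2 * expectation f * expectation f + (expectation f)^2"
        using i by (simp add: prob_space)
      finally show ?thesis by (simp add: power2_eq_square)
    qed
    let ?f = "\<lambda>\<omega>. rot i \<omega> * rot j \<omega>" and ?g = "\<lambda>\<omega>. rot k \<omega> * rot l \<omega>"
    have L: "Lp_fun M 2 ?f" "Lp_fun M 2 ?g" using ij kl by (intro Lp_fun_4_2 rot_sq_L4; simp)+
    have "D i j k l = (expectation (\<lambda>\<omega>. (?f \<omega> - expectation ?f) * (?g \<omega> - expectation ?g)))^2"
      by (simp add: D_def rot_cov_def covar_def)
    also have "\<dots> \<le> expectation (\<lambda>\<omega>. (?f \<omega> - expectation ?f)^2) * expectation (\<lambda>\<omega>. (?g \<omega> - expectation ?g)^2)"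
      by (intro expectation_Cauchy_Schwarz Lp_fun_diff L Lp_fun_const)
    also have "\<dots> \<le> m i j * m k l"
      using centred[OF L(1)] centred[OF L(2)] ij kl
      by (intro mult_mono) (auto simp: m_def intro: Bochner_Integration.integral_nonneg)
    finally show ?thesis .
  qed
  have row: "(\<Sum>j<p. m i j) = expectation (\<lambda>\<omega>. (rot i \<omega>)^2 * (\<Sum>j<p. (rot j \<omega>)^2))" if i: "i < p" for i
  proof -
    have "(\<Sum>j<p. m i j) = (\<Sum>j<p. expectation (\<lambda>\<omega>. (rot i \<omega> * rot j \<omega>)^2))"
      using i by (intro sum.cong) (auto simp: m_def)
    also have "\<dots> = expectation (\<lambda>\<omega>. \<Sum>j<p. (rot i \<omega> * rot j \<omega>)^2)"
      using sq_int i by (intro Bochner_Integration.integral_sum[symmetric]) auto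
    finally show ?thesis by (simp add: power_mult_distrib sum_distrib_left)
  qed
  have int_rot: "integrable M (\<lambda>\<omega>. (rot i \<omega>)^2 * (\<Sum>j<p. (rot j \<omega>)^2))" if i: "i < p" for i
  proof -
    have "integrable M (\<lambda>\<omega>. \<Sum>j<p. (rot i \<omega> * rot j \<omega>)^2)"
      using sq_int i by (intro Bochner_Integration.integrable_sum) auto
    then show ?thesis by (simp add: power_mult_distrib sum_distrib_left)
  qed
  have total: "(\<Sum>i<p. \<Sum>j<p. m i j) \<le> (real p)^2 * K"
  proof -
    have "(\<Sum>i<p. \<Sum>j<p. m i j) = (\<Sum>i<p. expectation (\<lambda>\<omega>. (rot i \<omega>)^2 * (\<Sum>j<p. (rot j \<omega>)^2)))"
      by (simp add: row)
    also have "\<dots> = expectation (\<lambda>\<omega>. \<Sum>i<p. (rot i \<omega>)^2 * (\<Sum>j<p. (rot j \<omega>)^2))"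
      using int_rot by (intro Bochner_Integration.integral_sum[symmetric]) auto
    also have "\<dots> = expectation (\<lambda>\<omega>. (\<Sum>i<p. (rot i \<omega>)^2)^2)"
      by (simp add: power2_eq_square sum_distrib_right)
    also have "\<dots> \<le> (real p)^2 * K" by (rule expectation_sum_rot_sq_sq_le)
    finally show ?thesis .
  qed
  have diag: "(\<Sum>i<p. m i i) \<le> real p * K"
  proof -
    have "(\<Sum>i<p. m i i) = (\<Sum>i<p. expectation (\<lambda>\<omega>. (rot i \<omega>)^4))"
      by (intro sum.cong) (auto simp: m_def power2_eq_square power4_eq_xxxx mult.assoc)
    then show ?thesis using sum_rot4_le by simp
  qed
  have "(\<Sum>i<p. (\<Sum>j<p. m i j)^2) \<le> (\<Sum>i<p. expectation (\<lambda>\<omega>. (rot i \<omega>)^4) * ((real p)^2 * K))"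
  proof (rule sum_mono)
    fix i assume "i \<in> {..<p}"
    then have i: "i < p" by simp
    have "(\<Sum>j<p. m i j)^2 \<le> expectation (\<lambda>\<omega>. ((rot i \<omega>)^2)^2) * expectation (\<lambda>\<omega>. (\<Sum>j<p. (rot j \<omega>)^2)^2)"
      unfolding row[OF i]
      using i by (intro expectation_Cauchy_Schwarz Lp_fun_sum)
        (auto simp: power2_eq_square intro!: Lp_fun_4_2 rot_sq_L4)
    also have "\<dots> \<le> expectation (\<lambda>\<omega>. ((rot i \<omega>)^2)^2) * ((real p)^2 * K)"
      by (intro mult_left_mono expectation_sum_rot_sq_sq_le Bochner_Integration.integral_nonneg) auto
    finally show "(\<Sum>j<p. m i j)^2 \<le> expectation (\<lambda>\<omega>. (rot i \<omega>)^4) * ((real p)^2 * K)"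
      by (simp flip: power_mult)
  qed
  also have "\<dots> \<le> real p * K * ((real p)^2 * K)"
    unfolding sum_distrib_right[symmetric] using sum_rot4_le K by (intro mult_right_mono) auto
  finally have rows: "(\<Sum>i<p. (\<Sum>j<p. m i j)^2) \<le> real p * K * ((real p)^2 * K)" .
  have diag_total: "(\<Sum>i<p. m i i) * (\<Sum>i<p. \<Sum>j<p. m i j) \<le> real p * K * ((real p)^2 * K)"
    using diag total m0 K by (intro mult_mono sum_nonneg) auto
  have "(\<Sum>c\<in>grid. \<Sum>d\<in>grid. (dev_cov c d)^2) = (\<Sum>i<p. \<Sum>j<p. \<Sum>k<p. \<Sum>l<p. D i j k l)"
    unfolding sum_rot_cov_sq[symmetric] D_def by (simp only: sum.cartesian_product')
  also have "\<dots> \<le> (\<Sum>(i, j, k, l)\<in>quadruples p. D i j k l) + 6 * (real p * K * ((real p)^2 * K))"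
    using cs by (intro sum_over_quadruples_bound[where m = m] m0 msym diag_total rows) (auto simp: D_def)
  finally have "dev_power \<le> ((\<Sum>(i, j, k, l)\<in>quadruples p. D i j k l) + 6 * (real p * K * ((real p)^2 * K))) / (real p)^2"
    unfolding dev_power_def by (rule divide_right_mono) simp
  also have "\<dots> = (\<Sum>(i, j, k, l)\<in>quadruples p. D i j k l) / (real p)^2 + 6 * K^2 * real p"
    using p_pos by (simp add: add_divide_distrib power2_eq_square)
  also have "(\<Sum>(i, j, k, l)\<in>quadruples p. D i j k l) = (\<Sum>(i, j, k, l)\<in>quadruples p.
      (covar M (\<lambda>\<omega>. y_centred M G X i \<omega> * y_centred M G X j \<omega>)
               (\<lambda>\<omega>. y_centred M G X k \<omega> * y_centred M G X l \<omega>))^2)"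
  proof (intro sum.cong refl)
    fix q assume "q \<in> quadruples p"
    then obtain i j k l where q: "q = (i, j, k, l)" "i < p" "j < p" "k < p" "l < p"
      by (auto simp: quadruples_def)
    have "covar M (\<lambda>\<omega>. y_centred M G X i \<omega> * y_centred M G X j \<omega>) (\<lambda>\<omega>. y_centred M G X k \<omega> * y_centred M G X l \<omega>)
        = covar M (\<lambda>\<omega>. rot i \<omega> * rot j \<omega>) (\<lambda>\<omega>. rot k \<omega> * rot l \<omega>)"
    proof -
      have e: "expectation (\<lambda>\<omega>. y_centred M G X i \<omega> * y_centred M G X j \<omega>) = expectation (\<lambda>\<omega>. rot i \<omega> * rot j \<omega>)"
        if "i < p" "j < p" for i j
        using that y_centred_eq by (intro Bochner_Integration.integral_cong) auto
      show ?thesis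
        unfolding covar_def e[OF q(2,3)] e[OF q(4,5)]
        using q y_centred_eq by (intro Bochner_Integration.integral_cong) auto
    qed
    then show "(case q of (i, j, k, l) \<Rightarrow> D i j k l) = (case q of (i, j, k, l) \<Rightarrow>
      (covar M (\<lambda>\<omega>. y_centred M G X i \<omega> * y_centred M G X j \<omega>)
               (\<lambda>\<omega>. y_centred M G X k \<omega> * y_centred M G X l \<omega>))^2)"
      by (simp add: q D_def rot_cov_def)
  qed
  finally show ?thesis .
qed

end

end

text \<open>The moment hypothesis is about coordinates that are not centred; the eighth power of the mean is at most
  the eighth moment, by three squarings.\<close>
lemma (in prob_space) centred_eighth_moment_le:
  assumes f: "Lp_fun M 8 f"
  shows "expectation (\<lambda>\<omega>. (f \<omega> - expectation f)^8) \<le> 256 * expectation (\<lambda>\<omega>. (f \<omega>)^8)"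
proof -
  have i8: "integrable M (\<lambda>\<omega>. (f \<omega>)^8)" using f by (simp add: Lp_fun_def)
  have f4: "Lp_fun M 4 (\<lambda>\<omega>. (f \<omega>)^2)" using Lp_fun_mult_8[OF f f] by (simp add: power2_eq_square)
  have f2: "Lp_fun M 2 (\<lambda>\<omega>. (f \<omega>)^4)"
    using Lp_fun_mult_4[OF f4 f4] by (simp flip: power_add)
  have "(expectation f)^2 \<le> expectation (\<lambda>\<omega>. (f \<omega>)^2)"
    by (rule square_expectation_le[OF Lp_fun_4_2[OF Lp_fun_8_4[OF f]]])
  then have "((expectation f)^2)^2 \<le> (expectation (\<lambda>\<omega>. (f \<omega>)^2))^2" by (intro power_mono) auto
  also have "\<dots> \<le> expectation (\<lambda>\<omega>. ((f \<omega>)^2)^2)" by (rule square_expectation_le[OF Lp_fun_4_2[OF f4]])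
  finally have "(((expectation f)^2)^2)^2 \<le> (expectation (\<lambda>\<omega>. (f \<omega>)^4))^2"
    by (intro power_mono) (auto simp flip: power_mult)
  also have "\<dots> \<le> expectation (\<lambda>\<omega>. ((f \<omega>)^4)^2)" by (rule square_expectation_le[OF f2])
  finally have m8: "(expectation f)^8 \<le> expectation (\<lambda>\<omega>. (f \<omega>)^8)" by (simp flip: power_mult)
  have "expectation (\<lambda>\<omega>. (f \<omega> - expectation f)^8) \<le> expectation (\<lambda>\<omega>. 128 * (f \<omega>)^8 + 128 * (expectation f)^8)"
    using i8 by (intro integral_mono' add_power8_le) auto
  also have "\<dots> = 128 * expectation (\<lambda>\<omega>. (f \<omega>)^8) + 128 * (expectation f)^8"
    using i8 by (simp add: prob_space)
  finally show ?thesis using m8 by linarith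
qed

lemma finite_quadruples: "finite (quadruples p)"
  and card_quadruples_le: "real (card (quadruples p)) \<le> (real p)^4"
proof -
  have sub: "quadruples p \<subseteq> {..<p} \<times> {..<p} \<times> {..<p} \<times> {..<p}" by (auto simp: quadruples_def)
  then show "finite (quadruples p)" by (rule finite_subset) simp
  have "card (quadruples p) \<le> card ({..<p} \<times> {..<p} \<times> {..<p} \<times> {..<p})" by (rule card_mono[OF _ sub]) simp
  also have "\<dots> = p^4" by (simp add: card_cartesian_product power4_eq_xxxx)
  finally show "real (card (quadruples p)) \<le> (real p)^4" by (simp flip: of_nat_power)
qed

theorem theorem2:
  fixes M :: "nat \<Rightarrow> 'a measure"
    and X :: "nat \<Rightarrow> 'a \<Rightarrow> real mat"
    and p N :: "nat \<Rightarrow> nat"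
    and \<Gamma> \<Lambda> \<Sigma> :: "nat \<Rightarrow> real mat"
    and T :: "nat \<Rightarrow> nat \<Rightarrow> real mat"
    and s :: mean_setting
    and Z :: "nat \<Rightarrow> 'a \<Rightarrow> real mat"
    and S :: "nat \<Rightarrow> 'a \<Rightarrow> real mat"
    and S_star \<Sigma>_star :: "nat \<Rightarrow> 'a \<Rightarrow> real mat"
  defines "\<Sigma> \<equiv> \<lambda>n. cov_mat (M n) (p n) (X n)"
    and "Z \<equiv> \<lambda>n. centred_obs s (M n) (p n) n (X n)"
    and "S \<equiv> \<lambda>n \<omega>. sample_cov s n (Z n \<omega>)"
    and "S_star \<equiv> \<lambda>n \<omega>. bona_fide_est s (p n) n (N n) (T n) (Z n \<omega>)"
    and "\<Sigma>_star \<equiv> \<lambda>n \<omega>. oracle_est (p n) (N n) (T n) (\<Sigma> n) (S n \<omega>)"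
  assumes prob: "\<And>n. n \<ge> 1 \<Longrightarrow> prob_space (M n)"
    and dims: "\<And>n. n \<ge> 1 \<Longrightarrow> p n \<ge> 1 \<and> N n \<ge> 1"
    and X_dim: "\<And>n \<omega>. n \<ge> 1 \<Longrightarrow> \<omega> \<in> space (M n) \<Longrightarrow> X n \<omega> \<in> carrier_mat (p n) n"
    and X_iid: "\<And>n. n \<ge> 1 \<Longrightarrow> iid_columns (M n) (X n) (p n) n"
    and X_sq: "\<And>n i. n \<ge> 1 \<Longrightarrow> i < p n \<Longrightarrow> integrable (M n) (\<lambda>\<omega>. (X n \<omega> $$ (i, 0))^2)"
    and rotation: "\<And>n. n \<ge> 1 \<Longrightarrow> rotation_mat (p n) (\<Gamma> n)"
    and diagonal: "\<And>n. n \<ge> 1 \<Longrightarrow> \<Lambda> n \<in> carrier_mat (p n) (p n) \<and> diagonal_mat (\<Lambda> n)"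
    and spectral: "\<And>n. n \<ge> 1 \<Longrightarrow> \<Sigma> n = \<Gamma> n * \<Lambda> n * transpose_mat (\<Gamma> n)"
    and T_targets: "\<And>n. n \<ge> 1 \<Longrightarrow> targets (p n) (N n) (T n)"
    and A1: "\<exists>K1. \<forall>n\<ge>1. real (p n) / real n \<le> K1"
    and A2: "\<exists>K2. \<forall>n\<ge>1.
        (\<forall>i<p n. integrable (M n) (\<lambda>\<omega>. (y_coord (\<Gamma> n) (X n) i \<omega>)^8)) \<and>
        1 / real (p n) * (\<Sum>i<p n. integral\<^sup>L (M n) (\<lambda>\<omega>. (y_coord (\<Gamma> n) (X n) i \<omega>)^8)) \<le> K2 \<and>
        (\<forall>k<N n.
          integrable (M n) (\<lambda>\<omega>. (inner_mat (p n) (outer_col (X n \<omega>) 0) (T n k))^4) \<and>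
          integral\<^sup>L (M n) (\<lambda>\<omega>. (inner_mat (p n) (outer_col (X n \<omega>) 0) (T n k))^4) \<le> K2)"
    and A3: "(\<lambda>n. real (N n)) \<in> o(\<lambda>n. real n)"
    and A4: "(\<lambda>n. (real (p n))^2 / real n *
        ((\<Sum>(i, j, k, l) \<in> quadruples (p n).
            (covar (M n)
              (\<lambda>\<omega>. y_centred (M n) (\<Gamma> n) (X n) i \<omega> * y_centred (M n) (\<Gamma> n) (X n) j \<omega>)
              (\<lambda>\<omega>. y_centred (M n) (\<Gamma> n) (X n) k \<omega> * y_centred (M n) (\<Gamma> n) (X n) l \<omega>))^2)
          / real (card (quadruples (p n))))) \<longlonglongrightarrow> 0"
    and A5: "\<And>n. n \<ge> min_size s \<Longrightarrow>
        measure (M n) {\<omega> \<in> space (M n).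
          (norm_mat (p n) (S n \<omega>))^2 - (\<Sum>k<N n. (inner_mat (p n) (S n \<omega>) (T n k))^2) = 0} = 0"
  shows "mean_tends_to_zero (min_size s) M
           (\<lambda>n \<omega>. (norm_mat (p n) (S_star n \<omega> - \<Sigma>_star n \<omega>))^2)
       \<and> mean_tends_to_zero (min_size s) M
           (\<lambda>n \<omega>. \<bar>(norm_mat (p n) (S_star n \<omega> - \<Sigma> n))^2
                    - (norm_mat (p n) (\<Sigma>_star n \<omega> - \<Sigma> n))^2\<bar>)"
proof -
  have n1: "1 \<le> n" if "n \<ge> min_size s" for n using that by (cases s) auto
  obtain K1 where K1: "\<And>n. n \<ge> 1 \<Longrightarrow> real (p n) / real n \<le> K1" using A1 by blast
  obtain K2 where K2: "\<And>n i. n \<ge> 1 \<Longrightarrow> i < p n \<Longrightarrow> integrable (M n) (\<lambda>\<omega>. (y_coord (\<Gamma> n) (X n) i \<omega>)^8)"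
    "\<And>n. n \<ge> 1 \<Longrightarrow> 1 / real (p n) * (\<Sum>i<p n. integral\<^sup>L (M n) (\<lambda>\<omega>. (y_coord (\<Gamma> n) (X n) i \<omega>)^8)) \<le> K2"
    using A2 by blast
  define Q where "Q n = (\<Sum>(i, j, k, l) \<in> quadruples (p n).
      (covar (M n)
        (\<lambda>\<omega>. y_centred (M n) (\<Gamma> n) (X n) i \<omega> * y_centred (M n) (\<Gamma> n) (X n) j \<omega>)
        (\<lambda>\<omega>. y_centred (M n) (\<Gamma> n) (X n) k \<omega> * y_centred (M n) (\<Gamma> n) (X n) l \<omega>))^2)" for n
  have "Bseq (\<lambda>n. (real (p n))^2 / real n * (Q n / real (card (quadruples (p n)))))"
    using A4 unfolding Q_def by (intro convergent_imp_Bseq convergentI)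
  then obtain B where B: "0 < B" "\<And>n. \<bar>(real (p n))^2 / real n * (Q n / real (card (quadruples (p n))))\<bar> \<le> B"
    by (auto simp: Bseq_def)
  \<comment> \<open>\<open>C\<close> bounds the eighth moments of the centred coordinates; the other terms of \<open>K\<close> are for \<open>\<Psi>\<close> and \<open>p / n\<close>.\<close>
  define C where "C = 1 + 256 * \<bar>K2\<bar>"
  define K where "K = C + B + 6 * C^2 * \<bar>K1\<bar> + \<bar>K1\<bar>"
  have C: "1 \<le> C" by (simp add: C_def)
  have CK: "C \<le> K" using B(1) by (simp add: K_def)

  have G: "rotation_mat (p n) (\<Gamma> n)" and Xd: "\<And>\<omega>. \<omega> \<in> space (M n) \<Longrightarrow> X n \<omega> \<in> carrier_mat (p n) n"
    and T: "targets (p n) (N n) (T n)" and p1: "1 \<le> p n" if "n \<ge> min_size s" for n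
    using rotation[OF n1[OF that]] X_dim[OF n1[OF that]] T_targets[OF n1[OF that]] dims[OF n1[OF that]] by auto
  have p_le: "real (p n) \<le> \<bar>K1\<bar> * real n" if n: "n \<ge> min_size s" for n
  proof -
    have "real (p n) / real n \<le> \<bar>K1\<bar>" using K1[OF n1[OF n]] by simp
    then show ?thesis using n1[OF n] by (simp add: divide_le_eq)
  qed
  have y_L8: "Lp_fun (M n) 8 (y_coord (\<Gamma> n) (X n) i)" and X_L8: "Lp_fun (M n) 8 (\<lambda>\<omega>. X n \<omega> $$ (i, 0))"
    if n: "n \<ge> min_size s" and i: "i < p n" for n i
    using rotated_coordinates_L8[OF prob[OF n1[OF n]] X_iid[OF n1[OF n]] n1[OF n] Xd[OF n] G[OF n] K2(1)[OF n1[OF n]]] i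
    by auto
  have samp: "iid_sample (M n) (X n) (p n) n" if n: "n \<ge> min_size s" for n
    unfolding iid_sample_def iid_sample_axioms_def
    using prob[OF n1[OF n]] X_iid[OF n1[OF n]] n1[OF n] p1[OF n] X_L8[OF n] by blast
  have y8: "(\<Sum>i<p n. integral\<^sup>L (M n) (\<lambda>\<omega>. (y_centred (M n) (\<Gamma> n) (X n) i \<omega>)^8)) \<le> real (p n) * C"
    if n: "n \<ge> min_size s" for n
  proof -
    interpret prob_space "M n" by (rule prob[OF n1[OF n]])
    have "(\<Sum>i<p n. expectation (\<lambda>\<omega>. (y_centred (M n) (\<Gamma> n) (X n) i \<omega>)^8))
        \<le> (\<Sum>i<p n. 256 * expectation (\<lambda>\<omega>. (y_coord (\<Gamma> n) (X n) i \<omega>)^8))"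
      unfolding y_centred_def by (intro sum_mono centred_eighth_moment_le y_L8[OF n]) simp
    also have "\<dots> = 256 * (\<Sum>i<p n. expectation (\<lambda>\<omega>. (y_coord (\<Gamma> n) (X n) i \<omega>)^8))"
      by (simp add: sum_distrib_left)
    also have "\<dots> \<le> 256 * (real (p n) * K2)"
      using K2(2)[OF n1[OF n]] p1[OF n] by (simp add: divide_le_eq mult.commute)
    also have "\<dots> = real (p n) * (256 * K2)" by simp
    also have "\<dots> \<le> real (p n) * C" unfolding C_def by (intro mult_left_mono) auto
    finally show ?thesis .
  qed
  note moments = samp G Xd C y8
  have dev_power: "iid_sample.dev_power (M n) (X n) (p n) \<le> K * real n" if n: "n \<ge> min_size s" for n
  proof -
    define P where "P = (real (p n))^2"
    have P: "0 < P" using p1[OF n] by (simp add: P_def)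
    have x: "0 < real n" using n1[OF n] by simp
    define c where "c = real (card (quadruples (p n)))"
    have QP: "Q n / P \<le> B * real n"
    proof (cases "quadruples (p n) = {}")
      case True
      then show ?thesis using B(1) by (simp add: Q_def)
    next
      case False
      then have c: "0 < c" using finite_quadruples[of "p n"] by (simp add: c_def card_gt_0_iff)
      have "P / real n * (Q n / c) \<le> B" using order_trans[OF abs_ge_self B(2)[of n]] by (simp only: P_def c_def)
      then have "P * Q n \<le> B * real n * c" using x c by (simp add: field_simps)
      also have "\<dots> \<le> B * real n * (P * P)"
        using card_quadruples_le[of "p n"] B(1)
        by (intro mult_left_mono) (auto simp: c_def P_def simp flip: power_add)
      finally have "P * Q n \<le> P * (B * real n * P)" by (simp add: mult_ac)
      then show ?thesis using P by (simp add: divide_le_eq)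
    qed
    have "iid_sample.dev_power (M n) (X n) (p n) \<le> Q n / P + 6 * C^2 * real (p n)"
      unfolding Q_def P_def
      by (rule iid_sample.dev_power_bound[OF samp[OF n] G[OF n] Xd[OF n] C y8[OF n]])
    also have "\<dots> \<le> B * real n + 6 * C^2 * (\<bar>K1\<bar> * real n)"
      using QP p_le[OF n] by (intro add_mono mult_left_mono) auto
    also have "\<dots> \<le> K * real n"
      unfolding K_def using C by (simp add: distrib_right)
    finally show ?thesis .
  qed

  have seq: "sample_sequence M X p N T s K"
  proof (rule sample_sequence.intro)
    fix n assume n: "min_size s \<le> n"
    show "iid_sample (M n) (X n) (p n) n" by (rule samp[OF n])
    show "X n \<omega> \<in> carrier_mat (p n) n" if "\<omega> \<in> space (M n)" for \<omega> by (rule Xd[OF n that])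
    show "targets (p n) (N n) (T n)" by (rule T[OF n])
    show "integral\<^sup>L (M n) (\<lambda>\<omega>. (iid_sample.mean_sq (M n) (X n) (p n) 0 \<omega>)^4) \<le> K"
      using iid_sample.mean_sq_fourth_le[OF samp[OF n] G[OF n] Xd[OF n] C y8[OF n]] CK by simp
    show "entry_prod (p n) (iid_sample.sigma (M n) (X n)) (iid_sample.sigma (M n) (X n)) \<le> K"
      using iid_sample.sigma_norm_le[OF samp[OF n] G[OF n] Xd[OF n] C y8[OF n],
          of "\<Lambda> n"] diagonal[OF n1[OF n]] spectral[OF n1[OF n]] CK by (simp add: \<Sigma>_def)
    show "iid_sample.dev_power (M n) (X n) (p n) \<le> K * real n" by (rule dev_power[OF n])
    have "\<bar>K1\<bar> \<le> K" using B(1) C by (simp add: K_def)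
    then show "real (p n) \<le> K * real n"
      using p_le[OF n] mult_right_mono[of "\<bar>K1\<bar>" K "real n"] by simp
  next
    show "1 \<le> K" using C CK by simp
    show "(\<lambda>n. real (N n) / real n) \<longlonglongrightarrow> 0" using A3 by (rule smalloD_tendsto)
  qed
  show ?thesis
    unfolding S_star_def \<Sigma>_star_def S_def Z_def \<Sigma>_def
    using L1_null_imp_mean_tends_to_zero[OF sample_sequence.estimator_distance_null[OF seq]]
      L1_null_imp_mean_tends_to_zero[OF sample_sequence.loss_difference_null[OF seq]]
    by blast
qed

end
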